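(* Let $\phi:G\to H$ be a homomorphism between two Riemannian Lie groups such that $R^H\le0$ (i.e. $H$ has nonpositive sectional curvature) and the Lie algebra $\mathfrak g$ of $G$ is unimodular. Then $\phi$ is harmonic if and only if it is biharmonic.
   Context: All Lie groups are real and connected. A Riemannian Lie group is a Lie group with a left invariant Riemannian metric. $\mathfrak g$ is unimodular if $\mathrm{tr}(\mathrm{ad}_u)=0$ for all $u\in\mathfrak g$. For a smooth map $\phi:(M,g)\to(N,h)$ of Riemannian manifolds and a local orthonormal frame $(E_i)$ of $TM$, the tension field is $\tau(\phi)=\sum_i(\nabla_{E_i}d\phi)(E_i)$, and the bitension field is $\tau_2(\phi)=-\sum_i\big((\nabla^\phi)^2_{E_i,E_i}\tau(\phi)+R^N(\tau(\phi),d\phi(E_i))d\phi(E_i)\big)$, where $\nabla^\phi$ is the pull-back of the Levi-Civita connection of $N$, $(\nabla^\phi)^2_{X,Y}=\nabla^\phi_X\nabla^\phi_Y-\nabla^\phi_{\nabla^M_XY}$ and $R^N(X,Y)=\nabla_X\nabla_Y-\nabla_Y\nabla_X-\nabla_{[X,Y]}$. The map $\phi$ is harmonic if $\tau(\phi)=0$ and biharmonic if $\tau_2(\phi)=0$. *)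

theory Defs
  imports "HOL-Analysis.Analysis" "HOL-Algebra.Group"
begin

section \<open>Smooth maps between open subsets of normed spaces\<close>

abbreviation deriv_along :: "('a::real_normed_vector \<Rightarrow> 'b::real_normed_vector) \<Rightarrow> 'a \<Rightarrow> 'a \<Rightarrow> 'b"
  where "deriv_along f x v \<equiv> frechet_derivative f (at x) v"

text \<open>Both notions are meant for open \<open>S\<close> and a finite-dimensional domain, where this is the
  usual class \<open>C\<^sup>k\<close>.\<close>

primrec Ck_on :: "nat \<Rightarrow> 'a::real_normed_vector set \<Rightarrow> ('a \<Rightarrow> 'b::real_normed_vector) \<Rightarrow> bool" where
  "Ck_on 0 S f \<longleftrightarrow> continuous_on S f"
| "Ck_on (Suc k) S f \<longleftrightarrow>
     (\<forall>x\<in>S. f differentiable (at x)) \<and> (\<forall>v. Ck_on k S (\<lambda>x. deriv_along f x v))"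

definition smooth_on :: "'a::real_normed_vector set \<Rightarrow> ('a \<Rightarrow> 'b::real_normed_vector) \<Rightarrow> bool"
  where "smooth_on S f \<longleftrightarrow> (\<forall>k. Ck_on k S f)"

section \<open>Manifolds\<close>

text \<open>A chart is a pair of its domain and its coordinate map. The model space \<open>'e\<close> is a
  real inner product space that is required to be finite-dimensional in \<open>smooth_manifold\<close>.
  The class \<^class>\<open>euclidean_space\<close> is not used for it because its instances have positive
  dimension, whereas manifolds (and Lie groups) may have dimension \<open>0\<close>. The inner product of the
  model space plays no role besides providing the norm.\<close>

type_synonym ('p, 'e) chart = "'p set \<times> ('p \<Rightarrow> 'e)"

record ('p, 'e) manifold =
  mtop :: "'p topology"
  atlas :: "('p, 'e) chart set"

abbreviation points :: "('p, 'e, 'x) manifold_scheme \<Rightarrow> 'p set"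
  where "points M \<equiv> topspace (mtop M)"

definition chart_range :: "('p, 'e) chart \<Rightarrow> 'e set"
  where "chart_range c = snd c ` fst c"

definition chart_inv :: "('p, 'e) chart \<Rightarrow> 'e \<Rightarrow> 'p"
  where "chart_inv c = inv_into (fst c) (snd c)"

definition chart_of :: "'p topology \<Rightarrow> ('p, 'e::real_normed_vector) chart \<Rightarrow> bool"
  where "chart_of T c \<longleftrightarrow> openin T (fst c) \<and> open (chart_range c) \<and>
    homeomorphic_map (subtopology T (fst c)) (top_of_set (chart_range c)) (snd c)"

definition smooth_manifold :: "('p, 'e::real_inner, 'x) manifold_scheme \<Rightarrow> bool"
  where "smooth_manifold M \<longleftrightarrow>
    (\<exists>B::'e set. finite B \<and> span B = UNIV) \<and>
    Hausdorff_space (mtop M) \<and> second_countable (mtop M) \<and>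
    (\<forall>c\<in>atlas M. chart_of (mtop M) c) \<and>
    (\<Union>c\<in>atlas M. fst c) = points M \<and>
    (\<forall>c\<in>atlas M. \<forall>d\<in>atlas M.
       smooth_on (snd c ` (fst c \<inter> fst d)) (snd d \<circ> chart_inv c))"

definition product_manifold ::
    "('p, 'e, 'x) manifold_scheme \<Rightarrow> ('q, 'f, 'y) manifold_scheme \<Rightarrow> ('p \<times> 'q, 'e \<times> 'f) manifold"
  where "product_manifold M N =
    \<lparr> mtop = prod_topology (mtop M) (mtop N),
      atlas = {(fst c \<times> fst d, map_prod (snd c) (snd d)) |c d. c \<in> atlas M \<and> d \<in> atlas N} \<rparr>"

definition smooth_map ::
    "('p, 'e::real_inner, 'x) manifold_scheme \<Rightarrow> ('q, 'f::real_inner, 'y) manifold_scheme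
      \<Rightarrow> ('p \<Rightarrow> 'q) \<Rightarrow> bool"
  where "smooth_map M N \<phi> \<longleftrightarrow> continuous_map (mtop M) (mtop N) \<phi> \<and>
    (\<forall>c\<in>atlas M. \<forall>d\<in>atlas N.
       smooth_on (snd c ` {p \<in> fst c. \<phi> p \<in> fst d}) (snd d \<circ> \<phi> \<circ> chart_inv c))"

section \<open>Tangent vectors and vector fields\<close>

text \<open>A chart around every point is fixed once and for all. The tangent space at \<open>p\<close> is the model
  space \<open>'e\<close>, an element of which stands for the tangent vector having these components in the
  chart \<open>chart_at M p\<close>. Vector fields are functions \<open>'p \<Rightarrow> 'e\<close>, and vector fields along a map
  \<open>\<phi>\<close> into \<open>N\<close> (sections of the pull-back of the tangent bundle of \<open>N\<close>) are functions
  \<open>'p \<Rightarrow> 'f\<close>, the value at \<open>p\<close> being a tangent vector of \<open>N\<close> at \<open>\<phi> p\<close>.\<close>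

definition chart_at :: "('p, 'e, 'x) manifold_scheme \<Rightarrow> 'p \<Rightarrow> ('p, 'e) chart"
  where "chart_at M p = (SOME c. c \<in> atlas M \<and> p \<in> fst c)"

text \<open>Components in an arbitrary chart \<open>c\<close> of the tangent vector \<open>u\<close> at \<open>p\<close>, and conversely the
  tangent vector at \<open>p\<close> with components \<open>w\<close> in the chart \<open>c\<close>.\<close>

definition tangent_components ::
    "('p, 'e::real_inner, 'x) manifold_scheme \<Rightarrow> ('p, 'e) chart \<Rightarrow> 'p \<Rightarrow> 'e \<Rightarrow> 'e"
  where "tangent_components M c p u =
    deriv_along (snd c \<circ> chart_inv (chart_at M p)) (snd (chart_at M p) p) u"

definition tangent_from_components ::
    "('p, 'e::real_inner, 'x) manifold_scheme \<Rightarrow> ('p, 'e) chart \<Rightarrow> 'p \<Rightarrow> 'e \<Rightarrow> 'e"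
  where "tangent_from_components M c p w =
    deriv_along (snd (chart_at M p) \<circ> chart_inv c) (snd c p) w"

definition smooth_vector_field_on ::
    "('p, 'e::real_inner, 'x) manifold_scheme \<Rightarrow> 'p set \<Rightarrow> ('p \<Rightarrow> 'e) \<Rightarrow> bool"
  where "smooth_vector_field_on M U X \<longleftrightarrow>
    (\<forall>c\<in>atlas M. smooth_on (snd c ` (fst c \<inter> U))
       (\<lambda>x. tangent_components M c (chart_inv c x) (X (chart_inv c x))))"

definition differential ::
    "('p, 'e::real_inner, 'x) manifold_scheme \<Rightarrow> ('q, 'f::real_inner, 'y) manifold_scheme
      \<Rightarrow> ('p \<Rightarrow> 'q) \<Rightarrow> 'p \<Rightarrow> 'e \<Rightarrow> 'f"
  where "differential M N \<phi> p u =
    deriv_along (snd (chart_at N (\<phi> p)) \<circ> \<phi> \<circ> chart_inv (chart_at M p)) (snd (chart_at M p) p) u"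

definition lie_bracket ::
    "('p, 'e::real_inner, 'x) manifold_scheme \<Rightarrow> ('p \<Rightarrow> 'e) \<Rightarrow> ('p \<Rightarrow> 'e) \<Rightarrow> 'p \<Rightarrow> 'e"
  where "lie_bracket M X Y p =
    (let c = chart_at M p;
         loc = (\<lambda>Z x. tangent_components M c (chart_inv c x) (Z (chart_inv c x)))
     in deriv_along (loc Y) (snd c p) (X p) - deriv_along (loc X) (snd c p) (Y p))"

section \<open>Riemannian manifolds and the Levi-Civita connection\<close>

record ('p, 'e) riem_manifold = "('p, 'e) manifold" +
  riem_metric :: "'p \<Rightarrow> 'e \<Rightarrow> 'e \<Rightarrow> real"

definition metric_in_chart ::
    "('p, 'e::real_inner, 'x) riem_manifold_scheme \<Rightarrow> ('p, 'e) chart \<Rightarrow> 'e \<Rightarrow> 'e \<Rightarrow> 'e \<Rightarrow> real"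
  where "metric_in_chart M c x u v =
    (let p = chart_inv c x in riem_metric M p (tangent_from_components M c p u) (tangent_from_components M c p v))"

definition riemannian_manifold :: "('p, 'e::real_inner, 'x) riem_manifold_scheme \<Rightarrow> bool"
  where "riemannian_manifold M \<longleftrightarrow> smooth_manifold M \<and>
    (\<forall>p\<in>points M. bilinear (riem_metric M p) \<and>
       (\<forall>u v. riem_metric M p u v = riem_metric M p v u) \<and> (\<forall>u. u \<noteq> 0 \<longrightarrow> 0 < riem_metric M p u u)) \<and>
    (\<forall>c\<in>atlas M. \<forall>u v. smooth_on (chart_range c) (\<lambda>x. metric_in_chart M c x u v))"

text \<open>Christoffel symbols of the Levi-Civita connection in the chart \<open>c\<close> at the coordinate point
  \<open>x\<close>: in the chart the connection is \<open>\<nabla>\<^sub>u Y = DY(u) + \<Gamma>(u, Y)\<close>. It is torsion-free iff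
  \<open>\<Gamma>\<close> is symmetric, and the last conjunct says that it is compatible with the metric.\<close>

definition christoffel ::
    "('p, 'e::real_inner, 'x) riem_manifold_scheme \<Rightarrow> ('p, 'e) chart \<Rightarrow> 'e \<Rightarrow> 'e \<Rightarrow> 'e \<Rightarrow> 'e"
  where "christoffel M c x = (THE \<Gamma>. bilinear \<Gamma> \<and> (\<forall>u v. \<Gamma> u v = \<Gamma> v u) \<and>
    (\<forall>u v w. deriv_along (\<lambda>y. metric_in_chart M c y v w) x u =
       metric_in_chart M c x (\<Gamma> u v) w + metric_in_chart M c x v (\<Gamma> u w)))"

text \<open>\<open>pullback_conn M N \<phi> p u V\<close> is the covariant derivative at \<open>p\<close>, in the direction of the
  tangent vector \<open>u\<close> of \<open>M\<close>, of the vector field \<open>V\<close> along \<open>\<phi>\<close>, for the pull-back by \<open>\<phi>\<close> of the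
  Levi-Civita connection of \<open>N\<close>.\<close>

definition pullback_conn ::
    "('p, 'e::real_inner, 'x) manifold_scheme \<Rightarrow> ('q, 'f::real_inner, 'y) riem_manifold_scheme
      \<Rightarrow> ('p \<Rightarrow> 'q) \<Rightarrow> 'p \<Rightarrow> 'e \<Rightarrow> ('p \<Rightarrow> 'f) \<Rightarrow> 'f"
  where "pullback_conn M N \<phi> p u V =
    (let c = chart_at M p; d = chart_at N (\<phi> p)
     in deriv_along (\<lambda>x. tangent_components N d (\<phi> (chart_inv c x)) (V (chart_inv c x))) (snd c p) u
        + christoffel N d (snd d (\<phi> p)) (differential M N \<phi> p u) (V p))"

text \<open>The Levi-Civita connection itself is the pull-back along the identity.\<close>

definition levi_civita ::
    "('p, 'e::real_inner, 'x) riem_manifold_scheme \<Rightarrow> ('p \<Rightarrow> 'e) \<Rightarrow> ('p \<Rightarrow> 'e) \<Rightarrow> 'p \<Rightarrow> 'e"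
  where "levi_civita M X Y p = pullback_conn M M (\<lambda>q. q) p (X p) Y"

section \<open>Curvature\<close>

definition curvature_of_fields ::
    "('p, 'e::real_inner, 'x) riem_manifold_scheme
      \<Rightarrow> ('p \<Rightarrow> 'e) \<Rightarrow> ('p \<Rightarrow> 'e) \<Rightarrow> ('p \<Rightarrow> 'e) \<Rightarrow> 'p \<Rightarrow> 'e"
  where "curvature_of_fields M X Y Z p =
    levi_civita M X (levi_civita M Y Z) p - levi_civita M Y (levi_civita M X Z) p
    - levi_civita M (lie_bracket M X Y) Z p"

text \<open>The curvature is tensorial, so its value at \<open>p\<close> on tangent vectors may be computed with any
  local vector fields extending them; the ones used have constant components in \<open>chart_at M p\<close>.\<close>

definition extend_vector ::
    "('p, 'e::real_inner, 'x) manifold_scheme \<Rightarrow> 'p \<Rightarrow> 'e \<Rightarrow> 'p \<Rightarrow> 'e"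
  where "extend_vector M p u q = tangent_from_components M (chart_at M p) q u"

definition curvature ::
    "('p, 'e::real_inner, 'x) riem_manifold_scheme \<Rightarrow> 'p \<Rightarrow> 'e \<Rightarrow> 'e \<Rightarrow> 'e \<Rightarrow> 'e"
  where "curvature M p u v w =
    curvature_of_fields M (extend_vector M p u) (extend_vector M p v) (extend_vector M p w) p"

definition sectional_curvature ::
    "('p, 'e::real_inner, 'x) riem_manifold_scheme \<Rightarrow> 'p \<Rightarrow> 'e \<Rightarrow> 'e \<Rightarrow> real"
  where "sectional_curvature M p u v =
    riem_metric M p (curvature M p u v v) u /
      (riem_metric M p u u * riem_metric M p v v - (riem_metric M p u v)\<^sup>2)"

definition nonpositive_sectional_curvature :: "('p, 'e::real_inner, 'x) riem_manifold_scheme \<Rightarrow> bool"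
  where "nonpositive_sectional_curvature M \<longleftrightarrow>
    (\<forall>p\<in>points M. \<forall>u v. u \<noteq> v \<and> independent {u, v} \<longrightarrow> sectional_curvature M p u v \<le> 0)"

section \<open>Harmonic and biharmonic maps\<close>

definition orthonormal_frame_on ::
    "('p, 'e::real_inner, 'x) riem_manifold_scheme \<Rightarrow> 'p set \<Rightarrow> (nat \<Rightarrow> 'p \<Rightarrow> 'e) \<Rightarrow> bool"
  where "orthonormal_frame_on M U E \<longleftrightarrow> openin (mtop M) U \<and>
    (\<forall>i < dim (UNIV::'e set). smooth_vector_field_on M U (E i)) \<and>
    (\<forall>p\<in>U. \<forall>i < dim (UNIV::'e set). \<forall>j < dim (UNIV::'e set).
       riem_metric M p (E i p) (E j p) = (if i = j then 1 else 0))"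

text \<open>The tension and bitension fields do not depend on the local orthonormal frame, so at every
  point some frame on a neighbourhood of that point is used.\<close>

definition local_frame ::
    "('p, 'e::real_inner, 'x) riem_manifold_scheme \<Rightarrow> 'p \<Rightarrow> nat \<Rightarrow> 'p \<Rightarrow> 'e"
  where "local_frame M p = (SOME E. \<exists>U. p \<in> U \<and> orthonormal_frame_on M U E)"

text \<open>\<open>(\<nabla>\<^sub>X d\<phi>)(Y)\<close>\<close>

definition second_fundamental_form ::
    "('p, 'e::real_inner, 'x) riem_manifold_scheme \<Rightarrow> ('q, 'f::real_inner, 'y) riem_manifold_scheme
      \<Rightarrow> ('p \<Rightarrow> 'q) \<Rightarrow> ('p \<Rightarrow> 'e) \<Rightarrow> ('p \<Rightarrow> 'e) \<Rightarrow> 'p \<Rightarrow> 'f"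
  where "second_fundamental_form M N \<phi> X Y p =
    pullback_conn M N \<phi> p (X p) (\<lambda>q. differential M N \<phi> q (Y q))
    - differential M N \<phi> p (levi_civita M X Y p)"

definition tension ::
    "('p, 'e::real_inner, 'x) riem_manifold_scheme \<Rightarrow> ('q, 'f::real_inner, 'y) riem_manifold_scheme
      \<Rightarrow> ('p \<Rightarrow> 'q) \<Rightarrow> 'p \<Rightarrow> 'f"
  where "tension M N \<phi> p = (let E = local_frame M p in
    \<Sum>i < dim (UNIV::'e set). second_fundamental_form M N \<phi> (E i) (E i) p)"

text \<open>\<open>(\<nabla>\<^sup>\<phi>)\<^sup>2\<^sub>X\<^sub>,\<^sub>Y V\<close>\<close>

definition second_pullback_derivative ::
    "('p, 'e::real_inner, 'x) riem_manifold_scheme \<Rightarrow> ('q, 'f::real_inner, 'y) riem_manifold_scheme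
      \<Rightarrow> ('p \<Rightarrow> 'q) \<Rightarrow> ('p \<Rightarrow> 'e) \<Rightarrow> ('p \<Rightarrow> 'e) \<Rightarrow> ('p \<Rightarrow> 'f) \<Rightarrow> 'p \<Rightarrow> 'f"
  where "second_pullback_derivative M N \<phi> X Y V p =
    pullback_conn M N \<phi> p (X p) (\<lambda>q. pullback_conn M N \<phi> q (Y q) V)
    - pullback_conn M N \<phi> p (levi_civita M X Y p) V"

definition bitension ::
    "('p, 'e::real_inner, 'x) riem_manifold_scheme \<Rightarrow> ('q, 'f::real_inner, 'y) riem_manifold_scheme
      \<Rightarrow> ('p \<Rightarrow> 'q) \<Rightarrow> 'p \<Rightarrow> 'f"
  where "bitension M N \<phi> p = (let E = local_frame M p in
    - (\<Sum>i < dim (UNIV::'e set).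
         second_pullback_derivative M N \<phi> (E i) (E i) (tension M N \<phi>) p
         + curvature N (\<phi> p) (tension M N \<phi> p)
             (differential M N \<phi> p (E i p)) (differential M N \<phi> p (E i p))))"

definition harmonic ::
    "('p, 'e::real_inner, 'x) riem_manifold_scheme \<Rightarrow> ('q, 'f::real_inner, 'y) riem_manifold_scheme
      \<Rightarrow> ('p \<Rightarrow> 'q) \<Rightarrow> bool"
  where "harmonic M N \<phi> \<longleftrightarrow> (\<forall>p\<in>points M. tension M N \<phi> p = 0)"

definition biharmonic ::
    "('p, 'e::real_inner, 'x) riem_manifold_scheme \<Rightarrow> ('q, 'f::real_inner, 'y) riem_manifold_scheme
      \<Rightarrow> ('p \<Rightarrow> 'q) \<Rightarrow> bool"
  where "biharmonic M N \<phi> \<longleftrightarrow> (\<forall>p\<in>points M. bitension M N \<phi> p = 0)"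

section \<open>Lie groups\<close>

definition lie_group :: "('p, 'm) monoid_scheme \<Rightarrow> ('p, 'e::real_inner, 'x) manifold_scheme \<Rightarrow> bool"
  where "lie_group G M \<longleftrightarrow> group G \<and> smooth_manifold M \<and> points M = carrier G \<and>
    smooth_map (product_manifold M M) M (\<lambda>(p, q). p \<otimes>\<^bsub>G\<^esub> q) \<and>
    smooth_map M M (\<lambda>p. inv\<^bsub>G\<^esub> p)"

definition riemannian_lie_group ::
    "('p, 'm) monoid_scheme \<Rightarrow> ('p, 'e::real_inner, 'x) riem_manifold_scheme \<Rightarrow> bool"
  where "riemannian_lie_group G M \<longleftrightarrow> lie_group G M \<and> riemannian_manifold M \<and>
    (\<forall>a\<in>carrier G. \<forall>p\<in>carrier G. \<forall>u v.
       riem_metric M (a \<otimes>\<^bsub>G\<^esub> p) (differential M M (\<lambda>q. a \<otimes>\<^bsub>G\<^esub> q) p u)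
                     (differential M M (\<lambda>q. a \<otimes>\<^bsub>G\<^esub> q) p v) = riem_metric M p u v)"

text \<open>The Lie algebra of \<open>G\<close> is the tangent space at the unit with the bracket of left invariant
  vector fields.\<close>

definition left_invariant_field ::
    "('p, 'm) monoid_scheme \<Rightarrow> ('p, 'e::real_inner, 'x) manifold_scheme \<Rightarrow> 'e \<Rightarrow> 'p \<Rightarrow> 'e"
  where "left_invariant_field G M u p = differential M M (\<lambda>q. p \<otimes>\<^bsub>G\<^esub> q) \<one>\<^bsub>G\<^esub> u"

definition lie_ad ::
    "('p, 'm) monoid_scheme \<Rightarrow> ('p, 'e::real_inner, 'x) manifold_scheme \<Rightarrow> 'e \<Rightarrow> 'e \<Rightarrow> 'e"
  where "lie_ad G M u v =
    lie_bracket M (left_invariant_field G M u) (left_invariant_field G M v) \<one>\<^bsub>G\<^esub>"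

definition endo_trace :: "('e::real_vector \<Rightarrow> 'e) \<Rightarrow> real"
  where "endo_trace f = (let B = (SOME B. independent B \<and> span B = UNIV) in
    \<Sum>b\<in>B. representation B (f b) b)"

definition unimodular_lie_algebra ::
    "('p, 'm) monoid_scheme \<Rightarrow> ('p, 'e::real_inner, 'x) manifold_scheme \<Rightarrow> bool"
  where "unimodular_lie_algebra G M \<longleftrightarrow> (\<forall>u. endo_trace (lie_ad G M u) = 0)"

end

(* Everything is evaluated at the units of the two groups. Left invariance makes the Levi-Civita
connection of a left invariant metric a bilinear map on the Lie algebra, skew in its second
argument, and expanding an arbitrary orthonormal frame in a left invariant one shows that
the tension field of \<phi> is left invariant along \<phi>, with value t at the unit. Let f be the
differential of \<phi> at the unit and (e_i) an orthonormal basis of the Lie algebra of G. Unimodularity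
says that sum_i nabla_(e_i) e_i = 0, so t = sum_i nabla_(f e_i) (f e_i), and the scalar product
of the bitension field with t is
sum_i (|nabla_(f e_i) t|^2 - <R(t, f e_i) f e_i, t>), a sum of nonnegative terms. If it vanishes then
nabla_(f e_i) t = 0 for all i, and |t|^2 = - sum_i <f e_i, nabla_(f e_i) t> = 0. *)

theory Submission
  imports Defs
begin

text \<open>Tension and bitension are defined with an arbitrary frame near each point, and
  derivatives are taken in arbitrarily chosen charts, so the obstacle is to reach the Lie algebra at
  all. Such a frame is a combination of left invariant fields with variable coefficients. The
  derivatives of these coefficients enter the second fundamental form and the second pull-back
  derivative twice, with opposite signs, and cancel. What survives at \<open>p\<close> is an
  orthonormal basis that depends on \<open>p\<close>, and the trace of a bilinear map does not see
  which basis it is.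

  No integral is taken: the tension field has constant length, so skewness of the connection turns
  <nabla_X nabla_X t, t> into -|nabla_X t|^2 at a single point.

  The curvature is never expressed by the Lie bracket, as only its sign matters. The hypothesis
  gives the sign for independent pairs. For dependent pairs the vanishing of R(k v, v) is read off
  the Christoffel symbols in a chart; these must be differentiable, which left invariant orthonormal
  frames ensure.\<close>

section \<open>Scalar products on finite-dimensional spaces\<close>

text \<open>A predicate on a type that records the spanning condition of
  \<open>smooth_manifold\<close>; it leaves room for dimension 0.\<close>

definition finite_dimensional :: "'a::real_vector itself \<Rightarrow> bool"
  where "finite_dimensional T \<longleftrightarrow> (\<exists>B::'a set. finite B \<and> span B = UNIV)"

text \<open>A plain function, because neither the metric at a point nor its expression in a chart is
  the inner product of the model space.\<close>

definition scalar_product :: "('a::real_vector \<Rightarrow> 'a \<Rightarrow> real) \<Rightarrow> bool"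
  where "scalar_product g \<longleftrightarrow>
    bilinear g \<and> (\<forall>u v. g u v = g v u) \<and> (\<forall>u. u \<noteq> 0 \<longrightarrow> 0 < g u u)"

definition orthonormal :: "('a::real_vector \<Rightarrow> 'a \<Rightarrow> real) \<Rightarrow> nat \<Rightarrow> (nat \<Rightarrow> 'a) \<Rightarrow> bool"
  where "orthonormal g k E \<longleftrightarrow> (\<forall>i<k. \<forall>j<k. g (E i) (E j) = (if i = j then 1 else 0))"

lemma scalar_product_linear:
  assumes "scalar_product g"
  shows "linear (g u)" "linear (\<lambda>u. g u v)"
  using assms by (auto simp: scalar_product_def bilinear_def)

lemma scalar_product_sym: "scalar_product g \<Longrightarrow> g u v = g v u"
  by (auto simp: scalar_product_def)

lemma scalar_product_simps:
  assumes "scalar_product g"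
  shows "g (u + v) w = g u w + g v w" "g w (u + v) = g w u + g w v"
    "g (r *\<^sub>R u) w = r * g u w" "g w (r *\<^sub>R u) = r * g w u"
    "g 0 w = 0" "g w 0 = 0" "g (u - v) w = g u w - g v w" "g w (u - v) = g w u - g w v"
    "g (- u) w = - g u w" "g w (- u) = - g w u"
    "g (\<Sum>i\<in>I. f i) w = (\<Sum>i\<in>I. g (f i) w)" "g w (\<Sum>i\<in>I. f i) = (\<Sum>i\<in>I. g w (f i))"
  using scalar_product_linear[OF assms]
  by (simp_all add: linear_add linear_0 linear_diff linear_neg linear_sum linear_scale
      linear_add[of "\<lambda>u. g u w"] linear_0[of "\<lambda>u. g u w"] linear_diff[of "\<lambda>u. g u w"]
      linear_neg[of "\<lambda>u. g u w"] linear_sum[of "\<lambda>u. g u w"] linear_scale[of "\<lambda>u. g u w"])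

lemma scalar_product_nonneg: "scalar_product g \<Longrightarrow> 0 \<le> g u u"
  by (cases "u = 0") (auto simp: scalar_product_simps scalar_product_def intro: less_imp_le)

lemma scalar_product_eq_0: "scalar_product g \<Longrightarrow> g u u = 0 \<Longrightarrow> u = 0"
  by (metis scalar_product_def less_irrefl)

lemma scalar_product_eqI:
  assumes "scalar_product g" "\<And>w. g u w = g v w"
  shows "u = v"
proof -
  have "g (u - v) (u - v) = 0"
    using assms by (simp add: scalar_product_simps)
  then show ?thesis using scalar_product_eq_0[OF assms(1)] by fastforce
qed

text \<open>By independence \<open>u\<close> minus its projection to the line of \<open>v\<close> is
  nonzero, hence of positive square. The strict form makes the denominator of the sectional
  curvature positive.\<close>

lemma scalar_product_cauchy_schwarz:
  assumes g: "scalar_product g" and "independent {u, v}" "u \<noteq> v"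
  shows "(g u v)\<^sup>2 < g u u * g v v"
proof -
  have v0: "v \<noteq> 0" using assms dependent_zero by blast
  let ?c = "g u v / g v v"
  have "u - ?c *\<^sub>R v \<noteq> 0"
  proof
    assume "u - ?c *\<^sub>R v = 0"
    then have "u = ?c *\<^sub>R v" by simp
    then have "u \<in> span {v}" by (metis singletonI span_base span_scale)
    then show False using assms(2,3) by (simp add: independent_insert)
  qed
  then have "0 < g (u - ?c *\<^sub>R v) (u - ?c *\<^sub>R v)"
    using g by (auto simp: scalar_product_def)
  also have "\<dots> = g u u - (g u v)\<^sup>2 / g v v"
    using g v0 scalar_product_sym[OF g, of v u]
    by (simp add: scalar_product_simps power2_eq_square scalar_product_def field_simps)
  finally show ?thesis
    using g v0 by (simp add: scalar_product_def field_simps)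
qed

text \<open>One Gram-Schmidt step: a vector that is not its own projection leaves a nonzero
  remainder, which is normalised and appended.\<close>

lemma orthonormal_extend:
  assumes g: "scalar_product g" and E: "orthonormal g k E"
    and v: "v \<noteq> (\<Sum>i<k. g v (E i) *\<^sub>R E i)"
  shows "\<exists>E'. orthonormal g (Suc k) E'"
proof -
  define r where "r = v - (\<Sum>i<k. g v (E i) *\<^sub>R E i)"
  have r0: "0 < g r r" using v g by (auto simp: r_def scalar_product_def)
  have orth: "g r (E j) = 0" if "j < k" for j
  proof -
    have "(\<Sum>i<k. g v (E i) * g (E i) (E j)) = (\<Sum>i<k. if i = j then g v (E i) else 0)"
      using E that by (intro sum.cong) (auto simp: orthonormal_def)
    then show ?thesis using that
      by (simp add: r_def scalar_product_simps[OF g])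
  qed
  define E' where "E' = E(k := (1 / sqrt (g r r)) *\<^sub>R r)"
  have "orthonormal g (Suc k) E'"
    using E orth r0 scalar_product_sym[OF g, of "E _" r]
    by (auto simp: orthonormal_def E'_def less_Suc_eq scalar_product_simps[OF g])
  then show ?thesis by blast
qed

lemma orthonormal_independent:
  assumes g: "scalar_product g" and E: "orthonormal g k E"
  shows "independent (E ` {..<k})" "card (E ` {..<k}) = k"
proof -
  have inj: "inj_on E {..<k}"
    using E by (auto simp: orthonormal_def inj_on_def) (metis zero_neq_one)
  then show "card (E ` {..<k}) = k" by (simp add: card_image)
  show "independent (E ` {..<k})"
  proof (rule independent_if_scalars_zero)
    fix f x assume s: "(\<Sum>x\<in>E ` {..<k}. f x *\<^sub>R x) = 0" and "x \<in> E ` {..<k}"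
    then obtain j where j: "j < k" "x = E j" by auto
    have "0 = g (\<Sum>i<k. f (E i) *\<^sub>R E i) (E j)"
      using s by (simp add: sum.reindex[OF inj] scalar_product_simps[OF g])
    also have "\<dots> = (\<Sum>i<k. if i = j then f (E i) else 0)"
      unfolding scalar_product_simps[OF g]
      using E j by (intro sum.cong) (auto simp: orthonormal_def)
    finally show "f x = 0" using j by simp
  qed simp
qed

lemma finite_dimensional_independent:
  assumes "finite_dimensional TYPE('a::real_vector)" and "independent (S::'a set)"
  shows "finite S" "card S \<le> dim (UNIV::'a set)"
proof -
  obtain B where B: "finite (B::'a set)" "span B = UNIV"
    using assms by (auto simp: finite_dimensional_def)
  obtain C where C: "S \<subseteq> C" "independent C" "UNIV \<subseteq> span C"
    using maximal_independent_subset_extend[of S UNIV] assms(2) by auto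
  have "finite C" using independent_span_bound[OF B(1) C(2)] B(2) by auto
  moreover have "card C = dim (UNIV::'a set)"
    using basis_card_eq_dim[OF _ C(3) C(2)] by simp
  ultimately show "finite S" "card S \<le> dim (UNIV::'a set)"
    using C(1) by (auto intro: finite_subset dest: card_mono)
qed

text \<open>A vector without such an expansion would allow one more orthonormal vector, hence more
  independent vectors than the dimension.\<close>

lemma orthonormal_expansion:
  assumes fd: "finite_dimensional TYPE('a::real_vector)"
    and g: "scalar_product (g :: 'a \<Rightarrow> 'a \<Rightarrow> real)" and E: "orthonormal g (dim (UNIV::'a set)) E"
  shows "v = (\<Sum>i<dim (UNIV::'a set). g v (E i) *\<^sub>R E i)"
proof (rule ccontr)
  assume "v \<noteq> (\<Sum>i<dim (UNIV::'a set). g v (E i) *\<^sub>R E i)"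
  then obtain E' where "orthonormal g (Suc (dim (UNIV::'a set))) E'"
    using orthonormal_extend[OF g E] by blast
  from orthonormal_independent[OF g this] finite_dimensional_independent(2)[OF fd]
  show False by (metis not_less_eq_eq order_refl)
qed

text \<open>If every vector already equals its projection, the \<open>k\<close> vectors span the
  space and \<open>k\<close> has reached the dimension; otherwise a Gram-Schmidt step
  applies.\<close>

lemma orthonormal_exists:
  assumes fd: "finite_dimensional TYPE('a::real_vector)"
    and g: "scalar_product (g :: 'a \<Rightarrow> 'a \<Rightarrow> real)"
  obtains E where "orthonormal g (dim (UNIV::'a set)) E"
proof -
  have "\<exists>E. orthonormal g k E" if "k \<le> dim (UNIV::'a set)" for k
    using that
  proof (induction k)
    case 0
    then show ?case by (simp add: orthonormal_def)
  next
    case (Suc k)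
    then obtain E where E: "orthonormal g k E" by auto
    show ?case
    proof (cases "\<forall>v. v = (\<Sum>i<k. g v (E i) *\<^sub>R E i)")
      case True
      have "UNIV \<subseteq> span (E ` {..<k})"
      proof
        fix v :: 'a
        have "(\<Sum>i<k. g v (E i) *\<^sub>R E i) \<in> span (E ` {..<k})"
          by (intro span_sum span_scale span_base) auto
        then show "v \<in> span (E ` {..<k})" using True by metis
      qed
      then have "dim (UNIV::'a set) \<le> k"
        using dim_le_card[of UNIV "E ` {..<k}"] orthonormal_independent(2)[OF g E] by simp
      then show ?thesis using Suc.prems by simp
    next
      case False
      then show ?thesis using orthonormal_extend[OF g E] by blast
    qed
  qed
  then show ?thesis using that by blast
qed

lemma orthonormal_parseval:
  assumes fd: "finite_dimensional TYPE('a::real_vector)"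
    and g: "scalar_product (g :: 'a \<Rightarrow> 'a \<Rightarrow> real)" and E: "orthonormal g (dim (UNIV::'a set)) E"
  shows "(\<Sum>i<dim (UNIV::'a set). g u (E i) * g v (E i)) = g u v"
proof -
  have "g u v = g (\<Sum>i<dim (UNIV::'a set). g u (E i) *\<^sub>R E i) v"
    using orthonormal_expansion[OF assms, of u] by simp
  also have "\<dots> = (\<Sum>i<dim (UNIV::'a set). g u (E i) * g v (E i))"
    unfolding scalar_product_simps[OF g] using scalar_product_sym[OF g] by (intro sum.cong) auto
  finally show ?thesis by simp
qed

section \<open>Traces in orthonormal bases\<close>

lemma bilinear_simps:
  assumes "bilinear h"
  shows "h (u + v) w = h u w + h v w" "h w (u + v) = h w u + h w v"
    "h (r *\<^sub>R u) w = r *\<^sub>R h u w" "h w (r *\<^sub>R u) = r *\<^sub>R h w u"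
    "h 0 w = 0" "h w 0 = 0" 
    "h (\<Sum>i\<in>I. f i) w = (\<Sum>i\<in>I. h (f i) w)" "h w (\<Sum>i\<in>I. f i) = (\<Sum>i\<in>I. h w (f i))"
  using assms unfolding bilinear_def
  by (simp_all add: linear_add linear_0 linear_sum linear_scale
      linear_add[of "\<lambda>u. h u w"] linear_0[of "\<lambda>u. h u w"] 
      linear_sum[of "\<lambda>u. h u w"] linear_scale[of "\<lambda>u. h u w"])

text \<open>Expanding \<open>E i\<close> in \<open>F\<close> produces the matrix with entries
  \<open>g (F j) (E i)\<close>. Parseval for \<open>E\<close> says that its rows are orthonormal,
  which leaves only the diagonal terms.\<close>

lemma orthonormal_trace_independent:
  assumes fd: "finite_dimensional TYPE('a::real_vector)"
    and g: "scalar_product (g :: 'a \<Rightarrow> 'a \<Rightarrow> real)"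
    and E: "orthonormal g (dim (UNIV::'a set)) E" and F: "orthonormal g (dim (UNIV::'a set)) F"
    and h: "bilinear (h :: 'a \<Rightarrow> 'a \<Rightarrow> 'b::real_vector)"
  shows "(\<Sum>i<dim (UNIV::'a set). h (E i) (E i)) = (\<Sum>i<dim (UNIV::'a set). h (F i) (F i))"
proof -
  let ?n = "dim (UNIV::'a set)"
  have "h (E i) (E i) = (\<Sum>j<?n. \<Sum>k<?n. (g (F j) (E i) * g (F k) (E i)) *\<^sub>R h (F j) (F k))" for i
  proof -
    have "h (E i) (E i) =
        h (\<Sum>j<?n. g (E i) (F j) *\<^sub>R F j) (\<Sum>k<?n. g (E i) (F k) *\<^sub>R F k)"
      using orthonormal_expansion[OF fd g F, of "E i"] by simp
    then show ?thesis
      by (simp add: bilinear_simps[OF h] scaleR_sum_right scalar_product_sym[OF g, of "E i"] mult.commute)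
        (subst sum.swap, simp add: mult.commute)
  qed
  then have "(\<Sum>i<?n. h (E i) (E i)) =
      (\<Sum>i<?n. \<Sum>j<?n. \<Sum>k<?n. (g (F j) (E i) * g (F k) (E i)) *\<^sub>R h (F j) (F k))"
    by simp
  also have "\<dots> =
      (\<Sum>j<?n. \<Sum>i<?n. \<Sum>k<?n. (g (F j) (E i) * g (F k) (E i)) *\<^sub>R h (F j) (F k))"
    by (rule sum.swap)
  also have "\<dots> =
      (\<Sum>j<?n. \<Sum>k<?n. \<Sum>i<?n. (g (F j) (E i) * g (F k) (E i)) *\<^sub>R h (F j) (F k))"
    by (rule sum.cong[OF refl], rule sum.swap)
  also have "\<dots> = (\<Sum>j<?n. \<Sum>k<?n. (\<Sum>i<?n. g (F j) (E i) * g (F k) (E i)) *\<^sub>R h (F j) (F k))"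
    by (simp add: scaleR_sum_left)
  also have "\<dots> = (\<Sum>j<?n. \<Sum>k<?n. (if j = k then h (F j) (F k) else 0))"
    unfolding orthonormal_parseval[OF fd g E]
    using F by (intro sum.cong refl) (auto simp: orthonormal_def)
  finally show ?thesis by simp
qed

lemma scalar_product_inner: "scalar_product ((\<bullet>) :: 'a::real_inner \<Rightarrow> 'a \<Rightarrow> real)"
  by (auto simp: scalar_product_def bilinear_def inner_commute inner_add_left inner_add_right
      intro!: linearI)

text \<open>The inner product of the model space serves here to provide a basis that does not vary
  with the point.\<close>

lemma inner_basis:
  assumes "finite_dimensional TYPE('a::real_inner)"
  obtains E :: "nat \<Rightarrow> 'a::real_inner" where "\<And>v. v = (\<Sum>i<dim (UNIV::'a set). (v \<bullet> E i) *\<^sub>R E i)"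
  using orthonormal_exists[OF assms scalar_product_inner]
    orthonormal_expansion[OF assms scalar_product_inner] by metis

text \<open>\<open>endo_trace\<close> sums over an arbitrarily chosen algebraic basis
  \<open>B\<close>. Expanding \<open>f b\<close> in \<open>E\<close>, and then collecting the
  coordinates of \<open>E i\<close> over \<open>B\<close> into \<open>f (E i)\<close>, exchanges the
  two bases.\<close>

lemma endo_trace_orthonormal:
  assumes fd: "finite_dimensional TYPE('a::real_vector)"
    and g: "scalar_product (g :: 'a \<Rightarrow> 'a \<Rightarrow> real)" and E: "orthonormal g (dim (UNIV::'a set)) E"
    and f: "linear f"
  shows "endo_trace f = (\<Sum>i<dim (UNIV::'a set). g (f (E i)) (E i))"
proof -
  let ?n = "dim (UNIV::'a set)"
  define B where "B = (SOME B::'a set. independent B \<and> span B = UNIV)"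
  have "\<exists>B::'a set. independent B \<and> span B = UNIV"
    using maximal_independent_subset[of "UNIV::'a set"] by (metis UNIV_eq_I subsetD UNIV_I)
  from someI_ex[OF this] have B: "independent B" "span B = UNIV"
    unfolding B_def by auto
  have finB: "finite B" using finite_dimensional_independent(1)[OF fd B(1)] .
  have lin: "linear (\<lambda>v. representation B v b)" for b
    by (intro linearI) (simp_all add: representation_add[OF B(1)] representation_scale[OF B(1)] B(2))
  have rep: "v = (\<Sum>b\<in>B. representation B v b *\<^sub>R b)" for v
    using sum_representation_eq[OF B(1) _ finB order_refl, of v] B(2) by simp
  have "endo_trace f = (\<Sum>b\<in>B. representation B (f b) b)"
    by (simp add: endo_trace_def B_def Let_def)
  also have "\<dots> = (\<Sum>b\<in>B. \<Sum>i<?n. g (f b) (E i) * representation B (E i) b)"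
  proof (rule sum.cong[OF refl])
    fix b
    show "representation B (f b) b = (\<Sum>i<?n. g (f b) (E i) * representation B (E i) b)"
      by (subst orthonormal_expansion[OF fd g E, of "f b"])
        (simp add: linear_sum[OF lin] linear_scale[OF lin])
  qed
  also have "\<dots> = (\<Sum>i<?n. \<Sum>b\<in>B. representation B (E i) b * g (f b) (E i))"
    by (subst sum.swap) (simp add: mult.commute)
  also have "\<dots> = (\<Sum>i<?n. g (f (E i)) (E i))"
  proof (rule sum.cong[OF refl])
    fix i
    have "f (E i) = (\<Sum>b\<in>B. representation B (E i) b *\<^sub>R f b)"
      by (subst rep[of "E i"]) (simp add: linear_sum[OF f] linear_scale[OF f])
    then show "(\<Sum>b\<in>B. representation B (E i) b * g (f b) (E i)) = g (f (E i)) (E i)"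
      by (simp add: scalar_product_simps[OF g])
  qed
  finally show ?thesis .
qed

section \<open>Calculus\<close>

lemma deriv_alongI: "(f has_derivative f') (at x) \<Longrightarrow> deriv_along f x v = f' v"
  using frechet_derivative_at by metis

lemma Ck_on_cong:
  assumes "open S" "\<And>x. x \<in> S \<Longrightarrow> f x = g x"
  shows "Ck_on k S f \<longleftrightarrow> Ck_on k S g"
  using assms(2)
proof (induction k arbitrary: f g)
  case 0
  then show ?case by (simp cong: continuous_on_cong)
next
  case (Suc k)
  have d: "(f has_derivative D) (at x) \<longleftrightarrow> (g has_derivative D) (at x)" if "x \<in> S" for x D
    using has_derivative_transform_within_open[OF _ assms(1) that, of _ _ UNIV] Suc.prems by auto
  then have "f differentiable at x \<longleftrightarrow> g differentiable at x"
    "frechet_derivative f (at x) = frechet_derivative g (at x)" if "x \<in> S" for x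
    using that by (auto simp: differentiable_def frechet_derivative_def)
  then show ?case
    using Suc.IH[of "\<lambda>x. deriv_along f x v" "\<lambda>x. deriv_along g x v" for v] by auto
qed

lemma Ck_on_subset: "Ck_on k S f \<Longrightarrow> T \<subseteq> S \<Longrightarrow> Ck_on k T f"
  by (induction k arbitrary: f) (auto intro: continuous_on_subset)

text \<open>The derivative in direction \<open>v\<close> of the composition is the composition of
  the derivative of \<open>f\<close> in direction \<open>L v\<close>, so the induction runs with
  \<open>f\<close> generalised. The affine maps of interest embed the slices of a product.\<close>

lemma Ck_on_affine:
  assumes "open S" and L: "bounded_linear L" and "Ck_on k S f"
  shows "Ck_on k {y. a + L y \<in> S} (\<lambda>y. f (a + L y))"
  using assms(3)
proof (induction k arbitrary: f)
  case 0
  have "continuous_on UNIV (\<lambda>y. a + L y)"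
    using L by (intro continuous_intros linear_continuous_on)
  then show ?case using 0
    by (auto intro!: continuous_on_compose2[of S f _ "\<lambda>y. a + L y"] intro: continuous_on_subset)
next
  case (Suc k)
  let ?S = "{y. a + L y \<in> S}"
  have "open ?S"
    using open_vimage[OF assms(1), of "\<lambda>y. a + L y"] L
    by (simp add: vimage_def continuous_on_add linear_continuous_on)
  have d: "((\<lambda>y. f (a + L y)) has_derivative (\<lambda>v. deriv_along f (a + L y) (L v))) (at y)"
    if "y \<in> ?S" for y
  proof -
    have "(f has_derivative frechet_derivative f (at (a + L y))) (at (a + L y))"
      using that Suc.prems frechet_derivative_works by auto
    moreover have "((\<lambda>y. a + L y) has_derivative L) (at y)"
      using L by (auto intro!: derivative_eq_intros bounded_linear_imp_has_derivative)
    ultimately show ?thesis using diff_chain_at[of "\<lambda>y. a + L y" L y f] by (simp add: o_def)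
  qed
  have "Ck_on k ?S (\<lambda>y. deriv_along (\<lambda>y. f (a + L y)) y v)" for v
  proof -
    have "Ck_on k ?S (\<lambda>y. deriv_along f (a + L y) (L v))"
      using Suc.IH[of "\<lambda>x. deriv_along f x (L v)"] Suc.prems by simp
    then show ?thesis
      by (subst Ck_on_cong[OF \<open>open ?S\<close>, of _ "\<lambda>y. deriv_along f (a + L y) (L v)"])
        (simp_all add: deriv_alongI[OF d])
  qed
  then show ?case using d by (auto simp: differentiable_def)
qed

lemma smooth_on_D:
  assumes "smooth_on S f" "x \<in> S"
  shows "f differentiable (at x)" "(\<lambda>y. deriv_along f y v) differentiable (at x)"
    "(f has_derivative frechet_derivative f (at x)) (at x)"
proof -
  have "Ck_on (Suc (Suc 0)) S f" using assms by (simp add: smooth_on_def)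
  then show "f differentiable (at x)" "(\<lambda>y. deriv_along f y v) differentiable (at x)"
    using assms by auto
  then show "(f has_derivative frechet_derivative f (at x)) (at x)"
    using frechet_derivative_works by auto
qed

lemma smooth_on_cong:
  "open S \<Longrightarrow> (\<And>x. x \<in> S \<Longrightarrow> f x = g x) \<Longrightarrow> smooth_on S f \<longleftrightarrow> smooth_on S g"
  using Ck_on_cong unfolding smooth_on_def by metis

lemma smooth_on_subset: "smooth_on S f \<Longrightarrow> T \<subseteq> S \<Longrightarrow> smooth_on T f"
  using Ck_on_subset unfolding smooth_on_def by metis

lemma smooth_on_deriv_along: "smooth_on S f \<Longrightarrow> smooth_on S (\<lambda>x. deriv_along f x v)"
  unfolding smooth_on_def by (metis Ck_on.simps(2))

lemma smooth_on_slice_right: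
  assumes "open S" "smooth_on S (f :: 'a::real_normed_vector \<times> 'b::real_normed_vector \<Rightarrow> _)"
  shows "smooth_on {y. (x, y) \<in> S} (\<lambda>y. f (x, y))"
  using Ck_on_affine[OF assms(1), of "\<lambda>y. (0, y)" _ f "(x, 0)"] assms(2)
  by (simp add: smooth_on_def bounded_linear_Pair bounded_linear_zero bounded_linear_ident)

lemma smooth_on_slice_left:
  assumes "open S" "smooth_on S (f :: 'a::real_normed_vector \<times> 'b::real_normed_vector \<Rightarrow> _)"
  shows "smooth_on {x. (x, y) \<in> S} (\<lambda>x. f (x, y))"
  using Ck_on_affine[OF assms(1), of "\<lambda>x. (x, 0)" _ f "(0, y)"] assms(2)
  by (simp add: smooth_on_def bounded_linear_Pair bounded_linear_zero bounded_linear_ident)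

section \<open>Symmetry of second derivatives\<close>

lemma has_derivative_line:
  assumes "f differentiable (at (a + s *\<^sub>R v))"
  shows "((\<lambda>s. f (a + s *\<^sub>R v)) has_vector_derivative deriv_along f (a + s *\<^sub>R v) v) (at s)"
proof -
  have f: "(f has_derivative frechet_derivative f (at (a + s *\<^sub>R v))) (at (a + s *\<^sub>R v))"
    using assms frechet_derivative_works by auto
  have "((\<lambda>s. a + s *\<^sub>R v) has_derivative (\<lambda>s. s *\<^sub>R v)) (at s)"
    by (auto intro!: derivative_eq_intros)
  from diff_chain_at[OF this f]
  show ?thesis
    by (simp add: has_vector_derivative_def o_def linear_scale[OF linear_frechet_derivative[OF assms]])
qed

text \<open>The mean value theorem is applied once along \<open>v\<close> and once along
  \<open>w\<close>. It holds for real functions, hence the scalar product with a fixed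
  \<open>z\<close>.\<close>

lemma second_difference_mean_value:
  fixes f :: "'a::real_normed_vector \<Rightarrow> 'b::real_inner"
  assumes f: "Ck_on 2 S f" and h: "0 < h"
    and S: "\<And>s t. 0 \<le> s \<Longrightarrow> s \<le> h \<Longrightarrow> 0 \<le> t \<Longrightarrow> t \<le> h \<Longrightarrow> x + s *\<^sub>R v + t *\<^sub>R w \<in> S"
  obtains s t where "0 \<le> s" "s \<le> h" "0 \<le> t" "t \<le> h"
    "(f (x + h *\<^sub>R v + h *\<^sub>R w) - f (x + h *\<^sub>R v) - f (x + h *\<^sub>R w) + f x) \<bullet> z =
      h\<^sup>2 * (deriv_along (\<lambda>y. deriv_along f y v) (x + s *\<^sub>R v + t *\<^sub>R w) w \<bullet> z)"
proof -
  have d1: "f differentiable (at y)" and d2: "(\<lambda>y. deriv_along f y v) differentiable (at y)"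
    if "y \<in> S" for y
    using f that by (auto simp: numeral_2_eq_2)
  define G where "G s = (f (x + s *\<^sub>R v + h *\<^sub>R w) - f (x + s *\<^sub>R v)) \<bullet> z" for s
  define G' where "G' s = (deriv_along f (x + s *\<^sub>R v + h *\<^sub>R w) v - deriv_along f (x + s *\<^sub>R v) v) \<bullet> z" for s
  have G: "DERIV G s :> G' s" if "0 \<le> s" "s \<le> h" for s
  proof -
    have "((\<lambda>s. f ((x + h *\<^sub>R w) + s *\<^sub>R v)) has_vector_derivative
        deriv_along f ((x + h *\<^sub>R w) + s *\<^sub>R v) v) (at s)"
      by (intro has_derivative_line d1) (use S[of s h] that h in \<open>simp add: ac_simps\<close>)
    moreover have "((\<lambda>s. f (x + s *\<^sub>R v)) has_vector_derivative deriv_along f (x + s *\<^sub>R v) v) (at s)"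
      by (intro has_derivative_line d1) (use S[of s 0] that h in simp)
    ultimately have "((\<lambda>s. f (x + s *\<^sub>R v + h *\<^sub>R w) - f (x + s *\<^sub>R v)) has_vector_derivative
        (deriv_along f (x + s *\<^sub>R v + h *\<^sub>R w) v - deriv_along f (x + s *\<^sub>R v) v)) (at s)"
      by (auto simp: ac_simps intro!: has_vector_derivative_diff)
    from bounded_linear.has_vector_derivative[OF bounded_linear_inner_left this, of z]
    show ?thesis
      unfolding G_def G'_def has_real_derivative_iff_has_vector_derivative .
  qed
  obtain s where s: "0 < s" "s < h" "G h - G 0 = (h - 0) * G' s"
    using MVT2[of 0 h G G'] G h by auto
  define F where "F t = deriv_along f (x + s *\<^sub>R v + t *\<^sub>R w) v \<bullet> z" for t
  define F' where "F' t = deriv_along (\<lambda>y. deriv_along f y v) (x + s *\<^sub>R v + t *\<^sub>R w) w \<bullet> z" for t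
  have F: "DERIV F t :> F' t" if "0 \<le> t" "t \<le> h" for t
  proof -
    have "((\<lambda>t. deriv_along f (x + s *\<^sub>R v + t *\<^sub>R w) v) has_vector_derivative
        deriv_along (\<lambda>y. deriv_along f y v) (x + s *\<^sub>R v + t *\<^sub>R w) w) (at t)"
      by (intro has_derivative_line[where f = "\<lambda>y. deriv_along f y v"] d2)
        (use S[of s t] that s in simp)
    from bounded_linear.has_vector_derivative[OF bounded_linear_inner_left this, of z]
    show ?thesis
      unfolding F_def F'_def has_real_derivative_iff_has_vector_derivative .
  qed
  obtain t where t: "0 < t" "t < h" "F h - F 0 = (h - 0) * F' t"
    using MVT2[of 0 h F F'] F h by auto
  have "G' s = F h - F 0" by (simp add: G'_def F_def inner_diff_left)
  then have "G h - G 0 = h\<^sup>2 * F' t" using s t by (simp add: power2_eq_square)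
  moreover have "G h - G 0 = (f (x + h *\<^sub>R v + h *\<^sub>R w) - f (x + h *\<^sub>R v) - f (x + h *\<^sub>R w) + f x) \<bullet> z"
    by (simp add: G_def inner_diff_left inner_add_left)
  ultimately show ?thesis using that[of s t] s t by (simp add: F'_def)
qed

text \<open>The second difference is symmetric in \<open>v\<close> and \<open>w\<close>, so the two
  mixed derivatives agree, in the direction \<open>z\<close>, at some points of every small
  parallelogram. Continuity carries this to \<open>x\<close>, where \<open>z\<close> is their
  supposed difference.\<close>

lemma second_derivative_symmetric:
  fixes f :: "'a::real_normed_vector \<Rightarrow> 'b::real_inner"
  assumes S: "open S" "x \<in> S" and f: "Ck_on 2 S f"
  shows "deriv_along (\<lambda>y. deriv_along f y v) x w = deriv_along (\<lambda>y. deriv_along f y w) x v"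
proof (rule ccontr)
  define P where "P y = deriv_along (\<lambda>y. deriv_along f y v) y w" for y
  define Q where "Q y = deriv_along (\<lambda>y. deriv_along f y w) y v" for y
  define z where "z = P x - Q x"
  assume "\<not> ?thesis"
  then have "z \<bullet> z > 0" by (simp add: z_def P_def Q_def)
  \<comment> \<open>Half of the gap: two errors, each strictly below \<open>e\<close>, cannot bridge
    a difference of \<open>2 * e\<close>.\<close>
  define e where "e = (z \<bullet> z) / 2"
  have e: "e > 0" using \<open>z \<bullet> z > 0\<close> by (simp add: e_def)
  have PQ: "continuous_on S P" "continuous_on S Q"
    using f by (auto simp: P_def[abs_def] Q_def[abs_def] numeral_2_eq_2)
  then have "isCont P x" "isCont Q x"
    using S continuous_on_eq_continuous_at by blast+
  then have "isCont (\<lambda>y. P y \<bullet> z) x" "isCont (\<lambda>y. Q y \<bullet> z) x"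
    by (auto intro: continuous_intros)
  then obtain d1 d2 where d: "d1 > 0" "d2 > 0"
    and d1: "\<And>y. dist y x < d1 \<Longrightarrow> dist (P y \<bullet> z) (P x \<bullet> z) < e"
    and d2: "\<And>y. dist y x < d2 \<Longrightarrow> dist (Q y \<bullet> z) (Q x \<bullet> z) < e"
    using e unfolding continuous_at_eps_delta by (metis (no_types, lifting))
  obtain d3 where d3: "d3 > 0" "ball x d3 \<subseteq> S" using S openE by blast
  define d where "d = min d1 (min d2 d3)"
  have "d > 0" using d d3 by (simp add: d_def)
  \<comment> \<open>Keeps the parallelogram with sides \<open>h *\<^sub>R v\<close> and
    \<open>h *\<^sub>R w\<close> within distance \<open>d / 2\<close>; the summand 1 avoids division
    by zero.\<close>
  define h where "h = d / (2 * (norm v + norm w + 1))"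
  have nn: "norm v + norm w + 1 > 0" by (simp add: add_nonneg_pos)
  have h: "h > 0" using \<open>d > 0\<close> nn by (simp add: h_def)
  have near: "dist (x + s *\<^sub>R a + t *\<^sub>R b) x < d"
    if "0 \<le> s" "s \<le> h" "0 \<le> t" "t \<le> h" "norm a + norm b = norm v + norm w" for s t a b
  proof -
    have "dist (x + s *\<^sub>R a + t *\<^sub>R b) x = norm (s *\<^sub>R a + t *\<^sub>R b)" by (simp add: dist_norm)
    also have "\<dots> \<le> s * norm a + t * norm b" using norm_triangle_ineq[of "s *\<^sub>R a" "t *\<^sub>R b"] that by simp
    also have "\<dots> \<le> h * norm a + h * norm b" using that by (intro add_mono mult_right_mono) auto
    also have "\<dots> = h * (norm v + norm w)" using that by (simp flip: distrib_left)
    also have "\<dots> \<le> h * (norm v + norm w + 1)" using h by simp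
    also have "\<dots> = d / 2" using nn by (simp add: h_def field_simps)
    finally show ?thesis using \<open>d > 0\<close> by simp
  qed
  have inS: "x + s *\<^sub>R a + t *\<^sub>R b \<in> S"
    if "0 \<le> s" "s \<le> h" "0 \<le> t" "t \<le> h" "norm a + norm b = norm v + norm w" for s t a b
    using near[OF that] d3 by (auto simp: d_def dist_commute)
  obtain s t where st: "0 \<le> s" "s \<le> h" "0 \<le> t" "t \<le> h"
    "(f (x + h *\<^sub>R v + h *\<^sub>R w) - f (x + h *\<^sub>R v) - f (x + h *\<^sub>R w) + f x) \<bullet> z = h\<^sup>2 * (P (x + s *\<^sub>R v + t *\<^sub>R w) \<bullet> z)"
    using second_difference_mean_value[OF f h inS, of v w z] unfolding P_def by auto
  obtain s' t' where st': "0 \<le> s'" "s' \<le> h" "0 \<le> t'" "t' \<le> h"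
    "(f (x + h *\<^sub>R w + h *\<^sub>R v) - f (x + h *\<^sub>R w) - f (x + h *\<^sub>R v) + f x) \<bullet> z = h\<^sup>2 * (Q (x + s' *\<^sub>R w + t' *\<^sub>R v) \<bullet> z)"
    using second_difference_mean_value[OF f h inS, of w v z] unfolding Q_def by (auto simp: add.commute)
  have "h\<^sup>2 * (P (x + s *\<^sub>R v + t *\<^sub>R w) \<bullet> z) = h\<^sup>2 * (Q (x + s' *\<^sub>R w + t' *\<^sub>R v) \<bullet> z)"
    using st(5) st'(5) by (simp add: algebra_simps)
  then have "P (x + s *\<^sub>R v + t *\<^sub>R w) \<bullet> z = Q (x + s' *\<^sub>R w + t' *\<^sub>R v) \<bullet> z"
    using h by simp
  moreover have "dist (P (x + s *\<^sub>R v + t *\<^sub>R w) \<bullet> z) (P x \<bullet> z) < e"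
    using near[OF st(1-4), of v w] by (intro d1) (simp add: d_def)
  moreover have "dist (Q (x + s' *\<^sub>R w + t' *\<^sub>R v) \<bullet> z) (Q x \<bullet> z) < e"
    using near[OF st'(1-4), of w v] by (intro d2) (simp add: d_def)
  moreover have "P x \<bullet> z - Q x \<bullet> z = 2 * e"
    by (simp add: e_def z_def inner_diff_left)
  ultimately show False by (simp add: dist_real_def)
qed

text \<open>The product rule for evaluation \<open>(F, Y) \<mapsto> F Y\<close>, where \<open>F\<close> takes values in linear maps but
  its differentiability is only known pointwise.\<close>

lemma has_derivative_apply:
  fixes F :: "'c::real_normed_vector \<Rightarrow> 'a::real_inner \<Rightarrow> 'b::real_normed_vector"
  assumes fd: "finite_dimensional TYPE('a)"
    and S: "open S" "x \<in> S" "\<And>y. y \<in> S \<Longrightarrow> linear (F y)"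
    and F: "\<And>v. (\<lambda>y. F y v) differentiable (at x)" and Y: "(Y has_derivative Y') (at x)"
  shows "((\<lambda>y. F y (Y y)) has_derivative (\<lambda>u. deriv_along (\<lambda>y. F y (Y x)) x u + F x (Y' u))) (at x)"
proof -
  let ?n = "dim (UNIV::'a set)"
  obtain E :: "nat \<Rightarrow> 'a" where E: "\<And>v. v = (\<Sum>i<?n. (v \<bullet> E i) *\<^sub>R E i)"
    using inner_basis[OF fd] by blast
  \<comment> \<open>In a fixed basis \<open>F y v\<close> is a finite sum of scalars times the
    functions \<open>F y (E i)\<close>, which are differentiable by assumption.\<close>
  have ex: "F y v = (\<Sum>i<?n. (v \<bullet> E i) *\<^sub>R F y (E i))" if "y \<in> S" for y v
    by (subst E[of v]) (simp add: linear_sum[OF S(3)[OF that]] linear_scale[OF S(3)[OF that]])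
  have dF: "((\<lambda>y. F y v) has_derivative (\<lambda>u. deriv_along (\<lambda>y. F y v) x u)) (at x)" for v
    using F frechet_derivative_works by blast
  have 1: "((\<lambda>y. \<Sum>i<?n. (Y y \<bullet> E i) *\<^sub>R F y (E i)) has_derivative
      (\<lambda>u. \<Sum>i<?n. (Y x \<bullet> E i) *\<^sub>R deriv_along (\<lambda>y. F y (E i)) x u + (Y' u \<bullet> E i) *\<^sub>R F x (E i))) (at x)"
    by (intro has_derivative_sum has_derivative_scaleR has_derivative_inner_left Y dF)
  have "((\<lambda>y. \<Sum>i<?n. (Y x \<bullet> E i) *\<^sub>R F y (E i)) has_derivative
      (\<lambda>u. \<Sum>i<?n. (Y x \<bullet> E i) *\<^sub>R deriv_along (\<lambda>y. F y (E i)) x u)) (at x)"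
    by (intro has_derivative_sum has_derivative_scaleR_right dF)
  then have "((\<lambda>y. F y (Y x)) has_derivative
      (\<lambda>u. \<Sum>i<?n. (Y x \<bullet> E i) *\<^sub>R deriv_along (\<lambda>y. F y (E i)) x u)) (at x)"
    by (rule has_derivative_transform_within_open[OF _ S(1,2)]) (simp add: ex[symmetric])
  from deriv_alongI[OF this]
  have 2: "(\<lambda>u. \<Sum>i<?n. (Y x \<bullet> E i) *\<^sub>R deriv_along (\<lambda>y. F y (E i)) x u + (Y' u \<bullet> E i) *\<^sub>R F x (E i)) =
      (\<lambda>u. deriv_along (\<lambda>y. F y (Y x)) x u + F x (Y' u))"
    by (simp add: fun_eq_iff sum.distrib ex[OF S(2), symmetric])
  show ?thesis
    by (rule has_derivative_transform_within_open[OF 1[unfolded 2] S(1,2)]) (simp add: ex[symmetric])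
qed

text \<open>The rule for one argument is used twice: first with the left argument frozen, then with
  the moving right argument absorbed into the linear map.\<close>

lemma has_derivative_apply2:
  fixes g :: "'c::real_normed_vector \<Rightarrow> 'a::real_inner \<Rightarrow> 'a \<Rightarrow> real"
  assumes fd: "finite_dimensional TYPE('a)"
    and S: "open S" "x \<in> S" "\<And>y. y \<in> S \<Longrightarrow> bilinear (g y)"
    and g: "\<And>v w. (\<lambda>y. g y v w) differentiable (at x)"
    and Y: "(Y has_derivative Y') (at x)" and Z: "(Z has_derivative Z') (at x)"
  shows "((\<lambda>y. g y (Y y) (Z y)) has_derivative
    (\<lambda>u. deriv_along (\<lambda>y. g y (Y x) (Z x)) x u + g x (Y' u) (Z x) + g x (Y x) (Z' u))) (at x)"
proof -
  have 1: "((\<lambda>y. g y v (Z y)) has_derivative (\<lambda>u. deriv_along (\<lambda>y. g y v (Z x)) x u + g x v (Z' u))) (at x)" for v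
    using S g by (intro has_derivative_apply[OF fd S(1,2) _ _ Z]) (auto simp: bilinear_def)
  have "((\<lambda>y. g y (Y y) (Z y)) has_derivative
      (\<lambda>u. deriv_along (\<lambda>y. g y (Y x) (Z y)) x u + g x (Y' u) (Z x))) (at x)"
    using S 1 by (intro has_derivative_apply[OF fd S(1,2), of "\<lambda>y v. g y v (Z y)"])
      (auto simp: bilinear_def Y intro: differentiableI[OF 1])
  then show ?thesis
    by (simp add: deriv_alongI[OF 1] add.assoc add.commute add.left_commute)
qed

section \<open>Christoffel symbols in a coordinate domain\<close>

text \<open>The condition under the definite description in \<open>christoffel\<close>, for a metric
  on a coordinate domain.\<close>

definition christoffel_form ::
    "('a::real_normed_vector \<Rightarrow> 'a \<Rightarrow> 'a \<Rightarrow> real) \<Rightarrow> 'a \<Rightarrow> ('a \<Rightarrow> 'a \<Rightarrow> 'a) \<Rightarrow> bool"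
  where "christoffel_form g x \<Gamma> \<longleftrightarrow> bilinear \<Gamma> \<and> (\<forall>u v. \<Gamma> u v = \<Gamma> v u) \<and>
    (\<forall>u v w. deriv_along (\<lambda>y. g y v w) x u = g x (\<Gamma> u v) w + g x v (\<Gamma> u w))"

text \<open>Christoffel symbols of the first kind: the Koszul formula for constant coordinate
  fields, whose brackets vanish.\<close>

definition koszul :: "('a::real_normed_vector \<Rightarrow> 'a \<Rightarrow> 'a \<Rightarrow> real) \<Rightarrow> 'a \<Rightarrow> 'a \<Rightarrow> 'a \<Rightarrow> 'a \<Rightarrow> real"
  where "koszul g x u v w = (deriv_along (\<lambda>y. g y v w) x u + deriv_along (\<lambda>y. g y u w) x v
    - deriv_along (\<lambda>y. g y u v) x w) / 2"

text \<open>In the alternating sum of the three compatibility equations the symmetry of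
  \<open>\<Gamma>\<close> cancels all terms but two equal ones.\<close>

lemma christoffel_form_koszul:
  assumes "christoffel_form g x \<Gamma>" and g: "scalar_product (g x)"
  shows "g x (\<Gamma> u v) w = koszul g x u v w"
proof -
  have s: "\<Gamma> a b = \<Gamma> b a" and
    c: "deriv_along (\<lambda>y. g y b d) x a = g x (\<Gamma> a b) d + g x b (\<Gamma> a d)" for a b d
    using assms(1) unfolding christoffel_form_def by blast+
  show ?thesis
    unfolding koszul_def c
    using s[of u v] s[of u w] s[of v w] scalar_product_sym[OF g, of v] scalar_product_sym[OF g, of u]
    by simp
qed

locale local_metric =
  fixes g :: "'a::real_inner \<Rightarrow> 'a \<Rightarrow> 'a \<Rightarrow> real" and S :: "'a set"
  assumes fd: "finite_dimensional TYPE('a)" and S: "open S"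
    and scalar: "\<And>y. y \<in> S \<Longrightarrow> scalar_product (g y)"
    and smooth: "\<And>v w. smooth_on S (\<lambda>y. g y v w)"
begin

lemma deriv: "y \<in> S \<Longrightarrow> ((\<lambda>y. g y v w) has_derivative (\<lambda>u. deriv_along (\<lambda>y. g y v w) y u)) (at y)"
  using smooth_on_D(3)[OF smooth] .

lemma deriv_linear: "y \<in> S \<Longrightarrow> linear (\<lambda>u. deriv_along (\<lambda>y. g y v w) y u)"
  using has_derivative_bounded_linear[OF deriv] bounded_linear.linear by blast

lemma deriv_sym:
  assumes "y \<in> S"
  shows "deriv_along (\<lambda>y. g y v w) y u = deriv_along (\<lambda>y. g y w v) y u"
  by (rule deriv_alongI)
    (rule has_derivative_transform_within_open[OF deriv[OF assms] S assms], rule scalar_product_sym[OF scalar])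

lemma deriv_add:
  assumes "y \<in> S"
  shows "deriv_along (\<lambda>y. g y v (w + w')) y u = deriv_along (\<lambda>y. g y v w) y u + deriv_along (\<lambda>y. g y v w') y u"
  by (rule deriv_alongI, rule has_derivative_transform_within_open
      [OF has_derivative_add[OF deriv[OF assms, of v w] deriv[OF assms, of v w']] S assms])
    (simp add: scalar_product_simps[OF scalar])

lemma deriv_scale:
  assumes "y \<in> S"
  shows "deriv_along (\<lambda>y. g y v (r *\<^sub>R w)) y u = r * deriv_along (\<lambda>y. g y v w) y u"
  by (rule deriv_alongI, rule has_derivative_transform_within_open
      [OF has_derivative_mult_right[OF deriv[OF assms, of v w]] S assms])
    (simp add: scalar_product_simps[OF scalar])

lemma koszul_linear:
  assumes "y \<in> S"
  shows "linear (\<lambda>u. koszul g y u v w)" "linear (\<lambda>v. koszul g y u v w)" "linear (koszul g y u v)"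
proof -
  note d = deriv_linear[OF assms]
  have sw: "deriv_along (\<lambda>y. g y (a + a') b) y u = deriv_along (\<lambda>y. g y a b) y u + deriv_along (\<lambda>y. g y a' b) y u"
    "deriv_along (\<lambda>y. g y (r *\<^sub>R a) b) y u = r * deriv_along (\<lambda>y. g y a b) y u" for a a' b r u
    by (simp_all only: deriv_sym[OF assms, of "a + a'" b] deriv_sym[OF assms, of "r *\<^sub>R a" b]
        deriv_sym[OF assms, of a b] deriv_sym[OF assms, of a' b] deriv_add[OF assms] deriv_scale[OF assms])
  note simps = koszul_def linear_add[OF d] linear_scale[OF d] sw deriv_add[OF assms] deriv_scale[OF assms]
  show "linear (\<lambda>u. koszul g y u v w)" "linear (\<lambda>v. koszul g y u v w)" "linear (koszul g y u v)"
    by (intro linearI; simp add: simps field_simps)+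
qed

lemma christoffel_form_unique:
  assumes "y \<in> S" "christoffel_form g y \<Gamma>" "christoffel_form g y \<Gamma>'"
  shows "\<Gamma> = \<Gamma>'"
proof (intro ext)
  fix u v
  show "\<Gamma> u v = \<Gamma>' u v"
    using assms by (intro scalar_product_eqI[OF scalar[OF assms(1)]])
      (simp add: christoffel_form_koszul scalar)
qed

text \<open>Once \<open>\<Gamma>\<close> satisfies the Koszul identity, bilinearity and symmetry
  follow by testing against all \<open>w\<close>, and compatibility by adding two Koszul
  expressions.\<close>

lemma christoffel_form_exists:
  assumes y: "y \<in> S"
  shows "\<exists>!\<Gamma>. christoffel_form g y \<Gamma>"
proof -
  let ?n = "dim (UNIV::'a set)"
  note sc = scalar[OF y]
  obtain E where E: "orthonormal (g y) ?n E" using orthonormal_exists[OF fd sc] .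
  \<comment> \<open>The index is raised with an orthonormal basis for the metric at this one
    point.\<close>
  define \<Gamma> where "\<Gamma> u v = (\<Sum>i<?n. koszul g y u v (E i) *\<^sub>R E i)" for u v
  note k = koszul_linear[OF y]
  have kos: "g y (\<Gamma> u v) w = koszul g y u v w" for u v w
  proof -
    have "koszul g y u v w = koszul g y u v (\<Sum>i<?n. g y w (E i) *\<^sub>R E i)"
      using orthonormal_expansion[OF fd sc E, of w] by simp
    also have "\<dots> = (\<Sum>i<?n. g y w (E i) * koszul g y u v (E i))"
      by (simp add: linear_sum[OF k(3)] linear_scale[OF k(3)])
    also have "\<dots> = g y (\<Gamma> u v) w"
      by (simp add: \<Gamma>_def scalar_product_simps[OF sc] scalar_product_sym[OF sc, of w] mult.commute)
    finally show ?thesis by simp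
  qed
  have kl: "koszul g y (a + a') v w = koszul g y a v w + koszul g y a' v w"
    "koszul g y (r *\<^sub>R a) v w = r * koszul g y a v w"
    "koszul g y v (a + a') w = koszul g y v a w + koszul g y v a' w"
    "koszul g y v (r *\<^sub>R a) w = r * koszul g y v a w" for a a' r v w
    using k(1,2) by (simp_all add: linear_add linear_scale linear_add[of "\<lambda>u. koszul g y u _ _"]
      linear_scale[of "\<lambda>u. koszul g y u _ _"] linear_add[of "\<lambda>v. koszul g y _ v _"]
      linear_scale[of "\<lambda>v. koszul g y _ v _"])
  have "bilinear \<Gamma>"
    unfolding bilinear_def
    by (auto intro!: linearI scalar_product_eqI[OF sc] simp: kos scalar_product_simps[OF sc] kl)
  moreover have "\<Gamma> u v = \<Gamma> v u" for u v
    by (intro scalar_product_eqI[OF sc]) (simp add: kos koszul_def deriv_sym[OF y, of u v])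
  moreover have "deriv_along (\<lambda>y. g y v w) y u = g y (\<Gamma> u v) w + g y v (\<Gamma> u w)" for u v w
    unfolding scalar_product_sym[OF sc, of v] kos koszul_def
    using deriv_sym[OF y, of v u] deriv_sym[OF y, of v w] deriv_sym[OF y, of w u]
    by (simp add: field_simps)
  ultimately have "christoffel_form g y \<Gamma>" by (simp add: christoffel_form_def)
  then show ?thesis using christoffel_form_unique[OF y] by blast
qed

text \<open>In a frame that is orthonormal and differentiable the Christoffel symbols are read off the
  Koszul formula, so no inverse matrix is needed for their differentiability.\<close>

lemma christoffel_form_differentiable:
  assumes y: "y \<in> S" and \<Gamma>: "\<And>z. z \<in> S \<Longrightarrow> christoffel_form g z (\<Gamma> z)"
    and E: "\<And>z. z \<in> S \<Longrightarrow> orthonormal (g z) (dim (UNIV::'a set)) (\<lambda>i. E i z)"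
    and dE: "\<And>i. E i differentiable (at y)"
  shows "(\<lambda>z. \<Gamma> z u v) differentiable (at y)"
proof -
  let ?n = "dim (UNIV::'a set)"
  have k: "(\<lambda>z. koszul g z u v w) differentiable (at y)" for w
    unfolding koszul_def
    by (intro differentiable_divide differentiable_diff differentiable_add
        smooth_on_D(2)[OF smooth y]) auto
  \<comment> \<open>The last argument moves with the point as well, so this needs the product rule
    for linear maps.\<close>
  have "(\<lambda>z. koszul g z u v (E i z)) differentiable (at y)" for i
    using has_derivative_apply[OF fd S y, of "\<lambda>z. koszul g z u v" "E i"] koszul_linear(3) k dE[of i]
    by (meson differentiable_def)
  then have "(\<lambda>z. \<Sum>i<?n. koszul g z u v (E i z) *\<^sub>R E i z) differentiable (at y)"
    using dE by (intro differentiable_sum differentiable_scaleR) auto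
  then obtain D where "((\<lambda>z. \<Sum>i<?n. koszul g z u v (E i z) *\<^sub>R E i z) has_derivative D) (at y)"
    by (auto simp: differentiable_def)
  then have "((\<lambda>z. \<Gamma> z u v) has_derivative D) (at y)"
  proof (rule has_derivative_transform_within_open[OF _ S y])
    fix z assume z: "z \<in> S"
    show "(\<Sum>i<?n. koszul g z u v (E i z) *\<^sub>R E i z) = \<Gamma> z u v"
      using orthonormal_expansion[OF fd scalar[OF z] E[OF z], of "\<Gamma> z u v"]
      by (simp add: christoffel_form_koszul[where g = g, OF \<Gamma>[OF z] scalar[OF z]])
  qed
  then show ?thesis by (auto simp: differentiable_def)
qed

text \<open>The transformation law of Christoffel symbols, with the second derivative of
  \<open>\<psi>\<close> as its inhomogeneous term. The right-hand side, pulled back by the inverse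
  derivative, is shown to be a Christoffel form for \<open>g\<close>, and these are unique.\<close>

lemma christoffel_form_isometry:
  fixes h :: "'a \<Rightarrow> 'a \<Rightarrow> 'a \<Rightarrow> real"
  assumes h: "local_metric h S'" and x: "x \<in> S" and \<psi>: "smooth_on S \<psi>" "\<psi> ` S \<subseteq> S'"
    and iso: "\<And>y u v. y \<in> S \<Longrightarrow> g y u v = h (\<psi> y) (deriv_along \<psi> y u) (deriv_along \<psi> y v)"
    and inv: "\<And>u. \<exists>v. deriv_along \<psi> x v = u"
    and \<Gamma>: "christoffel_form g x \<Gamma>" and \<Gamma>': "christoffel_form h (\<psi> x) \<Gamma>'"
  shows "deriv_along \<psi> x (\<Gamma> u v) =
    \<Gamma>' (deriv_along \<psi> x u) (deriv_along \<psi> x v) + deriv_along (\<lambda>y. deriv_along \<psi> y v) x u"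
proof -
  interpret h: local_metric h S' by (rule h)
  define D where "D = frechet_derivative \<psi> (at x)"
  define H where "H u v = deriv_along (\<lambda>y. deriv_along \<psi> y v) x u" for u v
  have \<psi>x: "\<psi> x \<in> S'" using \<psi> x by auto
  note d\<psi> = smooth_on_D[OF \<psi>(1)]
  have linD: "linear D" unfolding D_def using linear_frechet_derivative d\<psi>(1) x by blast
  \<comment> \<open>An isometric linear map is injective because the metric is
    nondegenerate.\<close>
  have injD: "u = v" if "D u = D v" for u v
  proof (rule scalar_product_eqI[OF scalar[OF x]])
    fix w show "g x u w = g x v w" using iso[OF x] that by (simp add: D_def)
  qed
  obtain A where A: "\<And>u. D (A u) = u" using inv unfolding D_def by metis
  have AD: "A (D u) = u" for u using injD A by blast
  have linA: "linear A"
    by (rule linearI; rule injD; simp add: A linear_add[OF linD] linear_scale[OF linD])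
  have symH: "H u v = H v u" for u v
  proof -
    have "Ck_on 2 S \<psi>" using \<psi>(1) unfolding smooth_on_def by blast
    then show ?thesis unfolding H_def by (rule second_derivative_symmetric[OF S x])
  qed
  have linH: "linear (\<lambda>u. H u v)" for v
    unfolding H_def using linear_frechet_derivative[OF d\<psi>(2)[OF x]] .
  then have linH': "linear (H u)" for u
  proof -
    have "H u = (\<lambda>v. H v u)" using symH by blast
    then show ?thesis using linH by simp
  qed
  have gA: "g x (A z) w = h (\<psi> x) z (D w)" "g x w (A z) = h (\<psi> x) (D w) z" for z w
    using iso[OF x] A by (simp_all add: D_def[symmetric])
  \<comment> \<open>The candidate is what the law forces; its symmetry rests on that of the second
    derivative \<open>H\<close>.\<close>
  define \<Gamma>2 where "\<Gamma>2 u v = A (\<Gamma>' (D u) (D v) + H u v)" for u v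
  have \<Gamma>'b: "bilinear \<Gamma>'" and \<Gamma>'s: "\<Gamma>' u v = \<Gamma>' v u" and
    \<Gamma>'c: "deriv_along (\<lambda>y. h y v w) (\<psi> x) u = h (\<psi> x) (\<Gamma>' u v) w + h (\<psi> x) v (\<Gamma>' u w)" for u v w
    using \<Gamma>' by (simp_all add: christoffel_form_def)
  have "christoffel_form g x \<Gamma>2"
    unfolding christoffel_form_def
  proof (intro conjI allI)
    show "bilinear \<Gamma>2"
      unfolding bilinear_def \<Gamma>2_def
      by (auto intro!: linearI simp: linear_add[OF linD] linear_scale[OF linD] linear_add[OF linA]
          linear_scale[OF linA] linear_add[OF linH] linear_scale[OF linH] linear_add[OF linH']
          linear_scale[OF linH'] bilinear_simps[OF \<Gamma>'b] scaleR_add_right)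
    show "\<Gamma>2 u v = \<Gamma>2 v u" for u v
      unfolding \<Gamma>2_def using \<Gamma>'s symH by metis
    fix u v w
    have d\<psi>v: "((\<lambda>y. deriv_along \<psi> y v) has_derivative (\<lambda>u. H u v)) (at x)" for v
      unfolding H_def using d\<psi>(2)[OF x] frechet_derivative_works by blast
    have dh: "((\<lambda>y. h (\<psi> y) a b) has_derivative (\<lambda>u. deriv_along (\<lambda>y. h y a b) (\<psi> x) (D u))) (at x)" for a b
      using diff_chain_at[OF d\<psi>(3)[OF x] h.deriv[OF \<psi>x, of a b]] by (simp add: o_def D_def)
    have e: "deriv_along (\<lambda>y. h (\<psi> y) (D v) (D w)) x u = deriv_along (\<lambda>y. h y (D v) (D w)) (\<psi> x) (D u)" for u
      by (rule deriv_alongI[OF dh])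
    have b: "bilinear (h (\<psi> y))" if "y \<in> S" for y
      using h.scalar[of "\<psi> y"] \<psi>(2) that by (auto simp: scalar_product_def)
    have dd: "(\<lambda>y. h (\<psi> y) a b) differentiable (at x)" for a b
      by (rule differentiableI[OF dh])
    \<comment> \<open>The isometry identity is differentiated: the base point of \<open>h\<close>
      gives the compatibility of \<open>\<Gamma>'\<close>, the two moving arguments give the terms
      with \<open>H\<close>.\<close>
    have "((\<lambda>y. g y v w) has_derivative (\<lambda>u. deriv_along (\<lambda>y. h (\<psi> y) (D v) (D w)) x u
        + h (\<psi> x) (H u v) (D w) + h (\<psi> x) (D v) (H u w))) (at x)"
      by (rule has_derivative_transform_within_open[OF
            has_derivative_apply2[where g = "\<lambda>y. h (\<psi> y)", OF fd S x b dd d\<psi>v[of v] d\<psi>v[of w]]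
            S x, folded D_def]) (simp_all add: iso)
    from deriv_alongI[OF this, of u]
    show "deriv_along (\<lambda>y. g y v w) x u = g x (\<Gamma>2 u v) w + g x v (\<Gamma>2 u w)"
      by (simp add: e \<Gamma>2_def gA \<Gamma>'c scalar_product_simps[OF h.scalar[OF \<psi>x]])
  qed
  then have "\<Gamma> = \<Gamma>2" using christoffel_form_unique[OF x \<Gamma>] by blast
  then show ?thesis by (simp add: \<Gamma>2_def A H_def D_def[symmetric])
qed

end

section \<open>Charts and differentials\<close>

text \<open>Covers \<open>tangent_components\<close>, \<open>tangent_from_components\<close> and
  \<open>differential\<close> at once, so that a single chain rule handles maps and changes of
  charts.\<close>

definition coord_deriv ::
    "('p, 'e::real_inner) chart \<Rightarrow> ('q, 'f::real_inner) chart \<Rightarrow> ('p \<Rightarrow> 'q) \<Rightarrow> 'p \<Rightarrow> 'e \<Rightarrow> 'f"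
  where "coord_deriv c d \<phi> p = frechet_derivative (snd d \<circ> \<phi> \<circ> chart_inv c) (at (snd c p))"

lemma tangent_components_eq: "tangent_components M c p = coord_deriv (chart_at M p) c (\<lambda>q. q) p"
  by (simp add: fun_eq_iff tangent_components_def coord_deriv_def o_def)

lemma tangent_from_components_eq:
  "tangent_from_components M c p = coord_deriv c (chart_at M p) (\<lambda>q. q) p"
  by (simp add: fun_eq_iff tangent_from_components_def coord_deriv_def o_def)

lemma differential_eq:
  "differential M N \<phi> p = coord_deriv (chart_at M p) (chart_at N (\<phi> p)) \<phi> p"
  by (simp add: fun_eq_iff differential_def coord_deriv_def o_def)

lemma chart_facts:
  assumes "chart_of T c"
  shows "openin T (fst c)" "open (chart_range c)" "inj_on (snd c) (fst c)"
    "p \<in> fst c \<Longrightarrow> chart_inv c (snd c p) = p"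
    "x \<in> chart_range c \<Longrightarrow> chart_inv c x \<in> fst c"
    "x \<in> chart_range c \<Longrightarrow> snd c (chart_inv c x) = x"
    "openin T U \<Longrightarrow> U \<subseteq> fst c \<Longrightarrow> open (snd c ` U)"
    "p \<in> fst c \<Longrightarrow> snd c p \<in> chart_range c"
proof -
  have hm: "homeomorphic_map (subtopology T (fst c)) (top_of_set (chart_range c)) (snd c)"
    and o: "openin T (fst c)" and r: "open (chart_range c)"
    using assms by (auto simp: chart_of_def)
  have ts: "topspace (subtopology T (fst c)) = fst c"
    using openin_subset[OF o] by auto
  show "openin T (fst c)" "open (chart_range c)" by fact+
  show inj: "inj_on (snd c) (fst c)"
    using hm ts by (simp add: homeomorphic_map_def)
  show "p \<in> fst c \<Longrightarrow> chart_inv c (snd c p) = p"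
    using inj by (simp add: chart_inv_def)
  show "x \<in> chart_range c \<Longrightarrow> chart_inv c x \<in> fst c"
    unfolding chart_inv_def chart_range_def by (rule inv_into_into)
  show "x \<in> chart_range c \<Longrightarrow> snd c (chart_inv c x) = x"
    unfolding chart_inv_def chart_range_def by (rule f_inv_into_f)
  show "p \<in> fst c \<Longrightarrow> snd c p \<in> chart_range c"
    by (simp add: chart_range_def)
  show "open (snd c ` U)" if "openin T U" "U \<subseteq> fst c"
  proof -
    have "openin (subtopology T (fst c)) U"
      using that by (auto simp: openin_subtopology)
    then have "openin (top_of_set (chart_range c)) (snd c ` U)"
      using homeomorphic_imp_open_map[OF hm] by (auto simp: open_map_def)
    then show ?thesis using r openin_open_trans by blast
  qed
qed

lemma chart_inv_image: "chart_of T c \<Longrightarrow> x \<in> snd c ` W \<Longrightarrow> W \<subseteq> fst c \<Longrightarrow> chart_inv c x \<in> W \<and> snd c (chart_inv c x) = x"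
  using chart_facts(4) by fastforce

lemma smooth_manifold_chart:
  assumes "smooth_manifold M"
  shows "c \<in> atlas M \<Longrightarrow> chart_of (mtop M) c"
    "c \<in> atlas M \<Longrightarrow> p \<in> fst c \<Longrightarrow> p \<in> points M"
    "p \<in> points M \<Longrightarrow> chart_at M p \<in> atlas M" "p \<in> points M \<Longrightarrow> p \<in> fst (chart_at M p)"
proof -
  show *: "c \<in> atlas M \<Longrightarrow> chart_of (mtop M) c" for c
    using assms by (auto simp: smooth_manifold_def)
  show "c \<in> atlas M \<Longrightarrow> p \<in> fst c \<Longrightarrow> p \<in> points M"
    using chart_facts(1)[OF *] openin_subset by blast
  assume "p \<in> points M"
  then have "\<exists>c. c \<in> atlas M \<and> p \<in> fst c"
    using assms unfolding smooth_manifold_def by blast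
  then have "chart_at M p \<in> atlas M \<and> p \<in> fst (chart_at M p)"
    unfolding chart_at_def by (rule someI_ex)
  then show "chart_at M p \<in> atlas M" "p \<in> fst (chart_at M p)" by auto
qed

lemma smooth_manifold_finite_dimensional:
  "smooth_manifold (M :: ('p, 'e::real_inner, 'x) manifold_scheme) \<Longrightarrow> finite_dimensional TYPE('e)"
  by (simp add: smooth_manifold_def finite_dimensional_def)

lemma smooth_map_points: "smooth_map M N \<phi> \<Longrightarrow> p \<in> points M \<Longrightarrow> \<phi> p \<in> points N"
  by (auto simp: smooth_map_def continuous_map_def)

text \<open>Continuity makes the domain of a coordinate expression open, so that derivatives at its
  points are determined.\<close>

lemma smooth_map_coord:
  assumes M: "smooth_manifold M" and N: "smooth_manifold N" and \<phi>: "smooth_map M N \<phi>"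
    and c: "c \<in> atlas M" and d: "d \<in> atlas N"
  defines "W \<equiv> {q \<in> fst c. \<phi> q \<in> fst d}"
  shows "openin (mtop M) W" "open (snd c ` W)" "smooth_on (snd c ` W) (snd d \<circ> \<phi> \<circ> chart_inv c)"
proof -
  note cc = smooth_manifold_chart(1)[OF M c] and dd = smooth_manifold_chart(1)[OF N d]
  have "W = fst c \<inter> {q \<in> points M. \<phi> q \<in> fst d}"
    using smooth_manifold_chart(2)[OF M c] by (auto simp: W_def)
  moreover have "openin (mtop M) {q \<in> points M. \<phi> q \<in> fst d}"
    using \<phi> chart_facts(1)[OF dd] by (auto simp: smooth_map_def intro: openin_continuous_map_preimage)
  ultimately show W: "openin (mtop M) W" using chart_facts(1)[OF cc] by auto
  show "open (snd c ` W)" using chart_facts(7)[OF cc W] by (simp add: W_def)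
  show "smooth_on (snd c ` W) (snd d \<circ> \<phi> \<circ> chart_inv c)"
    using \<phi> c d unfolding smooth_map_def W_def by blast
qed

section \<open>The chain rule in charts\<close>

lemma coord_deriv_has_derivative:
  assumes "smooth_manifold M" "smooth_manifold N" "smooth_map M N \<phi>"
    "c \<in> atlas M" "d \<in> atlas N" "p \<in> fst c" "\<phi> p \<in> fst d"
  shows "((snd d \<circ> \<phi> \<circ> chart_inv c) has_derivative coord_deriv c d \<phi> p) (at (snd c p))"
    "linear (coord_deriv c d \<phi> p)"
proof -
  show *: "((snd d \<circ> \<phi> \<circ> chart_inv c) has_derivative coord_deriv c d \<phi> p) (at (snd c p))"
    using smooth_on_D(3)[OF smooth_map_coord(3)[OF assms(1-5)]] assms(6,7)
    unfolding coord_deriv_def by blast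
  then show "linear (coord_deriv c d \<phi> p)" using has_derivative_linear by blast
qed

text \<open>\<open>\<theta>\<close> has to agree with the composition on the points of
  \<open>M\<close> only, since maps take arbitrary values outside the manifold.\<close>

lemma coord_deriv_comp:
  assumes M: "smooth_manifold M" and N: "smooth_manifold N" and K: "smooth_manifold K"
    and \<phi>: "smooth_map M N \<phi>" and \<psi>: "smooth_map N K \<psi>"
    and c: "c \<in> atlas M" and d: "d \<in> atlas N" and e: "e \<in> atlas K"
    and p: "p \<in> fst c" "\<phi> p \<in> fst d" "\<psi> (\<phi> p) \<in> fst e"
    and \<theta>: "\<And>q. q \<in> points M \<Longrightarrow> \<theta> q = \<psi> (\<phi> q)"
  shows "coord_deriv c e \<theta> p u = coord_deriv d e \<psi> (\<phi> p) (coord_deriv c d \<phi> p u)"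
proof -
  define W where "W = {q \<in> fst c. \<phi> q \<in> fst d}"
  note cc = smooth_manifold_chart(1)[OF M c] and dd = smooth_manifold_chart(1)[OF N d]
  have W: "open (snd c ` W)" unfolding W_def by (rule smooth_map_coord(2)[OF M N \<phi> c d])
  have pW: "snd c p \<in> snd c ` W" using p by (auto simp: W_def)
  have x: "(snd d \<circ> \<phi> \<circ> chart_inv c) (snd c p) = snd d (\<phi> p)"
    using chart_facts(4)[OF cc] p by simp
  have "((snd e \<circ> \<psi> \<circ> chart_inv d) \<circ> (snd d \<circ> \<phi> \<circ> chart_inv c) has_derivative
      coord_deriv d e \<psi> (\<phi> p) \<circ> coord_deriv c d \<phi> p) (at (snd c p))"
    by (rule diff_chain_at[OF coord_deriv_has_derivative(1)[OF M N \<phi> c d p(1,2)]])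
      (use coord_deriv_has_derivative(1)[OF N K \<psi> d e p(2,3)] x in simp)
  then have "((snd e \<circ> \<theta> \<circ> chart_inv c) has_derivative
      coord_deriv d e \<psi> (\<phi> p) \<circ> coord_deriv c d \<phi> p) (at (snd c p))"
  proof (rule has_derivative_transform_within_open[OF _ W pW])
    fix x assume "x \<in> snd c ` W"
    then have "chart_inv c x \<in> W" using chart_inv_image[OF cc, of x W] by (auto simp: W_def)
    then show "((snd e \<circ> \<psi> \<circ> chart_inv d) \<circ> (snd d \<circ> \<phi> \<circ> chart_inv c)) x = (snd e \<circ> \<theta> \<circ> chart_inv c) x"
      using chart_facts(4)[OF dd] smooth_manifold_chart(2)[OF M c] by (auto simp: W_def \<theta>)
  qed
  from deriv_alongI[OF this, of u] show ?thesis by (simp add: coord_deriv_def)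
qed

lemma coord_deriv_cong:
  fixes M :: "('p, 'e::real_inner, 'x) manifold_scheme" and d :: "('q, 'f::real_inner) chart"
  assumes M: "smooth_manifold M" and c: "c \<in> atlas M" and p: "p \<in> fst c"
    and \<phi>: "\<And>q. q \<in> points M \<Longrightarrow> \<phi> q = \<psi> q"
  shows "coord_deriv c d \<phi> p = coord_deriv c d \<psi> p"
proof -
  note cc = smooth_manifold_chart(1)[OF M c]
  have d: "(f has_derivative D) (at (snd c p))"
    if "\<And>x. x \<in> chart_range c \<Longrightarrow> f x = g x" "(g has_derivative D) (at (snd c p))" for f g :: "'e \<Rightarrow> 'f" and D
    by (rule has_derivative_transform_within_open[OF that(2) chart_facts(2)[OF cc]])
      (use that p chart_facts(8)[OF cc] in auto)
  have e: "(snd d \<circ> \<phi> \<circ> chart_inv c) x = (snd d \<circ> \<psi> \<circ> chart_inv c) x" if "x \<in> chart_range c" for x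
    using chart_facts(5)[OF cc that] smooth_manifold_chart(2)[OF M c] \<phi> by auto
  have "(snd d \<circ> \<phi> \<circ> chart_inv c has_derivative D) (at (snd c p)) \<longleftrightarrow>
    (snd d \<circ> \<psi> \<circ> chart_inv c has_derivative D) (at (snd c p))" for D
    by (rule iffI; rule d[rotated]; assumption?; simp add: e del: o_apply)
  then show ?thesis by (simp add: coord_deriv_def frechet_derivative_def)
qed

text \<open>The coordinate expressions of the identity are the transition maps, so a change of
  charts becomes a case of the chain rule.\<close>

lemma smooth_map_ident: "smooth_manifold M \<Longrightarrow> smooth_map M M (\<lambda>q. q)"
  by (auto simp: smooth_map_def smooth_manifold_def Int_def o_def id_def)

lemma coord_deriv_ident:
  assumes M: "smooth_manifold M" and c: "c \<in> atlas M" and p: "p \<in> fst c"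
  shows "coord_deriv c c (\<lambda>q. q) p u = u"
proof -
  note cc = smooth_manifold_chart(1)[OF M c]
  have "((snd c \<circ> (\<lambda>q. q) \<circ> chart_inv c) has_derivative (\<lambda>u. u)) (at (snd c p))"
    by (rule has_derivative_transform_within_open[OF has_derivative_ident chart_facts(2)[OF cc]])
      (use p chart_facts(6,8)[OF cc] in auto)
  from deriv_alongI[OF this] show ?thesis by (simp add: coord_deriv_def)
qed

lemma coord_deriv_change:
  assumes M: "smooth_manifold M" and c: "c \<in> atlas M" and d: "d \<in> atlas M" and p: "p \<in> fst c" "p \<in> fst d"
  shows "coord_deriv d c (\<lambda>q. q) p (coord_deriv c d (\<lambda>q. q) p u) = u"
  using coord_deriv_comp[OF M M M smooth_map_ident[OF M] smooth_map_ident[OF M] c d c, of p "\<lambda>q. q" u]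
    coord_deriv_ident[OF M c] p by simp

lemma tangent_components_inverse:
  assumes M: "smooth_manifold M" and c: "c \<in> atlas M" and p: "p \<in> fst c"
  shows "tangent_components M c p (tangent_from_components M c p u) = u"
    "tangent_from_components M c p (tangent_components M c p u) = u"
    "linear (tangent_components M c p)" "linear (tangent_from_components M c p)"
  unfolding tangent_components_eq tangent_from_components_eq
  using smooth_manifold_chart(3,4)[OF M smooth_manifold_chart(2)[OF M c p]] c p
  by (auto intro!: coord_deriv_change[OF M]
      coord_deriv_has_derivative(2)[OF M M smooth_map_ident[OF M]])

lemma tangent_components_chart_at:
  assumes M: "smooth_manifold M" and p: "p \<in> points M"
  shows "tangent_components M (chart_at M p) p u = u"
    "tangent_from_components M (chart_at M p) p u = u"
  unfolding tangent_components_eq tangent_from_components_eq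
  using smooth_manifold_chart(3,4)[OF M p] by (auto intro!: coord_deriv_ident[OF M])

text \<open>Passes from the charts fixed by \<open>chart_at\<close> to arbitrary ones: two chain
  rules, with the identity composed on either side of \<phi>.\<close>

lemma coord_deriv_differential:
  assumes M: "smooth_manifold M" and N: "smooth_manifold N" and \<phi>: "smooth_map M N \<phi>"
    and c: "c \<in> atlas M" and d: "d \<in> atlas N" and p: "p \<in> fst c" "\<phi> p \<in> fst d"
  shows "tangent_components N d (\<phi> p) (differential M N \<phi> p u) =
    coord_deriv c d \<phi> p (tangent_components M c p u)"
proof -
  have pM: "p \<in> points M" using smooth_manifold_chart(2)[OF M c p(1)] .
  then have qN: "\<phi> p \<in> points N" using smooth_map_points[OF \<phi>] by blast
  note cp = smooth_manifold_chart(3,4)[OF M pM] and dp = smooth_manifold_chart(3,4)[OF N qN]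
  have "coord_deriv (chart_at N (\<phi> p)) d (\<lambda>q. q) (\<phi> p) (coord_deriv (chart_at M p) (chart_at N (\<phi> p)) \<phi> p u)
    = coord_deriv (chart_at M p) d \<phi> p u"
    using coord_deriv_comp[OF M N N \<phi> smooth_map_ident[OF N] cp(1) dp(1) d cp(2) dp(2)] p by auto
  also have "\<dots> = coord_deriv c d \<phi> p (coord_deriv (chart_at M p) c (\<lambda>q. q) p u)"
    using coord_deriv_comp[OF M M N smooth_map_ident[OF M] \<phi> cp(1) c d cp(2)] p by auto
  finally show ?thesis by (simp add: tangent_components_eq differential_eq)
qed

lemma differential_linear:
  assumes M: "smooth_manifold M" and N: "smooth_manifold N" and \<phi>: "smooth_map M N \<phi>" and p: "p \<in> points M"
  shows "linear (differential M N \<phi> p)"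
  unfolding differential_eq
  using smooth_manifold_chart(3,4)[OF M p] smooth_manifold_chart(3,4)[OF N smooth_map_points[OF \<phi> p]]
  by (intro coord_deriv_has_derivative(2)[OF M N \<phi>]) auto

lemma differential_comp:
  assumes M: "smooth_manifold M" and N: "smooth_manifold N" and K: "smooth_manifold K"
    and \<phi>: "smooth_map M N \<phi>" and \<psi>: "smooth_map N K \<psi>" and p: "p \<in> points M"
    and \<theta>: "\<And>q. q \<in> points M \<Longrightarrow> \<theta> q = \<psi> (\<phi> q)"
  shows "differential M K \<theta> p u = differential N K \<psi> (\<phi> p) (differential M N \<phi> p u)"
proof -
  note qN = smooth_map_points[OF \<phi> p]
  note rK = smooth_map_points[OF \<psi> qN]
  show ?thesis
    unfolding differential_eq \<theta>[OF p]
    by (rule coord_deriv_comp[OF M N K \<phi> \<psi> smooth_manifold_chart(3)[OF M p]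
        smooth_manifold_chart(3)[OF N qN] smooth_manifold_chart(3)[OF K rK]
        smooth_manifold_chart(4)[OF M p] smooth_manifold_chart(4)[OF N qN]
        smooth_manifold_chart(4)[OF K rK] \<theta>])
qed

lemma differential_ident:
  assumes M: "smooth_manifold M" and p: "p \<in> points M" and \<phi>: "\<And>q. q \<in> points M \<Longrightarrow> \<phi> q = q"
  shows "differential M M \<phi> p u = u"
proof -
  note c = smooth_manifold_chart(3,4)[OF M p]
  have "coord_deriv (chart_at M p) (chart_at M p) \<phi> p = coord_deriv (chart_at M p) (chart_at M p) (\<lambda>q. q) p"
    by (rule coord_deriv_cong[OF M c \<phi>])
  then show ?thesis
    unfolding differential_eq \<phi>[OF p] using coord_deriv_ident[OF M c] by simp
qed

section \<open>The Levi-Civita connection under isometries\<close>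

definition field_in_chart ::
    "('p, 'e::real_inner, 'x) manifold_scheme \<Rightarrow> ('p, 'e) chart \<Rightarrow> ('p \<Rightarrow> 'e) \<Rightarrow> 'e \<Rightarrow> 'e"
  where "field_in_chart M c X x = tangent_components M c (chart_inv c x) (X (chart_inv c x))"

lemma riemannian_manifold_smooth: "riemannian_manifold M \<Longrightarrow> smooth_manifold M"
  by (simp add: riemannian_manifold_def)

lemma riem_metric_scalar_product:
  "riemannian_manifold M \<Longrightarrow> p \<in> points M \<Longrightarrow> scalar_product (riem_metric M p)"
  unfolding riemannian_manifold_def scalar_product_def by blast

lemma metric_in_chart_components:
  assumes M: "riemannian_manifold M" and c: "c \<in> atlas M" and p: "p \<in> fst c"
  shows "metric_in_chart M c (snd c p) (tangent_components M c p u) (tangent_components M c p v) = riem_metric M p u v"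
    "metric_in_chart M c (snd c p) a b =
      riem_metric M p (tangent_from_components M c p a) (tangent_from_components M c p b)"
proof -
  note sM = riemannian_manifold_smooth[OF M]
  note cc = smooth_manifold_chart(1)[OF sM c]
  note [simp] = tangent_components_inverse[OF sM c p] chart_facts(4)[OF cc p]
  show "metric_in_chart M c (snd c p) (tangent_components M c p u) (tangent_components M c p v) = riem_metric M p u v"
    "metric_in_chart M c (snd c p) a b =
      riem_metric M p (tangent_from_components M c p a) (tangent_from_components M c p b)"
    by (simp_all add: metric_in_chart_def)
qed

lemma local_metric_in_chart:
  fixes M :: "('p, 'e::real_inner, 'x) riem_manifold_scheme"
  assumes M: "riemannian_manifold M" and c: "c \<in> atlas M"
  shows "local_metric (metric_in_chart M c) (chart_range c)"
proof
  note sM = riemannian_manifold_smooth[OF M]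
  note cc = smooth_manifold_chart(1)[OF sM c]
  show "finite_dimensional TYPE('e)" using smooth_manifold_finite_dimensional[OF sM] .
  show "open (chart_range c)" using chart_facts(2)[OF cc] .
  show "smooth_on (chart_range c) (\<lambda>y. metric_in_chart M c y v w)" for v w
    using M c by (simp add: riemannian_manifold_def)
  show "scalar_product (metric_in_chart M c y)" if y: "y \<in> chart_range c" for y
  proof -
    obtain p where p: "p \<in> fst c" "y = snd c p" using y by (auto simp: chart_range_def)
    note sp = riem_metric_scalar_product[OF M smooth_manifold_chart(2)[OF sM c p(1)]]
    note T = tangent_components_inverse[OF sM c p(1)]
    have "tangent_from_components M c p u \<noteq> 0" if "u \<noteq> 0" for u
      using T(1)[of u] linear_0[OF T(3)] that by metis
    then have pos: "0 < riem_metric M p (tangent_from_components M c p u) (tangent_from_components M c p u)"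
      if "u \<noteq> 0" for u
      using sp that unfolding scalar_product_def by blast
    show ?thesis
      unfolding p(2) scalar_product_def bilinear_def metric_in_chart_components(2)[OF M c p(1)]
    proof (intro conjI allI impI)
      show "linear (\<lambda>v. riem_metric M p (tangent_from_components M c p u) (tangent_from_components M c p v))"
        "linear (\<lambda>v. riem_metric M p (tangent_from_components M c p v) (tangent_from_components M c p u))" for u
        by (intro linearI; simp add: linear_add[OF T(4)] linear_scale[OF T(4)] scalar_product_simps[OF sp])+
    qed (fact scalar_product_sym[OF sp] pos)+
  qed
qed

text \<open>Unique existence gives the definite description in \<open>christoffel\<close> its
  meaning.\<close>

lemma christoffel_christoffel_form:
  assumes M: "riemannian_manifold M" and c: "c \<in> atlas M" and x: "x \<in> chart_range c"
  shows "christoffel_form (metric_in_chart M c) x (christoffel M c x)"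
proof -
  interpret local_metric "metric_in_chart M c" "chart_range c"
    by (rule local_metric_in_chart[OF M c])
  have "christoffel M c x = (THE \<Gamma>. christoffel_form (metric_in_chart M c) x \<Gamma>)"
    unfolding christoffel_def christoffel_form_def by (rule refl)
  then show ?thesis
    using theI'[OF christoffel_form_exists[OF x]] by (simp only:)
qed

lemma christoffel_bilinear:
  assumes M: "riemannian_manifold M" and c: "c \<in> atlas M" and x: "x \<in> chart_range c"
  shows "bilinear (christoffel M c x)" "christoffel M c x u v = christoffel M c x v u"
  using christoffel_christoffel_form[OF assms] by (auto simp: christoffel_form_def)

text \<open>The Levi-Civita derivative sees the direction at the point only, so a tangent vector
  replaces the first field of \<open>levi_civita\<close>.\<close>

definition cov_deriv ::
    "('p, 'e::real_inner, 'x) riem_manifold_scheme \<Rightarrow> 'p \<Rightarrow> 'e \<Rightarrow> ('p \<Rightarrow> 'e) \<Rightarrow> 'e"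
  where "cov_deriv M p u Y = pullback_conn M M (\<lambda>q. q) p u Y"

lemma levi_civita_eq: "levi_civita M X Y p = cov_deriv M p (X p) Y"
  by (simp add: levi_civita_def cov_deriv_def)

lemma cov_deriv_eq:
  assumes M: "smooth_manifold M" and p: "p \<in> points M"
  shows "cov_deriv M p u Y = deriv_along (field_in_chart M (chart_at M p) Y) (snd (chart_at M p) p) u
    + christoffel M (chart_at M p) (snd (chart_at M p) p) u (Y p)"
  using differential_ident[OF M p] by (simp add: cov_deriv_def pullback_conn_def Let_def field_in_chart_def[abs_def])

text \<open>The inverse is part of the data because its smoothness is used to differentiate
  transported fields.\<close>

definition isometry_pair ::
    "('p, 'e::real_inner, 'x) riem_manifold_scheme \<Rightarrow> ('p \<Rightarrow> 'p) \<Rightarrow> ('p \<Rightarrow> 'p) \<Rightarrow> bool"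
  where "isometry_pair M F F' \<longleftrightarrow> smooth_map M M F \<and> smooth_map M M F' \<and>
    (\<forall>p\<in>points M. F' (F p) = p \<and> F (F' p) = p \<and>
      (\<forall>u v. riem_metric M (F p) (differential M M F p u) (differential M M F p v) = riem_metric M p u v))"

lemma isometry_pair_ident: "riemannian_manifold M \<Longrightarrow> isometry_pair M (\<lambda>q. q) (\<lambda>q. q)"
  by (simp add: isometry_pair_def smooth_map_ident riemannian_manifold_smooth
      differential_ident[where \<phi> = "\<lambda>q. q"])

text \<open>The chart \<open>d\<close> at the source is arbitrary, so the identity in place of
  \<open>F\<close> yields the change of charts, and a left translation yields left invariance. The
  transported field is the derivative of \<open>\<psi>\<close> applied to \<open>Y\<close>; the
  second derivative of \<open>\<psi>\<close> that the product rule produces is the inhomogeneous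
  term of the Christoffel law.\<close>

lemma cov_deriv_isometry:
  fixes M :: "('p, 'e::real_inner, 'x) riem_manifold_scheme"
  assumes M: "riemannian_manifold M" and F: "isometry_pair M F F'"
    and d: "d \<in> atlas M" and p: "p \<in> fst d"
    and W: "openin (mtop M) W" "p \<in> W"
    and Z: "\<And>q. q \<in> W \<Longrightarrow> Z (F q) = differential M M F q (Y q)"
    and Y: "(field_in_chart M d Y has_derivative DY) (at (snd d p))"
  defines "c \<equiv> chart_at M (F p)"
  shows "cov_deriv M (F p) (coord_deriv d c F p u) Z =
    coord_deriv d c F p (DY u + christoffel M d (snd d p) u (tangent_components M d p (Y p)))"
proof -
  note sM = riemannian_manifold_smooth[OF M]
  have sF: "smooth_map M M F" and sF': "smooth_map M M F'"
    and inv: "\<And>q. q \<in> points M \<Longrightarrow> F' (F q) = q" "\<And>q. q \<in> points M \<Longrightarrow> F (F' q) = q"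
    and iso: "\<And>q u v. q \<in> points M \<Longrightarrow>
      riem_metric M (F q) (differential M M F q u) (differential M M F q v) = riem_metric M q u v"
    using F unfolding isometry_pair_def by blast+
  have pM: "p \<in> points M" using smooth_manifold_chart(2)[OF sM d p] .
  have FpM: "F p \<in> points M" using smooth_map_points[OF sF pM] .
  have c: "c \<in> atlas M" "F p \<in> fst c"
    using smooth_manifold_chart(3,4)[OF sM FpM] by (auto simp: c_def)
  note cc = smooth_manifold_chart(1)[OF sM c(1)] and dd = smooth_manifold_chart(1)[OF sM d]
  have fd: "finite_dimensional TYPE('e)" by (rule smooth_manifold_finite_dimensional[OF sM])
  define x where "x = snd d p"
  define S where "S = snd d ` {q \<in> fst d. F q \<in> fst c}"
  define \<psi> where "\<psi> = snd c \<circ> F \<circ> chart_inv d"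
  define \<psi>' where "\<psi>' = snd d \<circ> F' \<circ> chart_inv c"
  have S: "open S" "smooth_on S \<psi>"
    unfolding S_def \<psi>_def using smooth_map_coord[OF sM sM sF d c(1)] by auto
  have xS: "x \<in> S" using p c by (auto simp: S_def x_def)
  have Sd: "S \<subseteq> chart_range d" by (auto simp: S_def chart_range_def)
  have \<psi>x: "\<psi> x = snd c (F p)" by (simp add: \<psi>_def x_def chart_facts(4)[OF dd p])
  have Sq: "chart_inv d (snd d q) = q" if "q \<in> fst d" for q using chart_facts(4)[OF dd that] .
  have D\<psi>: "deriv_along \<psi> (snd d q) u = coord_deriv d c F q u" for q u
    by (simp add: coord_deriv_def \<psi>_def)
  have D\<psi>': "(\<psi>' has_derivative coord_deriv c d F' (F p)) (at (\<psi> x))"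
  proof -
    have "F' (F p) \<in> fst d" using inv(1)[OF pM] p by simp
    from coord_deriv_has_derivative(1)[OF sM sM sF' c(1) d c(2) this]
    show ?thesis unfolding \<psi>'_def \<psi>x .
  qed
  have BA: "coord_deriv c d F' (F p) (coord_deriv d c F p u) = u" for u
    using coord_deriv_comp[OF sM sM sM sF sF' d c(1) d p c(2), of "\<lambda>q. q" u]
      coord_deriv_ident[OF sM d p] inv(1) pM p by simp
  have AB: "coord_deriv d c F p (coord_deriv c d F' (F p) u) = u" for u
    using coord_deriv_comp[OF sM sM sM sF' sF c(1) d c(1) c(2), of "\<lambda>q. q" u]
      coord_deriv_ident[OF sM c] inv pM FpM p c by simp
  interpret d: local_metric "metric_in_chart M d" "chart_range d"
    by (rule local_metric_in_chart[OF M d])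
  interpret S: local_metric "metric_in_chart M d" S
    by (unfold_locales) (use fd S d.scalar Sd smooth_on_subset[OF d.smooth Sd] in auto)
  have \<Gamma>: "deriv_along \<psi> x (christoffel M d x u v) =
    christoffel M c (\<psi> x) (deriv_along \<psi> x u) (deriv_along \<psi> x v) + deriv_along (\<lambda>y. deriv_along \<psi> y v) x u"
    for u v
  proof (rule S.christoffel_form_isometry[where \<psi> = \<psi> and \<Gamma> = "christoffel M d x"
        and \<Gamma>' = "christoffel M c (\<psi> x)", OF local_metric_in_chart[OF M c(1)] xS S(2)])
    show "\<psi> ` S \<subseteq> chart_range c"
      unfolding S_def \<psi>_def using Sq chart_facts(8)[OF cc] by auto
    show "christoffel_form (metric_in_chart M d) x (christoffel M d x)"
      using christoffel_christoffel_form[OF M d] xS Sd by blast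
    show "christoffel_form (metric_in_chart M c) (\<psi> x) (christoffel M c (\<psi> x))"
      using christoffel_christoffel_form[OF M c(1)] chart_facts(8)[OF cc c(2)] by (simp add: \<psi>x)
    show "\<exists>v. deriv_along \<psi> x v = u" for u
      using AB[of u] D\<psi>[of p] by (auto simp: x_def)
    fix y u v assume "y \<in> S"
    then obtain q where q: "q \<in> fst d" "F q \<in> fst c" "y = snd d q" by (auto simp: S_def)
    have \<psi>y: "\<psi> y = snd c (F q)" using q Sq by (simp add: \<psi>_def)
    have qM: "q \<in> points M" using smooth_manifold_chart(2)[OF sM d q(1)] .
    have *: "tangent_components M c (F q) (differential M M F q (tangent_from_components M d q u)) =
      deriv_along \<psi> y u" for u
      using coord_deriv_differential[OF sM sM sF d c(1) q(1,2)] tangent_components_inverse[OF sM d q(1)]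
      by (simp add: D\<psi> q(3))
    show "metric_in_chart M d y u v = metric_in_chart M c (\<psi> y) (deriv_along \<psi> y u) (deriv_along \<psi> y v)"
      unfolding *[symmetric] \<psi>y metric_in_chart_components(1)[OF M c(1) q(2)] iso[OF qM]
      by (simp add: q(3) metric_in_chart_components(2)[OF M d q(1)])
  qed
  \<comment> \<open>The transported field in target components, but as a function of the source
    coordinates.\<close>
  define h where "h y = deriv_along \<psi> y (field_in_chart M d Y y)" for y
  have Yx: "field_in_chart M d Y x = tangent_components M d p (Y p)"
    by (simp add: x_def Sq[OF p] field_in_chart_def)
  have h: "(h has_derivative (\<lambda>u. deriv_along (\<lambda>y. deriv_along \<psi> y (field_in_chart M d Y x)) x u
      + deriv_along \<psi> x (DY u))) (at x)"
    unfolding h_def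
  proof (rule has_derivative_apply[where F = "\<lambda>y. deriv_along \<psi> y" and Y = "field_in_chart M d Y", OF fd S(1) xS])
    show "linear (frechet_derivative \<psi> (at y))" if "y \<in> S" for y
      using linear_frechet_derivative smooth_on_D(1)[OF S(2) that] by blast
    show "(\<lambda>y. deriv_along \<psi> y v) differentiable at x" for v
      using smooth_on_D(2)[OF S(2) xS] .
    show "(field_in_chart M d Y has_derivative DY) (at x)" using Y by (simp add: x_def)
  qed
  \<comment> \<open>Points near \<open>F p\<close> whose preimage lies in the chart \<open>d\<close>
    and in \<open>W\<close>, where \<open>Z\<close> is known to be the transported field.\<close>
  define V where "V = {r \<in> fst c. F' r \<in> fst d} \<inter> {r \<in> points M. F' r \<in> W}"
  have "openin (mtop M) {r \<in> points M. F' r \<in> W}"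
    using sF' W(1) by (auto simp: smooth_map_def intro: openin_continuous_map_preimage)
  then have "openin (mtop M) V"
    unfolding V_def using smooth_map_coord(1)[OF sM sM sF' c(1) d] by blast
  then have oV: "open (snd c ` V)" using chart_facts(7)[OF cc] by (auto simp: V_def)
  have pV: "\<psi> x \<in> snd c ` V"
    unfolding \<psi>x V_def using c FpM inv(1)[OF pM] p W(2) by auto
  have \<psi>'\<psi>: "\<psi>' (\<psi> x) = x"
    by (simp only: \<psi>'_def o_apply \<psi>x chart_facts(4)[OF cc c(2)] inv(1)[OF pM]) (simp only: x_def)
  have Zh: "(h \<circ> \<psi>') z = field_in_chart M c Z z" if zV: "z \<in> snd c ` V" for z
  proof -
    obtain r where r: "z = snd c r" "r \<in> fst c" "F' r \<in> fst d" "F' r \<in> W" "r \<in> points M"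
      using zV unfolding V_def by blast
    have FF: "F (F' r) = r" using inv r by auto
    have "field_in_chart M c Z z = tangent_components M c (F (F' r)) (Z (F (F' r)))"
      using r chart_facts(4)[OF cc r(2)] by (simp add: FF field_in_chart_def)
    also have "\<dots> = coord_deriv d c F (F' r) (tangent_components M d (F' r) (Y (F' r)))"
      using coord_deriv_differential[OF sM sM sF d c(1) r(3)] Z[OF r(4)] r FF by simp
    also have "\<dots> = h (\<psi>' z)"
      using r chart_facts(4)[OF cc r(2)] Sq[OF r(3)] by (simp add: h_def \<psi>'_def D\<psi> field_in_chart_def)
    finally show ?thesis by simp
  qed
  define B where "B = coord_deriv c d F' (F p)"
  define Dh where "Dh u = deriv_along (\<lambda>y. deriv_along \<psi> y (field_in_chart M d Y x)) x u
    + deriv_along \<psi> x (DY u)" for u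
  have "(h has_derivative Dh) (at (\<psi>' (\<psi> x)))"
    unfolding \<psi>'\<psi> Dh_def[abs_def] by (rule h)
  moreover have "(\<psi>' has_derivative B) (at (\<psi> x))"
    unfolding B_def by (rule D\<psi>')
  ultimately have "(h \<circ> \<psi>' has_derivative Dh \<circ> B) (at (\<psi> x))"
    by (intro diff_chain_at)
  then have "(field_in_chart M c Z has_derivative Dh \<circ> B) (at (\<psi> x))"
    by (rule has_derivative_transform_within_open[OF _ oV pV]) (rule Zh)
  from deriv_alongI[OF this, of "coord_deriv d c F p u"]
  have 1: "deriv_along (field_in_chart M c Z) (snd c (F p)) (coord_deriv d c F p u) =
      deriv_along (\<lambda>y. deriv_along \<psi> y (field_in_chart M d Y x)) x u + coord_deriv d c F p (DY u)"
    using D\<psi>[of p, folded x_def] by (simp add: BA B_def Dh_def \<psi>x)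
  have "tangent_components M c (F p) (Z (F p)) = coord_deriv d c F p (tangent_components M d p (Y p))"
    using coord_deriv_differential[OF sM sM sF d c(1) p c(2)] Z[OF W(2)] by simp
  then have 2: "Z (F p) = coord_deriv d c F p (tangent_components M d p (Y p))"
    using tangent_components_chart_at(1)[OF sM FpM] by (simp add: c_def)
  have lin: "linear (coord_deriv d c F p)"
    by (rule coord_deriv_has_derivative(2)[OF sM sM sF d c(1) p c(2)])
  show ?thesis
    unfolding cov_deriv_eq[OF sM FpM] c_def[symmetric] 1 2 linear_add[OF lin]
    using \<Gamma>[of u "tangent_components M d p (Y p)"] D\<psi>[of p, folded x_def]
    by (simp add: Yx \<psi>x[symmetric] x_def[symmetric] add_ac)
qed

section \<open>Left invariant fields\<close>

text \<open>Openness is checked on boxes inside \<open>U\<close>, so only the charts of the two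
  factors enter.\<close>

lemma open_map_prod_image:
  assumes c: "chart_of T c" and d: "chart_of T' d" and U: "openin (prod_topology T T') U" "U \<subseteq> fst c \<times> fst d"
  shows "open (map_prod (snd c) (snd d) ` U)"
proof (subst open_prod_def, intro ballI)
  fix z assume "z \<in> map_prod (snd c) (snd d) ` U"
  then obtain p q where pq: "(p, q) \<in> U" "z = (snd c p, snd d q)" by auto
  obtain V W where VW: "openin T V" "openin T' W" "p \<in> V" "q \<in> W" "V \<times> W \<subseteq> U"
    using U(1)[unfolded openin_prod_topology_alt, rule_format, OF pq(1)] by blast
  have "V \<subseteq> fst c" "W \<subseteq> fst d" using VW U(2) by blast+
  then have "open (snd c ` V)" "open (snd d ` W)"
    using chart_facts(7)[OF c VW(1)] chart_facts(7)[OF d VW(2)] by blast+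
  moreover have "z \<in> snd c ` V \<times> snd d ` W" using pq VW by blast
  moreover have "snd c ` V \<times> snd d ` W \<subseteq> map_prod (snd c) (snd d) ` U"
  proof
    fix y assume "y \<in> snd c ` V \<times> snd d ` W"
    then obtain p q where "y = map_prod (snd c) (snd d) (p, q)" "(p, q) \<in> V \<times> W" by auto
    then show "y \<in> map_prod (snd c) (snd d) ` U" using VW(5) by blast
  qed
  ultimately show "\<exists>A B. open A \<and> open B \<and> z \<in> A \<times> B \<and> A \<times> B \<subseteq> map_prod (snd c) (snd d) ` U"
    by blast
qed

locale riem_lie_group =
  fixes G :: "('p, 'm) monoid_scheme" (structure)
    and M :: "('p, 'e::real_inner, 'x) riem_manifold_scheme"
  assumes riemannian_lie_group: "riemannian_lie_group G M"
begin

lemma group: "group G" and smooth_manifold: "smooth_manifold M" and points: "points M = carrier G"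
  and smooth_mult: "smooth_map (product_manifold M M) M (\<lambda>(p, q). p \<otimes> q)"
  and riemannian: "riemannian_manifold M"
  using riemannian_lie_group by (simp_all add: riemannian_lie_group_def lie_group_def)

sublocale group G by (rule group)

lemma fd: "finite_dimensional TYPE('e)"
  using smooth_manifold by (rule smooth_manifold_finite_dimensional)

text \<open>Unpacks the product chart, so that multiplication becomes a smooth function of two
  coordinate variables. Its slices are the left translations, and its derivatives in the second
  variable at the unit are the left invariant fields.\<close>

lemma mult_coord:
  assumes c: "c \<in> atlas M" and d: "d \<in> atlas M" and e: "e \<in> atlas M"
  defines "S \<equiv> map_prod (snd c) (snd d) ` {(p, q). p \<in> fst c \<and> q \<in> fst d \<and> p \<otimes> q \<in> fst e}"
  shows "open S" "smooth_on S (\<lambda>(x, y). snd e (chart_inv c x \<otimes> chart_inv d y))"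
proof -
  note cc = smooth_manifold_chart(1)[OF smooth_manifold c] and dd = smooth_manifold_chart(1)[OF smooth_manifold d]
    and ee = smooth_manifold_chart(1)[OF smooth_manifold e]
  define W where "W = {pq \<in> fst c \<times> fst d. (case pq of (p, q) \<Rightarrow> p \<otimes> q) \<in> fst e}"
  let ?P = "prod_topology (mtop M) (mtop M)"
  have cont: "continuous_map ?P (mtop M) (\<lambda>(p, q). p \<otimes> q)"
    using smooth_mult by (simp add: smooth_map_def product_manifold_def)
  have S_eq: "S = map_prod (snd c) (snd d) ` W"
  proof -
    have "{(p, q). p \<in> fst c \<and> q \<in> fst d \<and> p \<otimes> q \<in> fst e} = W" unfolding W_def by auto
    then show ?thesis unfolding S_def by simp
  qed
  have *: "{z \<in> A. P z} = A \<inter> {z \<in> B. P z}" if "A \<subseteq> B" for A B :: "('p \<times> 'p) set" and P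
    using that by blast
  have "W = (fst c \<times> fst d) \<inter> {pq \<in> topspace ?P. (case pq of (p, q) \<Rightarrow> p \<otimes> q) \<in> fst e}"
  proof -
    have "fst c \<times> fst d \<subseteq> topspace ?P"
      using smooth_manifold_chart(2)[OF smooth_manifold c] smooth_manifold_chart(2)[OF smooth_manifold d]
      by (simp add: Sigma_mono subsetI)
    then show ?thesis unfolding W_def by (rule *)
  qed
  moreover have "openin ?P (fst c \<times> fst d)"
    using chart_facts(1)[OF cc] chart_facts(1)[OF dd] by (simp add: openin_prod_Times_iff)
  moreover have "openin ?P {pq \<in> topspace ?P. (case pq of (p, q) \<Rightarrow> p \<otimes> q) \<in> fst e}"
    by (rule openin_continuous_map_preimage[OF cont chart_facts(1)[OF ee]])
  ultimately have W: "openin ?P W" by auto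
  show S: "open S" unfolding S_eq by (rule open_map_prod_image[OF cc dd W]) (auto simp: W_def)
  have at: "(fst c \<times> fst d, map_prod (snd c) (snd d)) \<in> atlas (product_manifold M M)"
    unfolding product_manifold_def manifold.simps by (rule CollectI) (use c d in blast)
  have "smooth_on S (snd e \<circ> (\<lambda>(p, q). p \<otimes> q) \<circ> chart_inv (fst c \<times> fst d, map_prod (snd c) (snd d)))"
    using smooth_mult[unfolded smooth_map_def, THEN conjunct2, rule_format, OF at e]
    by (simp add: S_eq W_def)
  moreover have "(snd e \<circ> (\<lambda>(p, q). p \<otimes> q) \<circ> chart_inv (fst c \<times> fst d, map_prod (snd c) (snd d))) z =
    (\<lambda>(x, y). snd e (chart_inv c x \<otimes> chart_inv d y)) z" if zS: "z \<in> S" for z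
  proof -
    obtain p q where pq: "p \<in> fst c" "q \<in> fst d" "z = (snd c p, snd d q)"
      using zS by (auto simp: S_def)
    have "inj_on (map_prod (snd c) (snd d)) (fst c \<times> fst d)"
      using chart_facts(3)[OF cc] chart_facts(3)[OF dd] by (rule map_prod_inj_on)
    from inv_into_f_f[OF this, of "(p, q)"]
    have "chart_inv (fst c \<times> fst d, map_prod (snd c) (snd d)) z = (p, q)"
      using pq by (simp add: chart_inv_def)
    then show ?thesis
      using pq chart_facts(4)[OF cc pq(1)] chart_facts(4)[OF dd pq(2)] by simp
  qed
  ultimately show "smooth_on S (\<lambda>(x, y). snd e (chart_inv c x \<otimes> chart_inv d y))"
    using smooth_on_cong[OF S] by blast
qed

lemma chart_at:
  assumes "p \<in> carrier G"
  shows "chart_at M p \<in> atlas M" "p \<in> fst (chart_at M p)" "chart_of (mtop M) (chart_at M p)"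
  using smooth_manifold_chart[OF smooth_manifold] assms points by blast+

lemma chart_inv_carrier:
  "c \<in> atlas M \<Longrightarrow> x \<in> chart_range c \<Longrightarrow> chart_inv c x \<in> carrier G"
  using smooth_manifold_chart(1,2)[OF smooth_manifold] chart_facts(5) points by blast

lemma smooth_left_translation:
  assumes a: "a \<in> carrier G"
  shows "smooth_map M M (\<lambda>q. a \<otimes> q)"
  unfolding smooth_map_def
proof (intro conjI ballI)
  have cont: "continuous_map (prod_topology (mtop M) (mtop M)) (mtop M) (\<lambda>(p, q). p \<otimes> q)"
    using smooth_mult by (simp add: smooth_map_def product_manifold_def)
  have "continuous_map (mtop M) (prod_topology (mtop M) (mtop M)) (\<lambda>q. (a, q))"
    using a points by (intro continuous_map_pairedI) auto
  from continuous_map_compose[OF this cont]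
  show "continuous_map (mtop M) (mtop M) (\<lambda>q. a \<otimes> q)" by (simp add: o_def)
  fix d e assume d: "d \<in> atlas M" and e: "e \<in> atlas M"
  note c = chart_at[OF a] and dd = smooth_manifold_chart(1)[OF smooth_manifold d]
  let ?c = "chart_at M a"
  let ?S = "map_prod (snd ?c) (snd d) ` {(p, q). p \<in> fst ?c \<and> q \<in> fst d \<and> p \<otimes> q \<in> fst e}"
  note m = mult_coord[OF c(1) d e]
  have "smooth_on {y. (snd ?c a, y) \<in> ?S} (\<lambda>y. snd e (a \<otimes> chart_inv d y))"
    using smooth_on_slice_right[OF m, of "snd ?c a"] chart_facts(4)[OF c(3) c(2)] by simp
  then show "smooth_on (snd d ` {q \<in> fst d. a \<otimes> q \<in> fst e}) (snd e \<circ> (\<lambda>q. a \<otimes> q) \<circ> chart_inv d)"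
    unfolding o_def by (rule smooth_on_subset) (use c in force)
qed

section \<open>Left invariant fields under left translations\<close>

abbreviation U :: "'e \<Rightarrow> 'p \<Rightarrow> 'e" where "U \<equiv> left_invariant_field G M"

lemma U_one: "U u \<one> = u"
  unfolding left_invariant_field_def
  by (rule differential_ident[OF smooth_manifold]) (simp_all add: points)

lemma U_linear: "p \<in> carrier G \<Longrightarrow> linear (\<lambda>u. U u p)"
  unfolding left_invariant_field_def
  using differential_linear[OF smooth_manifold smooth_manifold smooth_left_translation, of p \<one>]
  by (simp add: points)

lemma U_translate:
  assumes a: "a \<in> carrier G" and p: "p \<in> carrier G"
  shows "differential M M (\<lambda>q. a \<otimes> q) p (U u p) = U u (a \<otimes> p)"
proof -
  have "differential M M (\<lambda>q. (a \<otimes> p) \<otimes> q) \<one> u =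
    differential M M (\<lambda>q. a \<otimes> q) (p \<otimes> \<one>) (differential M M (\<lambda>q. p \<otimes> q) \<one> u)"
    by (rule differential_comp[OF smooth_manifold smooth_manifold smooth_manifold
        smooth_left_translation[OF p] smooth_left_translation[OF a]])
      (use a p in \<open>simp_all add: points m_assoc\<close>)
  then show ?thesis using p by (simp add: left_invariant_field_def)
qed

lemma left_translation_isometric:
  assumes "a \<in> carrier G" "p \<in> carrier G"
  shows "riem_metric M (a \<otimes> p) (differential M M (\<lambda>q. a \<otimes> q) p u) (differential M M (\<lambda>q. a \<otimes> q) p v)
    = riem_metric M p u v"
  using riemannian_lie_group assms unfolding riemannian_lie_group_def by blast

lemma U_metric:
  assumes "p \<in> carrier G"
  shows "riem_metric M p (U u p) (U v p) = riem_metric M \<one> u v"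
  using left_translation_isometric[OF assms one_closed, of u v] assms
  by (simp add: left_invariant_field_def)

lemma left_translation_isometry_pair:
  assumes a: "a \<in> carrier G"
  shows "isometry_pair M (\<lambda>q. a \<otimes> q) (\<lambda>q. inv a \<otimes> q)"
  unfolding isometry_pair_def points
proof (intro conjI ballI allI smooth_left_translation a inv_closed)
  fix p assume p: "p \<in> carrier G"
  show "inv a \<otimes> (a \<otimes> p) = p" "a \<otimes> (inv a \<otimes> p) = p"
    using a p by (simp_all add: m_assoc[symmetric])
  show "riem_metric M (a \<otimes> p) (differential M M ((\<otimes>) a) p u) (differential M M ((\<otimes>) a) p v) = riem_metric M p u v" for u v
    using left_translation_isometric[OF a p] .
qed

text \<open>The value at \<open>p\<close> is the derivative of
  \<open>q \<mapsto> p \<otimes> q\<close> at the unit, a partial derivative of multiplication; as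
  such it depends smoothly on \<open>p\<close>.\<close>

lemma U_smooth:
  assumes c: "c \<in> atlas M"
  shows "smooth_on (chart_range c) (field_in_chart M c (U u))"
proof -
  let ?e = "chart_at M \<one>"
  note e = chart_at[OF one_closed] and cc = smooth_manifold_chart(1)[OF smooth_manifold c]
  define S where "S = map_prod (snd c) (snd ?e) ` {(p, q). p \<in> fst c \<and> q \<in> fst ?e \<and> p \<otimes> q \<in> fst c}"
  define m where "m = (\<lambda>(x, y). snd c (chart_inv c x \<otimes> chart_inv ?e y))"
  have S: "open S" "smooth_on S m"
    unfolding S_def m_def by (rule mult_coord[OF c e(1) c])+
  define y where "y = snd ?e \<one>"
  have xS: "(x, y) \<in> S" if "x \<in> chart_range c" for x
  proof -
    obtain p where p: "p \<in> fst c" "x = snd c p" using \<open>x \<in> chart_range c\<close> by (auto simp: chart_range_def)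
    have "p \<in> carrier G" using smooth_manifold_chart(2)[OF smooth_manifold c p(1)] points by simp
    then show ?thesis using p e(2) unfolding S_def y_def by (intro image_eqI[of _ _ "(p, \<one>)"]) auto
  qed
  \<comment> \<open>Differentiating on the product before slicing retains smoothness in the first
    variable.\<close>
  have "smooth_on S (\<lambda>z. deriv_along m z (0, u))" by (rule smooth_on_deriv_along[OF S(2)])
  from smooth_on_slice_left[OF S(1) this, of y]
  have sm: "smooth_on (chart_range c) (\<lambda>x. deriv_along m (x, y) (0, u))"
    by (rule smooth_on_subset) (use xS in blast)
  have eq: "deriv_along m (x, y) (0, u) = field_in_chart M c (U u) x" if x: "x \<in> chart_range c" for x
  proof -
    let ?p = "chart_inv c x"
    have p: "?p \<in> carrier G" using chart_inv_carrier[OF c x] .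
    have p1: "?p \<otimes> \<one> \<in> fst c" using p chart_facts(5)[OF cc x] by simp
    have "((\<lambda>y. (x, y)) has_derivative (\<lambda>v. (0, v))) (at y)"
      by (auto intro!: derivative_eq_intros)
    moreover have "(m has_derivative frechet_derivative m (at (x, y))) (at (x, y))"
      by (rule smooth_on_D(3)[OF S(2) xS[OF x]])
    ultimately have "(m \<circ> (\<lambda>y. (x, y)) has_derivative frechet_derivative m (at (x, y)) \<circ> (\<lambda>v. (0, v))) (at y)"
      by (rule diff_chain_at)
    from deriv_alongI[OF this, of u]
    have "deriv_along m (x, y) (0, u) = coord_deriv ?e c (\<lambda>q. ?p \<otimes> q) \<one> u"
      by (simp add: coord_deriv_def m_def o_def y_def)
    also have "\<dots> = tangent_components M c (?p \<otimes> \<one>) (differential M M (\<lambda>q. ?p \<otimes> q) \<one> u)"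
      using coord_deriv_differential[OF smooth_manifold smooth_manifold smooth_left_translation[OF p] e(1) c e(2) p1, of u]
        tangent_components_chart_at(1)[OF smooth_manifold, of \<one>] points by simp
    also have "\<dots> = field_in_chart M c (U u) x"
      using p by (simp add: field_in_chart_def left_invariant_field_def)
    finally show ?thesis .
  qed
  show ?thesis
    by (rule smooth_on_cong[THEN iffD1, OF chart_facts(2)[OF cc] eq sm])
qed

lemma field_in_chart_at:
  assumes "p \<in> carrier G"
  shows "field_in_chart M (chart_at M p) Y (snd (chart_at M p) p) = Y p"
  using tangent_components_chart_at(1)[OF smooth_manifold, of p] chart_facts(4)[OF chart_at(3) chart_at(2)] assms points
  by (simp add: field_in_chart_def)

lemma U_has_derivative:
  assumes "c \<in> atlas M" "p \<in> fst c"
  shows "(field_in_chart M c (U v) has_derivative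
    (\<lambda>u. deriv_along (field_in_chart M c (U v)) (snd c p) u)) (at (snd c p))"
  using smooth_on_D(3)[OF U_smooth[OF assms(1)]]
    chart_facts(8)[OF smooth_manifold_chart(1)[OF smooth_manifold assms(1)] assms(2)] by blast

section \<open>The Levi-Civita product on the Lie algebra\<close>

definition conn :: "'e \<Rightarrow> 'e \<Rightarrow> 'e" where "conn u v = cov_deriv M \<one> u (U v)"

lemma conn_eq: "conn u v = deriv_along (field_in_chart M (chart_at M \<one>) (U v)) (snd (chart_at M \<one>) \<one>) u
    + christoffel M (chart_at M \<one>) (snd (chart_at M \<one>) \<one>) u v"
  unfolding conn_def using cov_deriv_eq[OF smooth_manifold, of \<one> u "U v"] by (simp add: points U_one)

text \<open>Left translation by \<open>p\<close> is an isometry that carries \<open>U v\<close> to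
  itself, so the derivative at \<open>p\<close> is the translate of the one at the unit.\<close>

lemma cov_deriv_U:
  assumes p: "p \<in> carrier G"
  shows "cov_deriv M p (U u p) (U v) = U (conn u v) p"
proof -
  note e = chart_at[OF one_closed]
  have "cov_deriv M (p \<otimes> \<one>) (coord_deriv (chart_at M \<one>) (chart_at M (p \<otimes> \<one>)) (\<lambda>q. p \<otimes> q) \<one> u) (U v) =
    coord_deriv (chart_at M \<one>) (chart_at M (p \<otimes> \<one>)) (\<lambda>q. p \<otimes> q) \<one>
      (deriv_along (field_in_chart M (chart_at M \<one>) (U v)) (snd (chart_at M \<one>) \<one>) u
        + christoffel M (chart_at M \<one>) (snd (chart_at M \<one>) \<one>) u (tangent_components M (chart_at M \<one>) \<one> (U v \<one>)))"
    by (rule cov_deriv_isometry[OF riemannian left_translation_isometry_pair[OF p] e(1,2),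
          of "points M", OF _ _ _ U_has_derivative[OF e(1,2)]])
      (use p openin_topspace[of "mtop M"] in \<open>simp_all add: points U_translate\<close>)
  then show ?thesis
    using p tangent_components_chart_at(1)[OF smooth_manifold, of \<one>] points
    by (simp add: conn_eq left_invariant_field_def[of G M _ p] differential_eq U_one)
qed

lemma christoffel_simps:
  assumes "p \<in> carrier G"
  shows "bilinear (christoffel M (chart_at M p) (snd (chart_at M p) p))"
    "christoffel M (chart_at M p) (snd (chart_at M p) p) u v = christoffel M (chart_at M p) (snd (chart_at M p) p) v u"
  using christoffel_bilinear[OF riemannian chart_at(1)[OF assms] chart_facts(8)[OF chart_at(3)[OF assms] chart_at(2)[OF assms]]] .

lemma conn_bilinear: "bilinear conn"
proof -
  note e = chart_at[OF one_closed] and b = christoffel_simps(1)[OF one_closed]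
  let ?e = "chart_at M \<one>" let ?y = "snd (chart_at M \<one>) \<one>"
  note d = U_has_derivative[OF e(1,2)]
  note r = chart_facts(2)[OF e(3)] chart_facts(8)[OF e(3,2)]
  have T: "linear (\<lambda>u. U u (chart_inv ?e x))" "linear (tangent_components M ?e (chart_inv ?e x))"
    if "x \<in> chart_range ?e" for x
    using U_linear[OF chart_inv_carrier[OF e(1) that]]
      tangent_components_inverse(3)[OF smooth_manifold e(1) chart_facts(5)[OF e(3) that]] by auto
  have add: "deriv_along (field_in_chart M ?e (U (v + w))) ?y u =
      deriv_along (field_in_chart M ?e (U v)) ?y u + deriv_along (field_in_chart M ?e (U w)) ?y u" for v w u
    by (rule deriv_alongI, rule has_derivative_transform_within_open[OF has_derivative_add[OF d[of v] d[of w]] r])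
      (simp add: field_in_chart_def linear_add[OF T(1)] linear_add[OF T(2)])
  have scale: "deriv_along (field_in_chart M ?e (U (k *\<^sub>R v))) ?y u =
      k *\<^sub>R deriv_along (field_in_chart M ?e (U v)) ?y u" for v k u
    by (rule deriv_alongI, rule has_derivative_transform_within_open[OF has_derivative_scaleR_right[OF d[of v]] r])
      (simp add: field_in_chart_def linear_scale[OF T(1)] linear_scale[OF T(2)])
  note l = has_derivative_linear[OF d]
  show ?thesis
    unfolding bilinear_def
    by (auto intro!: linearI simp: conn_eq add scale linear_add[OF l] linear_scale[OF l] bilinear_simps[OF b] scaleR_add_right)
qed

text \<open>The scalar product of \<open>U v\<close> and \<open>U w\<close> is constant. In its
  derivative at the unit, metric compatibility of the Christoffel symbols supplies exactly the parts
  missing from the two values of \<open>conn\<close>.\<close>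

lemma conn_skew: "riem_metric M \<one> (conn u v) w + riem_metric M \<one> v (conn u w) = 0"
proof -
  note e = chart_at[OF one_closed]
  let ?e = "chart_at M \<one>" let ?y = "snd (chart_at M \<one>) \<one>"
  interpret e: local_metric "metric_in_chart M ?e" "chart_range ?e"
    by (rule local_metric_in_chart[OF riemannian e(1)])
  note y = chart_facts(8)[OF e(3,2)]
  note sp = riem_metric_scalar_product[OF riemannian, of \<one>, unfolded points, OF one_closed]
  have g: "metric_in_chart M ?e ?y a b = riem_metric M \<one> a b" for a b
    using metric_in_chart_components(2)[OF riemannian e(1,2)]
      tangent_components_chart_at(2)[OF smooth_manifold, of \<one>] points by simp
  have \<Gamma>: "deriv_along (\<lambda>x. metric_in_chart M ?e x v w) ?y u =
      riem_metric M \<one> (christoffel M ?e ?y u v) w + riem_metric M \<one> v (christoffel M ?e ?y u w)"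
    using christoffel_christoffel_form[OF riemannian e(1) y] unfolding christoffel_form_def g by blast
  have "((\<lambda>x. metric_in_chart M ?e x (field_in_chart M ?e (U v) x) (field_in_chart M ?e (U w) x)) has_derivative
    (\<lambda>u. deriv_along (\<lambda>x. metric_in_chart M ?e x (field_in_chart M ?e (U v) ?y) (field_in_chart M ?e (U w) ?y)) ?y u
      + metric_in_chart M ?e ?y (deriv_along (field_in_chart M ?e (U v)) ?y u) (field_in_chart M ?e (U w) ?y)
      + metric_in_chart M ?e ?y (field_in_chart M ?e (U v) ?y) (deriv_along (field_in_chart M ?e (U w)) ?y u))) (at ?y)"
    by (rule has_derivative_apply2[OF fd e.S y _ smooth_on_D(1)[OF e.smooth y]
          U_has_derivative[OF e(1,2)] U_has_derivative[OF e(1,2)]])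
      (use e.scalar in \<open>simp add: scalar_product_def\<close>)
  moreover have "((\<lambda>x. metric_in_chart M ?e x (field_in_chart M ?e (U v) x) (field_in_chart M ?e (U w) x))
      has_derivative (\<lambda>u. 0)) (at ?y)"
  proof (rule has_derivative_transform_within_open[OF has_derivative_const[of "riem_metric M \<one> v w"] e.S y])
    fix x assume x: "x \<in> chart_range ?e"
    have "metric_in_chart M ?e (snd ?e (chart_inv ?e x)) (field_in_chart M ?e (U v) x) (field_in_chart M ?e (U w) x) =
      riem_metric M (chart_inv ?e x) (U v (chart_inv ?e x)) (U w (chart_inv ?e x))"
      unfolding field_in_chart_def
      by (rule metric_in_chart_components(1)[OF riemannian e(1) chart_facts(5)[OF e(3) x]])
    then show "riem_metric M \<one> v w = metric_in_chart M ?e x (field_in_chart M ?e (U v) x) (field_in_chart M ?e (U w) x)"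
      using U_metric[OF chart_inv_carrier[OF e(1) x]] chart_facts(6)[OF e(3) x] by simp
  qed
  ultimately have "(\<lambda>u. deriv_along (\<lambda>x. metric_in_chart M ?e x (field_in_chart M ?e (U v) ?y) (field_in_chart M ?e (U w) ?y)) ?y u
      + metric_in_chart M ?e ?y (deriv_along (field_in_chart M ?e (U v)) ?y u) (field_in_chart M ?e (U w) ?y)
      + metric_in_chart M ?e ?y (field_in_chart M ?e (U v) ?y) (deriv_along (field_in_chart M ?e (U w)) ?y u)) = (\<lambda>u. 0)"
    by (rule has_derivative_unique)
  from fun_cong[OF this, of u] show ?thesis
    by (simp add: g field_in_chart_at U_one \<Gamma> conn_eq scalar_product_simps[OF sp])
qed

text \<open>The Christoffel terms cancel by symmetry; what remains is the bracket in
  coordinates.\<close>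

lemma conn_torsion: "conn u v - conn v u = lie_ad G M u v"
proof -
  have "lie_ad G M u v = deriv_along (field_in_chart M (chart_at M \<one>) (U v)) (snd (chart_at M \<one>) \<one>) u
    - deriv_along (field_in_chart M (chart_at M \<one>) (U u)) (snd (chart_at M \<one>) \<one>) v"
    by (simp add: lie_ad_def lie_bracket_def Let_def field_in_chart_def[abs_def] U_one)
  then show ?thesis
    using christoffel_simps(2)[OF one_closed, of u v] by (simp add: conn_eq)
qed

end

section \<open>Orthonormal frames and curvature\<close>

context riem_lie_group
begin

lemma scalar_product_riem_metric: "p \<in> carrier G \<Longrightarrow> scalar_product (riem_metric M p)"
  using riem_metric_scalar_product[OF riemannian] points by simp

lemma U_orthonormal:
  assumes "orthonormal (riem_metric M \<one>) k l" "p \<in> carrier G"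
  shows "orthonormal (riem_metric M p) k (\<lambda>j. U (l j) p)"
  using assms(1) unfolding orthonormal_def U_metric[OF assms(2)] .

lemma U_eq_0: "p \<in> carrier G \<Longrightarrow> U u p = 0 \<Longrightarrow> u = 0"
  using U_metric[of p u u] scalar_product_eq_0[OF scalar_product_riem_metric[OF one_closed], of u]
    scalar_product_simps(5)[OF scalar_product_riem_metric, of p 0] by simp

text \<open>The scalar product of the sum with \<open>u\<close> is the trace of
  \<open>lie_ad G M u\<close>: by skewness <nabla_u e_i, e_i> vanishes, and -<nabla_(e_i) u, e_i>
  equals <u, nabla_(e_i) e_i>.\<close>

lemma unimodular_conn:
  assumes unimodular: "unimodular_lie_algebra G M"
    and e: "orthonormal (riem_metric M \<one>) (dim (UNIV::'e set)) e"
  shows "(\<Sum>i<dim (UNIV::'e set). conn (e i) (e i)) = 0"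
proof (rule scalar_product_eqI)
  let ?n = "dim (UNIV::'e set)" let ?g = "riem_metric M \<one>"
  show sp: "scalar_product ?g" by (rule scalar_product_riem_metric[OF one_closed])
  fix u
  have ad: "lie_ad G M u v = conn u v - conn v u" for v by (simp add: conn_torsion)
  have lin: "linear (lie_ad G M u)"
    by (rule linearI) (simp_all add: ad bilinear_simps[OF conn_bilinear] scaleR_diff_right)
  have diag: "?g (conn u (e i)) (e i) = 0" for i
    using conn_skew[of u "e i" "e i"] scalar_product_sym[OF sp, of "e i" "conn u (e i)"] by simp
  have "?g (lie_ad G M u (e i)) (e i) = ?g (conn (e i) (e i)) u" for i
    using conn_skew[of "e i" u "e i"] diag[of i] scalar_product_sym[OF sp, of u]
    by (simp add: ad scalar_product_simps[OF sp])
  then have "?g (\<Sum>i<?n. conn (e i) (e i)) u = endo_trace (lie_ad G M u)"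
    by (simp add: endo_trace_orthonormal[OF fd sp e lin] scalar_product_simps[OF sp])
  then show "?g (\<Sum>i<?n. conn (e i) (e i)) u = ?g 0 u"
    using unimodular by (simp add: unimodular_lie_algebra_def scalar_product_simps[OF sp])
qed

lemma U_frame:
  assumes l: "orthonormal (riem_metric M \<one>) (dim (UNIV::'e set)) l"
  shows "orthonormal_frame_on M (points M) (\<lambda>j. U (l j))"
  unfolding orthonormal_frame_on_def smooth_vector_field_on_def
proof (intro conjI allI impI ballI)
  fix c j assume c: "c \<in> atlas M"
  note cc = smooth_manifold_chart(1)[OF smooth_manifold c]
  have "snd c ` (fst c \<inter> points M) \<subseteq> chart_range c" by (auto simp: chart_range_def)
  from smooth_on_subset[OF U_smooth[OF c] this]
  show "smooth_on (snd c ` (fst c \<inter> points M)) (\<lambda>x. tangent_components M c (chart_inv c x) (U (l j) (chart_inv c x)))"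
    by (simp add: field_in_chart_def[abs_def])
next
  fix p i j assume "p \<in> points M" "i < dim (UNIV::'e set)" "j < dim (UNIV::'e set)"
  then show "riem_metric M p (U (l i) p) (U (l j) p) = (if i = j then 1 else 0)"
    using U_orthonormal[OF l, of p] points by (simp add: orthonormal_def)
qed simp

text \<open>The choice in \<open>local_frame\<close> has the intended property only if some frame
  exists; a left invariant one does, on the whole group.\<close>

lemma local_frame:
  assumes "p \<in> carrier G"
  obtains W where "p \<in> W" "orthonormal_frame_on M W (local_frame M p)"
proof -
  obtain l where "orthonormal (riem_metric M \<one>) (dim (UNIV::'e set)) l"
    using orthonormal_exists[OF fd scalar_product_riem_metric[OF one_closed]] .
  then have "\<exists>E W. p \<in> W \<and> orthonormal_frame_on M W E"
    using U_frame assms points by blast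
  from someI_ex[OF this] show ?thesis using that unfolding local_frame_def by blast
qed

text \<open>The coefficients are scalar products of the frame with a left invariant one, so the
  product rule makes them differentiable at \<open>p\<close>. Their derivative is claimed only for
  indices below the dimension, where \<open>orthonormal_frame_on\<close> controls the frame.
  Orthonormality of \<open>e\<close> comes from \<open>U\<close> being isometric at
  \<open>p\<close>.\<close>

lemma frame_expansion:
  assumes l: "orthonormal (riem_metric M \<one>) (dim (UNIV::'e set)) l"
    and E: "orthonormal_frame_on M W E" and p: "p \<in> W"
  obtains c C e where
    "\<And>i q. q \<in> W \<Longrightarrow> E i q = (\<Sum>j<dim (UNIV::'e set). c i j q *\<^sub>R U (l j) q)"
    "\<And>i j. i < dim (UNIV::'e set) \<Longrightarrow>
      ((\<lambda>x. c i j (chart_inv (chart_at M p) x)) has_derivative C i j) (at (snd (chart_at M p) p))"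
    "\<And>i. e i = (\<Sum>j<dim (UNIV::'e set). c i j p *\<^sub>R l j)"
    "orthonormal (riem_metric M \<one>) (dim (UNIV::'e set)) e" "\<And>i. E i p = U (e i) p"
    "\<And>i q. q \<in> W \<Longrightarrow> E i q = U (\<Sum>j<dim (UNIV::'e set). c i j q *\<^sub>R l j) q"
proof -
  let ?n = "dim (UNIV::'e set)"
  have oW: "openin (mtop M) W" and
    sE: "\<And>i c. i < ?n \<Longrightarrow> c \<in> atlas M \<Longrightarrow> smooth_on (snd c ` (fst c \<inter> W)) (field_in_chart M c (E i))" and
    oE: "\<And>q. q \<in> W \<Longrightarrow> orthonormal (riem_metric M q) ?n (\<lambda>i. E i q)"
    using E unfolding orthonormal_frame_on_def smooth_vector_field_on_def orthonormal_def field_in_chart_def[abs_def]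
    by blast+
  have W: "q \<in> carrier G" if "q \<in> W" for q using openin_subset[OF oW] that points by blast
  define c where "c i j q = riem_metric M q (E i q) (U (l j) q)" for i j q
  define e where "e i = (\<Sum>j<?n. c i j p *\<^sub>R l j)" for i
  have ex: "E i q = (\<Sum>j<?n. c i j q *\<^sub>R U (l j) q)" if "q \<in> W" for i q
    unfolding c_def
    by (rule orthonormal_expansion[OF fd scalar_product_riem_metric[OF W[OF that]] U_orthonormal[OF l W[OF that]]])
  have exU: "E i q = U (\<Sum>j<?n. c i j q *\<^sub>R l j) q" if "q \<in> W" for i q
    unfolding ex[OF that] linear_sum[OF U_linear[OF W[OF that]]] linear_scale[OF U_linear[OF W[OF that]]] ..
  have Ep: "E i p = U (e i) p" for i using exU[OF p] by (simp add: e_def)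
  have oe: "orthonormal (riem_metric M \<one>) ?n e"
    using oE[OF p] unfolding orthonormal_def Ep U_metric[OF W[OF p]] .
  let ?c = "chart_at M p"
  note cp = chart_at[OF W[OF p]]
  define R where "R = snd ?c ` (fst ?c \<inter> W)"
  have R: "open R"
    unfolding R_def using chart_facts(7)[OF cp(3), of "fst ?c \<inter> W"] chart_facts(1)[OF cp(3)] oW by auto
  have xR: "snd ?c p \<in> R" using cp p by (auto simp: R_def)
  have Rr: "R \<subseteq> chart_range ?c" by (auto simp: R_def chart_range_def)
  interpret g: local_metric "metric_in_chart M ?c" "chart_range ?c"
    by (rule local_metric_in_chart[OF riemannian cp(1)])
  have "(\<lambda>x. c i j (chart_inv ?c x)) differentiable (at (snd ?c p))" if i: "i < ?n" for i j
  proof -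
    have b: "bilinear (metric_in_chart M ?c y)" if "y \<in> chart_range ?c" for y
      using g.scalar[OF that] by (simp add: scalar_product_def)
    have xr: "snd ?c p \<in> chart_range ?c" using xR Rr by blast
    note sEi = sE[OF i cp(1), folded R_def]
    have "((\<lambda>x. metric_in_chart M ?c x (field_in_chart M ?c (E i) x) (field_in_chart M ?c (U (l j)) x)) has_derivative
        (\<lambda>u. deriv_along (\<lambda>x. metric_in_chart M ?c x (field_in_chart M ?c (E i) (snd ?c p)) (field_in_chart M ?c (U (l j)) (snd ?c p))) (snd ?c p) u
      + metric_in_chart M ?c (snd ?c p) (deriv_along (field_in_chart M ?c (E i)) (snd ?c p) u) (field_in_chart M ?c (U (l j)) (snd ?c p))
      + metric_in_chart M ?c (snd ?c p) (field_in_chart M ?c (E i) (snd ?c p)) (deriv_along (field_in_chart M ?c (U (l j))) (snd ?c p) u))) (at (snd ?c p))"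
      by (rule has_derivative_apply2[OF fd g.S xr b smooth_on_D(1)[OF g.smooth xr]
          smooth_on_D(3)[OF sEi xR] U_has_derivative[OF cp(1,2)]])
    then have "((\<lambda>x. c i j (chart_inv ?c x)) has_derivative
        (\<lambda>u. deriv_along (\<lambda>x. metric_in_chart M ?c x (field_in_chart M ?c (E i) (snd ?c p)) (field_in_chart M ?c (U (l j)) (snd ?c p))) (snd ?c p) u
      + metric_in_chart M ?c (snd ?c p) (deriv_along (field_in_chart M ?c (E i)) (snd ?c p) u) (field_in_chart M ?c (U (l j)) (snd ?c p))
      + metric_in_chart M ?c (snd ?c p) (field_in_chart M ?c (E i) (snd ?c p)) (deriv_along (field_in_chart M ?c (U (l j))) (snd ?c p) u))) (at (snd ?c p))"
    proof (rule has_derivative_transform_within_open[OF _ R xR])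
      fix x assume "x \<in> R"
      then obtain q where q: "q \<in> fst ?c" "q \<in> W" "x = snd ?c q" by (auto simp: R_def)
      show "metric_in_chart M ?c x (field_in_chart M ?c (E i) x) (field_in_chart M ?c (U (l j)) x) = c i j (chart_inv ?c x)"
        using metric_in_chart_components(1)[OF riemannian cp(1) q(1)] chart_facts(4)[OF cp(3) q(1)]
        by (simp add: q(3) field_in_chart_def c_def)
    qed
    then show ?thesis by (rule differentiableI)
  qed
  then have C: "((\<lambda>x. c i j (chart_inv ?c x)) has_derivative
      frechet_derivative (\<lambda>x. c i j (chart_inv ?c x)) (at (snd ?c p))) (at (snd ?c p))" if "i < ?n" for i j
    using that frechet_derivative_works by blast
  show ?thesis
    by (rule that[OF ex C e_def oe Ep exU])
qed

section \<open>Curvature in a chart and its sign\<close>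

lemma cov_deriv_zero:
  assumes q: "q \<in> carrier G" and Y: "(field_in_chart M (chart_at M q) Y has_derivative D) (at (snd (chart_at M q) q))"
  shows "cov_deriv M q 0 Y = 0"
  \<comment> \<open>Differentiability makes the coordinate derivative linear in the direction, hence
    zero in direction zero.\<close>
  using cov_deriv_eq[OF smooth_manifold, of q 0 Y] q points deriv_alongI[OF Y, of 0]
    linear_0[OF has_derivative_linear[OF Y]] bilinear_simps(5)[OF christoffel_simps(1)[OF q]] by simp

text \<open>These fields are constant in the chart at \<open>q\<close>, but \<open>cov_deriv\<close>
  at a nearby \<open>p\<close> uses the chart at \<open>p\<close>. The last claim bridges the two
  charts, as the second derivatives in the curvature differentiate this expression in
  \<open>p\<close>.\<close>

lemma extend_vector_facts:
  assumes q: "q \<in> carrier G"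
  defines "d \<equiv> chart_at M q"
  shows "p \<in> fst d \<Longrightarrow> tangent_components M d p (extend_vector M q u p) = u"
    "extend_vector M q u q = u"
    "p \<in> fst d \<Longrightarrow> (field_in_chart M d (extend_vector M q u) has_derivative (\<lambda>v. 0)) (at (snd d p))"
    "p \<in> fst d \<Longrightarrow> cov_deriv M p (extend_vector M q v p) (extend_vector M q w) =
      extend_vector M q (christoffel M d (snd d p) v w) p"
proof -
  note d = chart_at[OF q, folded d_def]
  have 1: "tangent_components M d p (extend_vector M q u p) = u" if "p \<in> fst d" for p u
    unfolding extend_vector_def d_def[symmetric]
    by (rule tangent_components_inverse(1)[OF smooth_manifold d(1) that])
  then show "p \<in> fst d \<Longrightarrow> tangent_components M d p (extend_vector M q u p) = u" .
  show "extend_vector M q u q = u"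
    using tangent_components_chart_at(2)[OF smooth_manifold, of q u] q points by (simp add: extend_vector_def)
  have 2: "(field_in_chart M d (extend_vector M q u) has_derivative (\<lambda>v. 0)) (at (snd d p))" if "p \<in> fst d" for p u
    by (rule has_derivative_transform_within_open[OF has_derivative_const[of u] chart_facts(2)[OF d(3)] chart_facts(8)[OF d(3) that]])
      (simp add: field_in_chart_def 1 chart_facts(5)[OF d(3)])
  then show "p \<in> fst d \<Longrightarrow> (field_in_chart M d (extend_vector M q u) has_derivative (\<lambda>v. 0)) (at (snd d p))" .
  assume p: "p \<in> fst d"
  have pM: "p \<in> points M" using smooth_manifold_chart(2)[OF smooth_manifold d(1) p] .
  have e: "extend_vector M q u p = coord_deriv d (chart_at M p) (\<lambda>q. q) p u" for u
    unfolding extend_vector_def tangent_from_components_eq d_def ..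
  have id: "extend_vector M q w r = differential M M (\<lambda>q. q) r (extend_vector M q w r)" if "r \<in> points M" for r
    by (rule differential_ident[OF smooth_manifold that, symmetric]) (rule refl)
  \<comment> \<open>Transport by the identity, which amounts to the change from the chart
    \<open>d\<close> to the chart at \<open>p\<close>.\<close>
  have "cov_deriv M p (coord_deriv d (chart_at M p) (\<lambda>q. q) p v) (extend_vector M q w) =
    coord_deriv d (chart_at M p) (\<lambda>q. q) p (0 + christoffel M d (snd d p) v (tangent_components M d p (extend_vector M q w p)))"
    by (rule cov_deriv_isometry[OF riemannian isometry_pair_ident[OF riemannian] d(1) p openin_topspace pM id 2[OF p]])
  then show "cov_deriv M p (extend_vector M q v p) (extend_vector M q w) =
      extend_vector M q (christoffel M d (snd d p) v w) p"
    unfolding e[symmetric] 1[OF p] by simp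
qed

text \<open>A left invariant orthonormal frame, read in the chart, is the differentiable frame that
  the Koszul argument asks for.\<close>

lemma christoffel_differentiable:
  assumes q: "q \<in> carrier G"
  defines "d \<equiv> chart_at M q"
  shows "(\<lambda>x. christoffel M d x u v) differentiable (at (snd d q))"
proof -
  note d = chart_at[OF q, folded d_def]
  interpret g: local_metric "metric_in_chart M d" "chart_range d"
    by (rule local_metric_in_chart[OF riemannian d(1)])
  obtain l where l: "orthonormal (riem_metric M \<one>) (dim (UNIV::'e set)) l"
    using orthonormal_exists[OF fd scalar_product_riem_metric[OF one_closed]] .
  show ?thesis
  proof (rule g.christoffel_form_differentiable[where E = "\<lambda>i. field_in_chart M d (U (l i))"])
    show x: "snd d q \<in> chart_range d" by (rule chart_facts(8)[OF d(3,2)])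
    show "christoffel_form (metric_in_chart M d) z (christoffel M d z)" if "z \<in> chart_range d" for z
      by (rule christoffel_christoffel_form[OF riemannian d(1) that])
    show "field_in_chart M d (U (l i)) differentiable (at (snd d q))" for i
      by (rule smooth_on_D(1)[OF U_smooth[OF d(1)] x])
    show "orthonormal (metric_in_chart M d z) (dim (UNIV::'e set)) (\<lambda>i. field_in_chart M d (U (l i)) z)"
      if "z \<in> chart_range d" for z
    proof -
      obtain p where p: "p \<in> fst d" "z = snd d p" using \<open>z \<in> chart_range d\<close> by (auto simp: chart_range_def)
      have "p \<in> carrier G" using smooth_manifold_chart(2)[OF smooth_manifold d(1) p(1)] points by simp
      then show ?thesis
        using U_orthonormal[OF l] unfolding orthonormal_def p(2) field_in_chart_def chart_facts(4)[OF d(3) p(1)]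
          metric_in_chart_components(1)[OF riemannian d(1) p(1)] by blast
    qed
  qed
qed

text \<open>The extended fields have constant components, so their bracket vanishes at
  \<open>q\<close> and the inner covariant derivatives are Christoffel symbols in the chart at
  \<open>q\<close>.\<close>

lemma curvature_eq:
  assumes q: "q \<in> carrier G"
  defines "d \<equiv> chart_at M q"
  shows "curvature M q u v w =
    deriv_along (\<lambda>x. christoffel M d x v w) (snd d q) u + christoffel M d (snd d q) u (christoffel M d (snd d q) v w)
    - (deriv_along (\<lambda>x. christoffel M d x u w) (snd d q) v + christoffel M d (snd d q) v (christoffel M d (snd d q) u w))"
proof -
  note d = chart_at[OF q, folded d_def] and ev = extend_vector_facts[OF q, folded d_def]
  let ?X = "extend_vector M q"
  have second: "levi_civita M (?X u) (levi_civita M (?X v) (?X w)) q =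
    deriv_along (\<lambda>x. christoffel M d x v w) (snd d q) u + christoffel M d (snd d q) u (christoffel M d (snd d q) v w)"
    for u v
  proof -
    define L where "L = levi_civita M (?X v) (?X w)"
    have L: "L p = ?X (christoffel M d (snd d p) v w) p" if "p \<in> fst d" for p
      unfolding L_def levi_civita_eq by (rule ev(4)[OF that])
    have "((\<lambda>x. christoffel M d x v w) has_derivative (\<lambda>u. deriv_along (\<lambda>x. christoffel M d x v w) (snd d q) u)) (at (snd d q))"
      using christoffel_differentiable[OF q, folded d_def] frechet_derivative_works by blast
    then have "(field_in_chart M d L has_derivative (\<lambda>u. deriv_along (\<lambda>x. christoffel M d x v w) (snd d q) u)) (at (snd d q))"
    proof (rule has_derivative_transform_within_open[OF _ chart_facts(2)[OF d(3)] chart_facts(8)[OF d(3,2)]])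
      fix x assume x: "x \<in> chart_range d"
      note p = chart_facts(5,6)[OF d(3) x]
      show "christoffel M d x v w = field_in_chart M d L x"
        unfolding field_in_chart_def L[OF p(1)] ev(1)[OF p(1)] p(2) ..
    qed
    from deriv_alongI[OF this, of u]
    show ?thesis
      using cov_deriv_eq[OF smooth_manifold, of q u L] q points
      by (simp add: levi_civita_eq[of M "?X u"] L_def[symmetric] ev(2) d_def[symmetric] L[OF d(2)])
  qed
  have "lie_bracket M (?X u) (?X v) q = 0"
    using deriv_alongI[OF ev(3)[OF d(2)]]
    by (simp add: lie_bracket_def Let_def d_def[symmetric] field_in_chart_def[abs_def])
  then have "levi_civita M (lie_bracket M (?X u) (?X v)) (?X w) q = 0"
    using cov_deriv_zero[OF q ev(3)[OF d(2), unfolded d_def]] by (simp add: levi_civita_eq)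
  then show ?thesis
    by (simp add: curvature_def curvature_of_fields_def second)
qed

text \<open>Covers the pairs on which sectional curvature gives no information. In the coordinate
  formula the two halves become the same multiple of one expression.\<close>

lemma curvature_dependent:
  assumes q: "q \<in> carrier G"
  shows "curvature M q (k *\<^sub>R v) v w = 0" "curvature M q u 0 0 = 0"
proof -
  let ?d = "chart_at M q"
  note d = chart_at[OF q]
  note r = chart_facts(2)[OF d(3)] chart_facts(8)[OF d(3,2)]
  have b: "bilinear (christoffel M ?d x)" if "x \<in> chart_range ?d" for x
    by (rule christoffel_bilinear(1)[OF riemannian d(1) that])
  have D: "((\<lambda>x. christoffel M ?d x a b) has_derivative (\<lambda>u. deriv_along (\<lambda>x. christoffel M ?d x a b) (snd ?d q) u)) (at (snd ?d q))" for a b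
    using christoffel_differentiable[OF q] frechet_derivative_works by blast
  note l = has_derivative_linear[OF D]
  have s: "deriv_along (\<lambda>x. christoffel M ?d x (k *\<^sub>R v) w) (snd ?d q) u = k *\<^sub>R deriv_along (\<lambda>x. christoffel M ?d x v w) (snd ?d q) u" for k v u w
    by (rule deriv_alongI, rule has_derivative_transform_within_open[OF has_derivative_scaleR_right[OF D[of v w]] r])
      (simp add: bilinear_simps[OF b])
  show "curvature M q (k *\<^sub>R v) v w = 0"
    unfolding curvature_eq[OF q] by (simp add: s linear_scale[OF l] bilinear_simps[OF b[OF r(2)]])
  show "curvature M q u 0 0 = 0"
    unfolding curvature_eq[OF q] using s[of 0 0 0 u]
    by (simp add: linear_0[OF l] bilinear_simps[OF b[OF r(2)]])
qed

lemma curvature_nonpositive: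
  assumes q: "q \<in> carrier G" and np: "nonpositive_sectional_curvature M"
  shows "riem_metric M q (curvature M q u v v) u \<le> 0"
proof (cases "independent {u, v} \<and> u \<noteq> v")
  case True
  note sp = scalar_product_riem_metric[OF q]
  have "sectional_curvature M q u v \<le> 0"
    using np True q points by (simp add: nonpositive_sectional_curvature_def)
  moreover have "0 < riem_metric M q u u * riem_metric M q v v - (riem_metric M q u v)\<^sup>2"
    using scalar_product_cauchy_schwarz[OF sp, of u v] True by simp
  ultimately show ?thesis
    by (simp add: sectional_curvature_def divide_le_0_iff)
next
  case False
  have "curvature M q u v v = 0"
  proof (cases "v = 0")
    case True
    then show ?thesis using curvature_dependent(2)[OF q] by simp
  next
    case v: False
    have "\<exists>k. u = k *\<^sub>R v"
    \<comment> \<open>For \<open>u = v\<close> the set \<open>{u, v}\<close> is a singleton and may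
      well be independent, so dependence cannot be read off it.\<close>
    proof (cases "u = v")
      case True
      then show ?thesis by (intro exI[of _ 1]) simp
    next
      case ne: False
      then have "u \<in> span {v}" using False v by (simp add: independent_insert)
      then show ?thesis by (auto simp: span_singleton)
    qed
    then show ?thesis using curvature_dependent(1)[OF q] by blast
  qed
  then show ?thesis using scalar_product_simps(5)[OF scalar_product_riem_metric[OF q]] by simp
qed

end

section \<open>Homomorphisms\<close>

locale riem_lie_group_hom = G: riem_lie_group G M + H: riem_lie_group H N
  for G :: "('p, 'm) monoid_scheme" and M :: "('p, 'e::real_inner, 'x) riem_manifold_scheme"
    and H :: "('q, 'k) monoid_scheme" and N :: "('q, 'f::real_inner, 'y) riem_manifold_scheme" +
  fixes \<phi> :: "'p \<Rightarrow> 'q"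
  assumes hom: "\<phi> \<in> hom G H" and smooth: "smooth_map M N \<phi>"
begin

section \<open>Fields along the homomorphism\<close>

definition lie_map :: "'e \<Rightarrow> 'f" where "lie_map u = differential M N \<phi> \<one>\<^bsub>G\<^esub> u"

lemma phi_closed: "p \<in> carrier G \<Longrightarrow> \<phi> p \<in> carrier H"
  using hom by (auto simp: hom_def)

lemma phi_one: "\<phi> \<one>\<^bsub>G\<^esub> = \<one>\<^bsub>H\<^esub>"
  by (rule hom_one[OF hom G.group H.group])

lemma lie_map_linear: "linear lie_map"
  unfolding lie_map_def[abs_def]
  using differential_linear[OF G.smooth_manifold H.smooth_manifold smooth, of "\<one>\<^bsub>G\<^esub>"] G.points by simp

text \<open>\<phi> after left translation by \<open>p\<close> equals left translation by
  \<open>\<phi> p\<close> after \<phi>; the chain rule at the unit is applied to both sides.\<close>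

lemma differential_U:
  assumes p: "p \<in> carrier G"
  shows "differential M N \<phi> p (G.U u p) = H.U (lie_map u) (\<phi> p)"
proof -
  have "differential M N (\<lambda>q. \<phi> (p \<otimes>\<^bsub>G\<^esub> q)) \<one>\<^bsub>G\<^esub> u = differential M N \<phi> (p \<otimes>\<^bsub>G\<^esub> \<one>\<^bsub>G\<^esub>) (G.U u p)"
    unfolding left_invariant_field_def
    by (rule differential_comp[OF G.smooth_manifold G.smooth_manifold H.smooth_manifold
          G.smooth_left_translation[OF p] smooth]) (simp_all add: G.points)
  moreover have "differential M N (\<lambda>q. \<phi> (p \<otimes>\<^bsub>G\<^esub> q)) \<one>\<^bsub>G\<^esub> u =
    differential N N (\<lambda>q. \<phi> p \<otimes>\<^bsub>H\<^esub> q) (\<phi> \<one>\<^bsub>G\<^esub>) (lie_map u)"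
    unfolding lie_map_def
    by (rule differential_comp[OF G.smooth_manifold H.smooth_manifold H.smooth_manifold
          smooth H.smooth_left_translation[OF phi_closed[OF p]]])
      (use p hom in \<open>simp_all add: G.points hom_mult\<close>)
  ultimately show ?thesis using p by (simp add: left_invariant_field_def phi_one)
qed

text \<open>The Leibniz rule for a combination, with variable coefficients, of left invariant fields
  along \<phi>. It is the only place where the pull-back connection is computed in charts: moving
  frames, fields of constant coefficients and the identity map are instances.\<close>

lemma pullback_conn_frame:
  assumes p: "p \<in> carrier G" and W: "openin (mtop M) W" "p \<in> W"
    and V: "\<And>q. q \<in> W \<Longrightarrow> V q = (\<Sum>j\<in>I. c j q *\<^sub>R H.U (w j) (\<phi> q))"
    and C: "\<And>j. j \<in> I \<Longrightarrow>
      ((\<lambda>x. c j (chart_inv (chart_at M p) x)) has_derivative C j) (at (snd (chart_at M p) p))"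
  shows "pullback_conn M N \<phi> p (G.U u p) V =
    H.U (\<Sum>j\<in>I. C j (G.U u p) *\<^sub>R w j + c j p *\<^sub>R H.conn (lie_map u) (w j)) (\<phi> p)"
proof -
  let ?c = "chart_at M p" let ?d = "chart_at N (\<phi> p)"
  note c = G.chart_at[OF p] and q = phi_closed[OF p]
  note d = H.chart_at[OF q]
  define \<kappa> where "\<kappa> = snd ?d \<circ> \<phi> \<circ> chart_inv ?c"
  define x where "x = snd ?c p"
  define Y where "Y j = field_in_chart N ?d (H.U (w j))" for j
  define DY where "DY j v = deriv_along (Y j) (snd ?d (\<phi> p)) v" for j v
  define R where "R = snd ?c ` ({q \<in> fst ?c. \<phi> q \<in> fst ?d} \<inter> W)"
  have R: "open R"
    unfolding R_def
    using smooth_map_coord(1)[OF G.smooth_manifold H.smooth_manifold smooth c(1) d(1)] W(1)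
    by (intro chart_facts(7)[OF c(3)]) auto
  have xR: "x \<in> R" using c d W by (auto simp: R_def x_def)
  have xp: "chart_inv ?c x = p" by (simp add: x_def chart_facts(4)[OF c(3) c(2)])
  have \<kappa>x: "\<kappa> x = snd ?d (\<phi> p)" by (simp add: \<kappa>_def xp)
  have \<kappa>: "(\<kappa> has_derivative differential M N \<phi> p) (at x)"
    unfolding \<kappa>_def x_def differential_eq
    by (rule coord_deriv_has_derivative(1)[OF G.smooth_manifold H.smooth_manifold smooth c(1) d(1) c(2) d(2)])
  have Y: "(Y j has_derivative DY j) (at (\<kappa> x))" for j
    unfolding \<kappa>x Y_def DY_def[abs_def] by (rule H.U_has_derivative[OF d(1,2)])
  have Yx: "Y j (\<kappa> x) = H.U (w j) (\<phi> p)" for j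
    unfolding \<kappa>x Y_def by (rule H.field_in_chart_at[OF q])
  have Y\<kappa>: "((\<lambda>x. Y j (\<kappa> x)) has_derivative (\<lambda>v. DY j (differential M N \<phi> p v))) (at x)" for j
    using diff_chain_at[OF \<kappa> Y[of j]] by (simp add: o_def)
  have "((\<lambda>x. \<Sum>j\<in>I. c j (chart_inv ?c x) *\<^sub>R Y j (\<kappa> x)) has_derivative
    (\<lambda>v. \<Sum>j\<in>I. c j (chart_inv ?c x) *\<^sub>R DY j (differential M N \<phi> p v) + C j v *\<^sub>R Y j (\<kappa> x))) (at x)"
    by (intro has_derivative_sum has_derivative_scaleR Y\<kappa>) (use C in \<open>simp add: x_def\<close>)
  then have "((\<lambda>x. tangent_components N ?d (\<phi> (chart_inv ?c x)) (V (chart_inv ?c x))) has_derivative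
    (\<lambda>v. \<Sum>j\<in>I. c j (chart_inv ?c x) *\<^sub>R DY j (differential M N \<phi> p v) + C j v *\<^sub>R Y j (\<kappa> x))) (at x)"
  proof (rule has_derivative_transform_within_open[OF _ R xR])
    fix y assume "y \<in> R"
    then obtain r where r: "r \<in> fst ?c" "\<phi> r \<in> fst ?d" "r \<in> W" "y = snd ?c r" unfolding R_def by blast
    note l = tangent_components_inverse(3)[OF H.smooth_manifold d(1) r(2)]
    have "Y j (\<kappa> y) = tangent_components N ?d (\<phi> r) (H.U (w j) (\<phi> r))" for j
      by (simp add: Y_def \<kappa>_def field_in_chart_def r(4) chart_facts(4)[OF c(3) r(1)] chart_facts(4)[OF d(3) r(2)])
    then show "(\<Sum>j\<in>I. c j (chart_inv ?c y) *\<^sub>R Y j (\<kappa> y)) = tangent_components N ?d (\<phi> (chart_inv ?c y)) (V (chart_inv ?c y))"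
      by (simp add: r(4) chart_facts(4)[OF c(3) r(1)] V[OF r(3)] linear_sum[OF l] linear_scale[OF l])
  qed
  from deriv_alongI[OF this, of "G.U u p"]
  have 1: "deriv_along (\<lambda>x. tangent_components N ?d (\<phi> (chart_inv ?c x)) (V (chart_inv ?c x))) x (G.U u p) =
    (\<Sum>j\<in>I. c j p *\<^sub>R DY j (H.U (lie_map u) (\<phi> p)) + C j (G.U u p) *\<^sub>R H.U (w j) (\<phi> p))"
    by (simp add: xp Yx differential_U[OF p])
  note b = H.christoffel_simps(1)[OF q]
  \<comment> \<open>The derivative of the chart components and the Christoffel term recombine into
    the covariant derivative of a left invariant field of \<open>H\<close>.\<close>
  have 2: "DY j (H.U (lie_map u) (\<phi> p)) + christoffel N ?d (snd ?d (\<phi> p)) (H.U (lie_map u) (\<phi> p)) (H.U (w j) (\<phi> p)) =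
      H.U (H.conn (lie_map u) (w j)) (\<phi> p)" for j
    unfolding H.cov_deriv_U[OF q, symmetric]
    using cov_deriv_eq[OF H.smooth_manifold, of "\<phi> p"] q by (simp add: H.points DY_def Y_def)
  note l = H.U_linear[OF q]
  have "pullback_conn M N \<phi> p (G.U u p) V =
    (\<Sum>j\<in>I. c j p *\<^sub>R DY j (H.U (lie_map u) (\<phi> p)) + C j (G.U u p) *\<^sub>R H.U (w j) (\<phi> p))
    + christoffel N ?d (snd ?d (\<phi> p)) (H.U (lie_map u) (\<phi> p)) (\<Sum>j\<in>I. c j p *\<^sub>R H.U (w j) (\<phi> p))"
    using 1 by (simp add: pullback_conn_def Let_def x_def[symmetric] differential_U[OF p] V[OF W(2)])
  also have "\<dots> = (\<Sum>j\<in>I. c j p *\<^sub>R (DY j (H.U (lie_map u) (\<phi> p)) + christoffel N ?d (snd ?d (\<phi> p)) (H.U (lie_map u) (\<phi> p)) (H.U (w j) (\<phi> p)))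
      + C j (G.U u p) *\<^sub>R H.U (w j) (\<phi> p))"
    unfolding bilinear_simps[OF b] sum.distrib[symmetric] scaleR_add_right by (simp add: ac_simps)
  also have "\<dots> = (\<Sum>j\<in>I. H.U (C j (G.U u p) *\<^sub>R w j + c j p *\<^sub>R H.conn (lie_map u) (w j)) (\<phi> p))"
    unfolding 2 linear_add[OF l] linear_scale[OF l] by (simp add: add.commute)
  also have "\<dots> = H.U (\<Sum>j\<in>I. C j (G.U u p) *\<^sub>R w j + c j p *\<^sub>R H.conn (lie_map u) (w j)) (\<phi> p)"
    by (rule linear_sum[OF l, symmetric])
  finally show ?thesis .
qed

end

context riem_lie_group
begin

lemma ident_hom: "riem_lie_group_hom G M G M (\<lambda>q. q)"
  by unfold_locales (auto simp: hom_def smooth_map_ident[OF smooth_manifold])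

text \<open>The identity is a homomorphism with the identity as its Lie algebra map.\<close>

lemma cov_deriv_frame:
  assumes p: "p \<in> carrier G" and W: "openin (mtop M) W" "p \<in> W"
    and V: "\<And>q. q \<in> W \<Longrightarrow> V q = (\<Sum>j\<in>I. c j q *\<^sub>R U (w j) q)"
    and C: "\<And>j. j \<in> I \<Longrightarrow>
      ((\<lambda>x. c j (chart_inv (chart_at M p) x)) has_derivative C j) (at (snd (chart_at M p) p))"
  shows "cov_deriv M p (U u p) V = U (\<Sum>j\<in>I. C j (U u p) *\<^sub>R w j + c j p *\<^sub>R conn u (w j)) p"
proof -
  interpret I: riem_lie_group_hom G M G M "\<lambda>q. q" by (rule ident_hom)
  have "I.lie_map v = v" for v
    unfolding I.lie_map_def by (rule differential_ident[OF smooth_manifold]) (simp_all add: points)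
  then show ?thesis
    unfolding cov_deriv_def using I.pullback_conn_frame[OF p W V C, of u] by simp
qed

end

context riem_lie_group_hom
begin

section \<open>Second order derivatives in a moving frame\<close>

definition sff_at_one :: "'e \<Rightarrow> 'e \<Rightarrow> 'f" where "sff_at_one u v = H.conn (lie_map u) (lie_map v) - lie_map (G.conn u v)"

lemma sff_at_one_bilinear: "bilinear sff_at_one"
  unfolding bilinear_def
  by (auto intro!: linearI simp: sff_at_one_def linear_add[OF lie_map_linear] linear_scale[OF lie_map_linear]
      bilinear_simps[OF H.conn_bilinear] bilinear_simps[OF G.conn_bilinear] scaleR_diff_right)

text \<open>The terms with \<open>C j (E p)\<close> occur in the covariant derivative of
  \<open>E\<close>, and with the same coefficients in that of its image under the differential of
  \<phi>. Their difference is free of them, so only the value \<open>e\<close> of the frame at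
  \<open>p\<close> matters.\<close>

lemma frame_second_fundamental_form:
  assumes p: "p \<in> carrier G" and W: "openin (mtop M) W" "p \<in> W" and e: "E p = G.U e p"
    and E: "\<And>q. q \<in> W \<Longrightarrow> E q = (\<Sum>j<n. c j q *\<^sub>R G.U (l j) q)" and es: "e = (\<Sum>j<n. c j p *\<^sub>R l j)"
    and C: "\<And>j. ((\<lambda>x. c j (chart_inv (chart_at M p) x)) has_derivative C j) (at (snd (chart_at M p) p))"
  shows "levi_civita M E E p = G.U ((\<Sum>j<n. C j (E p) *\<^sub>R l j) + G.conn e e) p"
    "second_fundamental_form M N \<phi> E E p = H.U (sff_at_one e e) (\<phi> p)"
proof -
  have Wc: "q \<in> carrier G" if "q \<in> W" for q using openin_subset[OF W(1)] that G.points by blast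
  have dE: "differential M N \<phi> q (E q) = (\<Sum>j<n. c j q *\<^sub>R H.U (lie_map (l j)) (\<phi> q))" if "q \<in> W" for q
  proof -
    note ld = differential_linear[OF G.smooth_manifold H.smooth_manifold smooth, unfolded G.points, OF Wc[OF that]]
    show ?thesis
      unfolding E[OF that] linear_sum[OF ld] linear_scale[OF ld] differential_U[OF Wc[OF that]] ..
  qed
  show lc: "levi_civita M E E p = G.U ((\<Sum>j<n. C j (E p) *\<^sub>R l j) + G.conn e e) p"
  proof -
    have "cov_deriv M p (G.U e p) E = G.U (\<Sum>j<n. C j (G.U e p) *\<^sub>R l j + c j p *\<^sub>R G.conn e (l j)) p"
      by (rule G.cov_deriv_frame[where c = c and w = l and C = C, OF p W E C])
    moreover have "G.conn e e = (\<Sum>j<n. c j p *\<^sub>R G.conn e (l j))"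
      by (subst (2) es) (simp add: bilinear_simps[OF G.conn_bilinear])
    ultimately show ?thesis by (simp add: levi_civita_eq e sum.distrib)
  qed
  have "pullback_conn M N \<phi> p (E p) (\<lambda>q. differential M N \<phi> q (E q)) =
    H.U ((\<Sum>j<n. C j (E p) *\<^sub>R lie_map (l j)) + H.conn (lie_map e) (lie_map e)) (\<phi> p)"
  proof -
    have "pullback_conn M N \<phi> p (G.U e p) (\<lambda>q. differential M N \<phi> q (E q)) =
      H.U (\<Sum>j<n. C j (G.U e p) *\<^sub>R lie_map (l j) + c j p *\<^sub>R H.conn (lie_map e) (lie_map (l j))) (\<phi> p)"
      by (rule pullback_conn_frame[where c = c and w = "\<lambda>j. lie_map (l j)" and C = C, OF p W dE C])
    moreover have "H.conn (lie_map e) (lie_map e) = (\<Sum>j<n. c j p *\<^sub>R H.conn (lie_map e) (lie_map (l j)))"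
      by (subst (2) es) (simp add: bilinear_simps[OF H.conn_bilinear] linear_sum[OF lie_map_linear] linear_scale[OF lie_map_linear])
    ultimately show ?thesis by (simp add: e sum.distrib)
  qed
  then show "second_fundamental_form M N \<phi> E E p = H.U (sff_at_one e e) (\<phi> p)"
    unfolding second_fundamental_form_def lc differential_U[OF p] sff_at_one_def
    by (simp add: linear_add[OF lie_map_linear] linear_sum[OF lie_map_linear] linear_scale[OF lie_map_linear]
        linear_diff[OF H.U_linear[OF phi_closed[OF p]], symmetric])
qed

text \<open>\<open>V\<close> has constant coefficients, so only the coefficients of the frame are
  differentiated, and the correction along the covariant derivative of \<open>E\<close> removes
  these terms.\<close>

lemma frame_second_pullback_derivative:
  assumes p: "p \<in> carrier G" and W: "openin (mtop M) W" "p \<in> W" and e: "E p = G.U e p"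
    and E: "\<And>q. q \<in> W \<Longrightarrow> E q = (\<Sum>j<n. c j q *\<^sub>R G.U (l j) q)" and es: "e = (\<Sum>j<n. c j p *\<^sub>R l j)"
    and EU: "\<And>q. q \<in> W \<Longrightarrow> E q = G.U (\<Sum>j<n. c j q *\<^sub>R l j) q"
    and C: "\<And>j. ((\<lambda>x. c j (chart_inv (chart_at M p) x)) has_derivative C j) (at (snd (chart_at M p) p))"
    and V: "\<And>q. q \<in> carrier G \<Longrightarrow> V q = H.U t (\<phi> q)"
  shows "second_pullback_derivative M N \<phi> E E V p =
    H.U (H.conn (lie_map e) (H.conn (lie_map e) t) - H.conn (lie_map (G.conn e e)) t) (\<phi> p)"
proof -
  have Wc: "q \<in> carrier G" if "q \<in> W" for q using openin_subset[OF W(1)] that G.points by blast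
  \<comment> \<open>The Leibniz rule with one summand, whose coefficient is the constant 1.\<close>
  have VU: "pullback_conn M N \<phi> q (G.U u q) V = H.U (H.conn (lie_map u) t) (\<phi> q)" if q: "q \<in> carrier G" for q u
    using pullback_conn_frame[where I = "{0::nat}" and c = "\<lambda>_ _. 1" and w = "\<lambda>_. t" and C = "\<lambda>_ _. 0"
        and u = u and V = V, OF q openin_topspace] q V
    by (simp add: G.points)
  have dV: "pullback_conn M N \<phi> q (E q) V = (\<Sum>j<n. c j q *\<^sub>R H.U (H.conn (lie_map (l j)) t) (\<phi> q))" if "q \<in> W" for q
    unfolding EU[OF that] VU[OF Wc[OF that]]
    by (simp add: linear_sum[OF lie_map_linear] linear_scale[OF lie_map_linear] bilinear_simps[OF H.conn_bilinear]
        linear_sum[OF H.U_linear[OF phi_closed[OF Wc[OF that]]]] linear_scale[OF H.U_linear[OF phi_closed[OF Wc[OF that]]]])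
  have "pullback_conn M N \<phi> p (E p) (\<lambda>q. pullback_conn M N \<phi> q (E q) V) =
    H.U ((\<Sum>j<n. C j (E p) *\<^sub>R H.conn (lie_map (l j)) t) + H.conn (lie_map e) (H.conn (lie_map e) t)) (\<phi> p)"
  proof -
    have "pullback_conn M N \<phi> p (G.U e p) (\<lambda>q. pullback_conn M N \<phi> q (E q) V) =
      H.U (\<Sum>j<n. C j (G.U e p) *\<^sub>R H.conn (lie_map (l j)) t + c j p *\<^sub>R H.conn (lie_map e) (H.conn (lie_map (l j)) t)) (\<phi> p)"
      by (rule pullback_conn_frame[where c = c and w = "\<lambda>j. H.conn (lie_map (l j)) t" and C = C, OF p W dV C])
    moreover have "H.conn (lie_map e) (H.conn (lie_map e) t) = (\<Sum>j<n. c j p *\<^sub>R H.conn (lie_map e) (H.conn (lie_map (l j)) t))"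
      by (subst (2) es) (simp add: bilinear_simps[OF H.conn_bilinear] linear_sum[OF lie_map_linear] linear_scale[OF lie_map_linear])
    ultimately show ?thesis by (simp add: e sum.distrib)
  qed
  moreover have "levi_civita M E E p = G.U ((\<Sum>j<n. C j (E p) *\<^sub>R l j) + G.conn e e) p"
    by (rule frame_second_fundamental_form(1)[where c = c and l = l and C = C, OF p W e E es C])
  ultimately show ?thesis
    by (simp add: second_pullback_derivative_def VU[OF p] linear_add[OF lie_map_linear] linear_sum[OF lie_map_linear] linear_scale[OF lie_map_linear]
        bilinear_simps[OF H.conn_bilinear] linear_diff[OF H.U_linear[OF phi_closed[OF p]], symmetric])
qed

section \<open>Tension and bitension fields in the Lie algebra\<close>

text \<open>The value at the unit of the tension field, which is left invariant along \<open>\<phi>\<close>.\<close>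

definition tension_at_one :: 'f where
  "tension_at_one = (\<Sum>i<dim (UNIV::'e set). let l = SOME l. orthonormal (riem_metric M \<one>\<^bsub>G\<^esub>) (dim (UNIV::'e set)) l
    in sff_at_one (l i) (l i))"

text \<open>Each point supplies its own basis \<open>e\<close> through the chosen frame; invariance
  of the trace makes all of them give one value.\<close>

lemma tension_at_one_eq:
  assumes "orthonormal (riem_metric M \<one>\<^bsub>G\<^esub>) (dim (UNIV::'e set)) e"
  shows "tension_at_one = (\<Sum>i<dim (UNIV::'e set). sff_at_one (e i) (e i))"
  unfolding tension_at_one_def Let_def
  by (rule orthonormal_trace_independent[OF G.fd G.scalar_product_riem_metric[OF G.one_closed] _ assms sff_at_one_bilinear])
    (rule someI[of "orthonormal (riem_metric M \<one>\<^bsub>G\<^esub>) (dim (UNIV::'e set))", OF assms])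

lemma tension_eq:
  assumes p: "p \<in> carrier G"
  shows "tension M N \<phi> p = H.U tension_at_one (\<phi> p)"
proof -
  let ?n = "dim (UNIV::'e set)"
  obtain l where l: "orthonormal (riem_metric M \<one>\<^bsub>G\<^esub>) ?n l"
    using orthonormal_exists[OF G.fd G.scalar_product_riem_metric[OF G.one_closed]] .
  obtain W where W: "p \<in> W" "orthonormal_frame_on M W (local_frame M p)"
    using G.local_frame[OF p] .
  have oW: "openin (mtop M) W" using W(2) by (simp add: orthonormal_frame_on_def)
  obtain c C e where
    E: "\<And>i q. q \<in> W \<Longrightarrow> local_frame M p i q = (\<Sum>j<?n. c i j q *\<^sub>R G.U (l j) q)" and
    C: "\<And>i j. i < ?n \<Longrightarrow>
      ((\<lambda>x. c i j (chart_inv (chart_at M p) x)) has_derivative C i j) (at (snd (chart_at M p) p))" and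
    es: "\<And>i. e i = (\<Sum>j<?n. c i j p *\<^sub>R l j)" and
    e: "orthonormal (riem_metric M \<one>\<^bsub>G\<^esub>) ?n e" and Ep: "\<And>i. local_frame M p i p = G.U (e i) p"
    by (rule G.frame_expansion[OF l W(2,1)]) (rule that; assumption)
  have "second_fundamental_form M N \<phi> (local_frame M p i) (local_frame M p i) p = H.U (sff_at_one (e i) (e i)) (\<phi> p)"
    if "i < ?n" for i
    by (rule frame_second_fundamental_form(2)[where c = "c i" and l = l and C = "C i",
          OF p oW W(1) Ep E es C[OF that]])
  then show ?thesis
    by (simp add: tension_def Let_def tension_at_one_eq[OF e] linear_sum[OF H.U_linear[OF phi_closed[OF p]]])
qed

text \<open>The basis depends on \<open>p\<close>, hence \<open>obtains\<close>. The curvature is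
  left at \<open>\<phi> p\<close>: what is used of it is its vanishing for zero tension and its sign
  at the unit.\<close>

lemma bitension_eq:
  assumes p: "p \<in> carrier G"
  obtains e where "orthonormal (riem_metric M \<one>\<^bsub>G\<^esub>) (dim (UNIV::'e set)) e"
    "bitension M N \<phi> p = - (\<Sum>i<dim (UNIV::'e set).
      H.U (H.conn (lie_map (e i)) (H.conn (lie_map (e i)) tension_at_one) - H.conn (lie_map (G.conn (e i) (e i))) tension_at_one) (\<phi> p)
      + curvature N (\<phi> p) (H.U tension_at_one (\<phi> p)) (H.U (lie_map (e i)) (\<phi> p)) (H.U (lie_map (e i)) (\<phi> p)))"
proof -
  let ?n = "dim (UNIV::'e set)"
  obtain l where l: "orthonormal (riem_metric M \<one>\<^bsub>G\<^esub>) ?n l"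
    using orthonormal_exists[OF G.fd G.scalar_product_riem_metric[OF G.one_closed]] .
  obtain W where W: "p \<in> W" "orthonormal_frame_on M W (local_frame M p)"
    using G.local_frame[OF p] .
  have oW: "openin (mtop M) W" using W(2) by (simp add: orthonormal_frame_on_def)
  obtain c C e where
    E: "\<And>i q. q \<in> W \<Longrightarrow> local_frame M p i q = (\<Sum>j<?n. c i j q *\<^sub>R G.U (l j) q)" and
    C: "\<And>i j. i < ?n \<Longrightarrow>
      ((\<lambda>x. c i j (chart_inv (chart_at M p) x)) has_derivative C i j) (at (snd (chart_at M p) p))" and
    es: "\<And>i. e i = (\<Sum>j<?n. c i j p *\<^sub>R l j)" and
    e: "orthonormal (riem_metric M \<one>\<^bsub>G\<^esub>) ?n e" and Ep: "\<And>i. local_frame M p i p = G.U (e i) p" and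
    EU: "\<And>i q. q \<in> W \<Longrightarrow> local_frame M p i q = G.U (\<Sum>j<?n. c i j q *\<^sub>R l j) q"
    by (rule G.frame_expansion[OF l W(2,1)]) (rule that; assumption)
  have "second_pullback_derivative M N \<phi> (local_frame M p i) (local_frame M p i) (tension M N \<phi>) p =
      H.U (H.conn (lie_map (e i)) (H.conn (lie_map (e i)) tension_at_one) - H.conn (lie_map (G.conn (e i) (e i))) tension_at_one) (\<phi> p)"
    if "i < ?n" for i
    by (rule frame_second_pullback_derivative[where c = "c i" and l = l and C = "C i",
          OF p oW W(1) Ep E es EU C[OF that] tension_eq])
  then have "bitension M N \<phi> p = - (\<Sum>i<dim (UNIV::'e set).
      H.U (H.conn (lie_map (e i)) (H.conn (lie_map (e i)) tension_at_one) - H.conn (lie_map (G.conn (e i) (e i))) tension_at_one) (\<phi> p)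
      + curvature N (\<phi> p) (H.U tension_at_one (\<phi> p)) (H.U (lie_map (e i)) (\<phi> p)) (H.U (lie_map (e i)) (\<phi> p)))"
    by (simp add: bitension_def Let_def tension_eq[OF p] Ep differential_U[OF p])
  with e show ?thesis by (rule that)
qed

section \<open>The equivalence of harmonicity and biharmonicity\<close>

theorem harmonic_iff_biharmonic:
  assumes np: "nonpositive_sectional_curvature N" and unimodular: "unimodular_lie_algebra G M"
  shows "harmonic M N \<phi> \<longleftrightarrow> biharmonic M N \<phi>"
proof
  assume harm: "harmonic M N \<phi>"
  then have "H.U tension_at_one (\<phi> \<one>\<^bsub>G\<^esub>) = 0"
    using tension_eq[OF G.one_closed] G.one_closed by (simp add: harmonic_def G.points)
  then have t: "tension_at_one = 0" using H.U_eq_0[OF phi_closed[OF G.one_closed]] by blast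
  show "biharmonic M N \<phi>"
    unfolding biharmonic_def
  proof
    fix p assume "p \<in> points M"
    then have p: "p \<in> carrier G" by (simp add: G.points)
    note q = phi_closed[OF p]
    have U0: "H.U 0 (\<phi> p) = 0" by (rule linear_0[OF H.U_linear[OF q]])
    \<comment> \<open>The zero vector is the multiple \<open>0 *\<^sub>R v\<close> of the second
      argument.\<close>
    have R: "curvature N (\<phi> p) 0 v w = 0" for v w
      using H.curvature_dependent(1)[OF q, of 0 v w] by simp
    obtain e where "bitension M N \<phi> p = - (\<Sum>i<dim (UNIV::'e set).
      H.U (H.conn (lie_map (e i)) (H.conn (lie_map (e i)) tension_at_one) - H.conn (lie_map (G.conn (e i) (e i))) tension_at_one) (\<phi> p)
      + curvature N (\<phi> p) (H.U tension_at_one (\<phi> p)) (H.U (lie_map (e i)) (\<phi> p)) (H.U (lie_map (e i)) (\<phi> p)))"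
      by (rule bitension_eq[OF p])
    then show "bitension M N \<phi> p = 0"
      by (simp add: t U0 R bilinear_simps[OF H.conn_bilinear])
  qed
next
  assume bih: "biharmonic M N \<phi>"
  let ?n = "dim (UNIV::'e set)" let ?g = "riem_metric N \<one>\<^bsub>H\<^esub>"
  have sp: "scalar_product ?g" by (rule H.scalar_product_riem_metric[OF H.one_closed])
  obtain e where e: "orthonormal (riem_metric M \<one>\<^bsub>G\<^esub>) ?n e" and
    b: "bitension M N \<phi> \<one>\<^bsub>G\<^esub> = - (\<Sum>i<?n.
      H.U (H.conn (lie_map (e i)) (H.conn (lie_map (e i)) tension_at_one) - H.conn (lie_map (G.conn (e i) (e i))) tension_at_one) (\<phi> \<one>\<^bsub>G\<^esub>)
      + curvature N (\<phi> \<one>\<^bsub>G\<^esub>) (H.U tension_at_one (\<phi> \<one>\<^bsub>G\<^esub>)) (H.U (lie_map (e i)) (\<phi> \<one>\<^bsub>G\<^esub>)) (H.U (lie_map (e i)) (\<phi> \<one>\<^bsub>G\<^esub>)))"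
    by (rule bitension_eq[OF G.one_closed])
  define A where "A i = H.conn (lie_map (e i)) tension_at_one" for i
  define K where "K i = curvature N \<one>\<^bsub>H\<^esub> tension_at_one (lie_map (e i)) (lie_map (e i))" for i
  have tr: "(\<Sum>i<?n. G.conn (e i) (e i)) = 0" by (rule G.unimodular_conn[OF unimodular e])
  \<comment> \<open>By linearity the first order corrections of the second derivatives add up to the
    derivative along the image of the trace, which unimodularity makes zero.\<close>
  have "(\<Sum>i<?n. H.conn (lie_map (G.conn (e i) (e i))) tension_at_one) = H.conn (lie_map (\<Sum>i<?n. G.conn (e i) (e i))) tension_at_one"
    by (simp add: linear_sum[OF lie_map_linear] bilinear_simps[OF H.conn_bilinear])
  then have tr': "(\<Sum>i<?n. H.conn (lie_map (G.conn (e i) (e i))) tension_at_one) = 0"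
    by (simp add: tr linear_0[OF lie_map_linear] bilinear_simps[OF H.conn_bilinear])
  have "bitension M N \<phi> \<one>\<^bsub>G\<^esub> = - (\<Sum>i<?n. H.conn (lie_map (e i)) (A i) + K i)"
    unfolding b phi_one H.U_one A_def[symmetric] K_def[symmetric] sum.distrib sum_subtractf tr' by simp
  then have "(\<Sum>i<?n. H.conn (lie_map (e i)) (A i) + K i) = 0"
    using bih G.one_closed by (simp add: biharmonic_def G.points)
  then have "?g (\<Sum>i<?n. H.conn (lie_map (e i)) (A i) + K i) tension_at_one = 0"
    by (simp add: scalar_product_simps[OF sp])
  \<comment> \<open>Skewness moves one derivative to the other factor, in place of an integration by
    parts.\<close>
  moreover have "?g (H.conn (lie_map (e i)) (A i)) tension_at_one = - ?g (A i) (A i)" for i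
    using H.conn_skew[of "lie_map (e i)" "A i" tension_at_one] by (simp add: A_def)
  ultimately have "(\<Sum>i<?n. ?g (A i) (A i) - ?g (K i) tension_at_one) = 0"
    by (simp add: scalar_product_simps[OF sp] sum.distrib sum_subtractf sum_negf)
  moreover have "0 \<le> ?g (A i) (A i)" for i by (rule scalar_product_nonneg[OF sp])
  moreover have "?g (K i) tension_at_one \<le> 0" for i
    unfolding K_def by (rule H.curvature_nonpositive[OF H.one_closed np])
  ultimately have "?g (A i) (A i) - ?g (K i) tension_at_one = 0" if "i < ?n" for i
    using sum_nonneg_eq_0_iff[of "{..<?n}" "\<lambda>i. ?g (A i) (A i) - ?g (K i) tension_at_one"] that
    by (smt (verit) finite_lessThan lessThan_iff)
  then have A0: "A i = 0" if "i < ?n" for i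
    using \<open>\<And>i. 0 \<le> ?g (A i) (A i)\<close>[of i] \<open>\<And>i. ?g (K i) tension_at_one \<le> 0\<close>[of i] that
    by (intro scalar_product_eq_0[OF sp]) fastforce
  \<comment> \<open>Second use of unimodularity: the part of the tension coming from the connection
    of \<open>G\<close> vanishes.\<close>
  have "tension_at_one = (\<Sum>i<?n. H.conn (lie_map (e i)) (lie_map (e i)))"
    unfolding tension_at_one_eq[OF e] sff_at_one_def sum_subtractf linear_sum[OF lie_map_linear, symmetric] tr
    by (simp add: linear_0[OF lie_map_linear])
  then have "?g tension_at_one tension_at_one = (\<Sum>i<?n. ?g (H.conn (lie_map (e i)) (lie_map (e i))) tension_at_one)"
    using scalar_product_simps(11)[OF sp, of "\<lambda>i. H.conn (lie_map (e i)) (lie_map (e i))" "{..<?n}" tension_at_one] by simp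
  also have "\<dots> = 0"
  proof (rule sum.neutral, intro ballI)
    fix i assume "i \<in> {..<?n}"
    then show "?g (H.conn (lie_map (e i)) (lie_map (e i))) tension_at_one = 0"
      using H.conn_skew[of "lie_map (e i)" "lie_map (e i)" tension_at_one] A0[of i]
      by (simp add: A_def scalar_product_simps[OF sp])
  qed
  finally have "tension_at_one = 0" by (rule scalar_product_eq_0[OF sp])
  \<comment> \<open>Vanishing at the unit spreads to every point by left invariance along
    \<phi>.\<close>
  then show "harmonic M N \<phi>"
    unfolding harmonic_def G.points
    using tension_eq linear_0[OF H.U_linear[OF phi_closed]] by simp
qed

end

theorem theorem6p1:
  fixes G :: "'g monoid" and MG :: "('g, 'e::real_inner) riem_manifold"
    and H :: "'h monoid" and MH :: "('h, 'f::real_inner) riem_manifold"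
    and \<phi> :: "'g \<Rightarrow> 'h"
  assumes "riemannian_lie_group G MG" and "connected_space (mtop MG)"
    and "riemannian_lie_group H MH" and "connected_space (mtop MH)"
    and "\<phi> \<in> hom G H" and "smooth_map MG MH \<phi>"
    and "nonpositive_sectional_curvature MH"
    and "unimodular_lie_algebra G MG"
  shows "harmonic MG MH \<phi> \<longleftrightarrow> biharmonic MG MH \<phi>"
proof -
  interpret riem_lie_group_hom G MG H MH \<phi>
    by unfold_locales (use assms in auto)
  show ?thesis using harmonic_iff_biharmonic assms(7,8) by blast
qed

end
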